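(* Let $L$ be a (classical first-order) signature and let $M$ and $N$ be two $L$-structures. The following are equivalent: (i) $M \equiv_{\mathrm{P}} N$; (ii) $M^{\mathrm{Fin}^\ast} \equiv N^{\mathrm{Fin}^\ast}$; (iii) $M^{\mathrm{Fin}^\ast \otimes U} \simeq N^{\mathrm{Fin}^\ast \otimes U}$ for some ultrafilter $U$; (iv) $M^{F} \simeq N^{F}$ for some filter $F$; (v) $M^{F} \equiv_{\mathrm{P}} N^{F}$ for some filter $F$.
   Context: Classical first-order logic with equality; structures are nonempty. All filters are proper filters on (nonempty) sets. Reduced products: for a family $(M_i)_{i\in I}$ of $L$-structures and a filter $F$ on $I$, let $a\sim_F b$ on $\prod_i M_i$ iff $\{i : a_i=b_i\}\in F$. The reduced product $M_F=\prod_i M_i/F$ has domain $\prod_i M_i/\sim_F$; a relation $R$ holds of the class of $(a_i)_i$ iff $\{i : M_i\models R(a_i)\}\in F$, and functions (and constants) are interpreted coordinatewise. If all $M_i=N$, this is the reduced power $N^F$. $\mathrm{Fin}^\ast$ is the Fréchet filter on $\omega$ (all cofinite subsets of $\omega$). For an ultrafilter $U$ on a set $J$, $\mathrm{Fin}^\ast\otimes U$ is the filter on $\omega\times J$ consisting of the sets $A$ such that $\{ j\in J : \{ n<\omega : (n,j)\in A\}\in \mathrm{Fin}^\ast\}\in U$, so that $M^{\mathrm{Fin}^\ast\otimes U}\simeq (M^{\mathrm{Fin}^\ast})^U$. Palyutin formulas: the smallest set of first-order formulas such that (1) it contains $\top$, $\bot$ and all atomic formulas; (2) it is closed under conjunction,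 $\exists$ and $\forall$; (3) if $\varphi,\psi$ are Palyutin formulas and $x$ is any variable, then $(\exists x\,\varphi) \wedge \forall x\,(\varphi \rightarrow \psi)$ is a Palyutin formula. A Palyutin sentence is a Palyutin formula with no free variables. $M\equiv_{\mathrm{P}} N$ means that $M$ and $N$ satisfy the same Palyutin sentences; $\equiv$ is elementary equivalence and $\simeq$ is isomorphism. *)

theory Defs
  imports Complex_Main "HOL-Library.FuncSet"
begin

section \<open>First-order logic with equality\<close>

text \<open>
  A signature is given by sets of function and relation symbols (so that, e.g., purely relational
  signatures are covered although HOL types are nonempty) together with their arities. Constants are
  function symbols of arity 0.
\<close>

record ('f, 'p) fo_signature =
  funs :: "'f set"
  rels :: "'p set"
  funar :: "'f \<Rightarrow> nat"
  relar :: "'p \<Rightarrow> nat"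

datatype 'f tm = Var nat | App 'f "'f tm list"

datatype ('f, 'p) fm =
    Top
  | Bot
  | Eq "'f tm" "'f tm"
  | Rel 'p "'f tm list"
  | Neg "('f, 'p) fm"
  | Conj "('f, 'p) fm" "('f, 'p) fm"
  | Disj "('f, 'p) fm" "('f, 'p) fm"
  | Imp "('f, 'p) fm" "('f, 'p) fm"
  | Ex nat "('f, 'p) fm"
  | All nat "('f, 'p) fm"

fun is_tm :: "('f, 'p) fo_signature \<Rightarrow> 'f tm \<Rightarrow> bool" where
  "is_tm L (Var x) \<longleftrightarrow> True"
| "is_tm L (App f ts) \<longleftrightarrow> f \<in> funs L \<and> length ts = funar L f \<and> (\<forall>t\<in>set ts. is_tm L t)"

fun is_fm :: "('f, 'p) fo_signature \<Rightarrow> ('f, 'p) fm \<Rightarrow> bool" where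
  "is_fm L Top \<longleftrightarrow> True"
| "is_fm L Bot \<longleftrightarrow> True"
| "is_fm L (Eq s t) \<longleftrightarrow> is_tm L s \<and> is_tm L t"
| "is_fm L (Rel r ts) \<longleftrightarrow> r \<in> rels L \<and> length ts = relar L r \<and> (\<forall>t\<in>set ts. is_tm L t)"
| "is_fm L (Neg \<phi>) \<longleftrightarrow> is_fm L \<phi>"
| "is_fm L (Conj \<phi> \<psi>) \<longleftrightarrow> is_fm L \<phi> \<and> is_fm L \<psi>"
| "is_fm L (Disj \<phi> \<psi>) \<longleftrightarrow> is_fm L \<phi> \<and> is_fm L \<psi>"
| "is_fm L (Imp \<phi> \<psi>) \<longleftrightarrow> is_fm L \<phi> \<and> is_fm L \<psi>"
| "is_fm L (Ex x \<phi>) \<longleftrightarrow> is_fm L \<phi>"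
| "is_fm L (All x \<phi>) \<longleftrightarrow> is_fm L \<phi>"

fun tm_vars :: "'f tm \<Rightarrow> nat set" where
  "tm_vars (Var x) = {x}"
| "tm_vars (App f ts) = (\<Union>t\<in>set ts. tm_vars t)"

fun free_vars :: "('f, 'p) fm \<Rightarrow> nat set" where
  "free_vars Top = {}"
| "free_vars Bot = {}"
| "free_vars (Eq s t) = tm_vars s \<union> tm_vars t"
| "free_vars (Rel r ts) = (\<Union>t\<in>set ts. tm_vars t)"
| "free_vars (Neg \<phi>) = free_vars \<phi>"
| "free_vars (Conj \<phi> \<psi>) = free_vars \<phi> \<union> free_vars \<psi>"
| "free_vars (Disj \<phi> \<psi>) = free_vars \<phi> \<union> free_vars \<psi>"
| "free_vars (Imp \<phi> \<psi>) = free_vars \<phi> \<union> free_vars \<psi>"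
| "free_vars (Ex x \<phi>) = free_vars \<phi> - {x}"
| "free_vars (All x \<phi>) = free_vars \<phi> - {x}"

text \<open>
  The interpretations are total HOL functions on lists; their values matter only for symbols of the
  signature and lists of the right length over the domain.
\<close>

record ('f, 'p, 'a) fo_structure =
  Dom :: "'a set"
  fun_int :: "'f \<Rightarrow> 'a list \<Rightarrow> 'a"
  rel_int :: "'p \<Rightarrow> 'a list \<Rightarrow> bool"

definition is_structure :: "('f, 'p) fo_signature \<Rightarrow> ('f, 'p, 'a) fo_structure \<Rightarrow> bool" where
  "is_structure L M \<longleftrightarrow>
     Dom M \<noteq> {} \<and>
     (\<forall>f\<in>funs L. \<forall>as. set as \<subseteq> Dom M \<and> length as = funar L f \<longrightarrow> fun_int M f as \<in> Dom M)"

fun tm_val :: "('f, 'p, 'a) fo_structure \<Rightarrow> (nat \<Rightarrow> 'a) \<Rightarrow> 'f tm \<Rightarrow> 'a" where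
  "tm_val M e (Var x) = e x"
| "tm_val M e (App f ts) = fun_int M f (map (tm_val M e) ts)"

fun sat :: "('f, 'p, 'a) fo_structure \<Rightarrow> (nat \<Rightarrow> 'a) \<Rightarrow> ('f, 'p) fm \<Rightarrow> bool" where
  "sat M e Top \<longleftrightarrow> True"
| "sat M e Bot \<longleftrightarrow> False"
| "sat M e (Eq s t) \<longleftrightarrow> tm_val M e s = tm_val M e t"
| "sat M e (Rel r ts) \<longleftrightarrow> rel_int M r (map (tm_val M e) ts)"
| "sat M e (Neg \<phi>) \<longleftrightarrow> \<not> sat M e \<phi>"
| "sat M e (Conj \<phi> \<psi>) \<longleftrightarrow> sat M e \<phi> \<and> sat M e \<psi>"
| "sat M e (Disj \<phi> \<psi>) \<longleftrightarrow> sat M e \<phi> \<or> sat M e \<psi>"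
| "sat M e (Imp \<phi> \<psi>) \<longleftrightarrow> (sat M e \<phi> \<longrightarrow> sat M e \<psi>)"
| "sat M e (Ex x \<phi>) \<longleftrightarrow> (\<exists>a\<in>Dom M. sat M (e(x := a)) \<phi>)"
| "sat M e (All x \<phi>) \<longleftrightarrow> (\<forall>a\<in>Dom M. sat M (e(x := a)) \<phi>)"

definition models :: "('f, 'p, 'a) fo_structure \<Rightarrow> ('f, 'p) fm \<Rightarrow> bool" where
  "models M \<phi> \<longleftrightarrow> (\<forall>e. range e \<subseteq> Dom M \<longrightarrow> sat M e \<phi>)"

definition elem_equiv ::
  "('f, 'p) fo_signature \<Rightarrow> ('f, 'p, 'a) fo_structure \<Rightarrow> ('f, 'p, 'b) fo_structure \<Rightarrow> bool" where
  "elem_equiv L M N \<longleftrightarrow>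
     (\<forall>\<phi>. is_fm L \<phi> \<and> free_vars \<phi> = {} \<longrightarrow> (models M \<phi> \<longleftrightarrow> models N \<phi>))"

definition isomorphic ::
  "('f, 'p) fo_signature \<Rightarrow> ('f, 'p, 'a) fo_structure \<Rightarrow> ('f, 'p, 'b) fo_structure \<Rightarrow> bool" where
  "isomorphic L M N \<longleftrightarrow>
     (\<exists>h. bij_betw h (Dom M) (Dom N) \<and>
        (\<forall>f\<in>funs L. \<forall>as. set as \<subseteq> Dom M \<and> length as = funar L f \<longrightarrow>
           h (fun_int M f as) = fun_int N f (map h as)) \<and>
        (\<forall>r\<in>rels L. \<forall>as. set as \<subseteq> Dom M \<and> length as = relar L r \<longrightarrow>
           (rel_int M r as \<longleftrightarrow> rel_int N r (map h as))))"


section \<open>Palyutin formulas\<close>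

inductive_set palyutin :: "('f, 'p) fo_signature \<Rightarrow> ('f, 'p) fm set"
  for L :: "('f, 'p) fo_signature" where
  Top: "Top \<in> palyutin L"
| Bot: "Bot \<in> palyutin L"
| Eq: "is_fm L (Eq s t) \<Longrightarrow> Eq s t \<in> palyutin L"
| Rel: "is_fm L (Rel r ts) \<Longrightarrow> Rel r ts \<in> palyutin L"
| Conj: "\<phi> \<in> palyutin L \<Longrightarrow> \<psi> \<in> palyutin L \<Longrightarrow> Conj \<phi> \<psi> \<in> palyutin L"
| Ex: "\<phi> \<in> palyutin L \<Longrightarrow> Ex x \<phi> \<in> palyutin L"
| All: "\<phi> \<in> palyutin L \<Longrightarrow> All x \<phi> \<in> palyutin L"
| ExAllImp: "\<phi> \<in> palyutin L \<Longrightarrow> \<psi> \<in> palyutin L \<Longrightarrow>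
    Conj (Ex x \<phi>) (All x (Imp \<phi> \<psi>)) \<in> palyutin L"

definition palyutin_equiv ::
  "('f, 'p) fo_signature \<Rightarrow> ('f, 'p, 'a) fo_structure \<Rightarrow> ('f, 'p, 'b) fo_structure \<Rightarrow> bool" where
  "palyutin_equiv L M N \<longleftrightarrow>
     (\<forall>\<phi>\<in>palyutin L. free_vars \<phi> = {} \<longrightarrow> (models M \<phi> \<longleftrightarrow> models N \<phi>))"


section \<open>Filters on sets\<close>

text \<open>
  A proper filter on a set \<open>I\<close> is represented by the filter it generates on the whole type: a set
  \<open>A \<subseteq> I\<close> belongs to it iff \<open>eventually (\<lambda>i. i \<in> A) F\<close>, and \<open>F \<le> principal I\<close> says that \<open>I\<close> itself
  belongs to it. Properness forces \<open>I\<close> to be nonempty.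
\<close>

definition proper_filter_on :: "'i set \<Rightarrow> 'i filter \<Rightarrow> bool" where
  "proper_filter_on I F \<longleftrightarrow> F \<noteq> bot \<and> F \<le> principal I"

definition ultrafilter_on :: "'i set \<Rightarrow> 'i filter \<Rightarrow> bool" where
  "ultrafilter_on J U \<longleftrightarrow> proper_filter_on J U \<and>
     (\<forall>A\<subseteq>J. eventually (\<lambda>j. j \<in> A) U \<or> eventually (\<lambda>j. j \<in> J - A) U)"

text \<open>
  The Frechet filter on \<open>\<omega>\<close> is the library's \<^const>\<open>cofinite\<close> at type \<^typ>\<open>nat\<close>. The next filter is the
  iterated one, \<open>Fin\<^sup>* \<otimes> U\<close>; it is not the library's product filter, which is generated by rectangles.
\<close>

definition Fin_otimes :: "'j filter \<Rightarrow> (nat \<times> 'j) filter" where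
  "Fin_otimes U = Abs_filter (\<lambda>P. eventually (\<lambda>j. eventually (\<lambda>n. P (n, j)) cofinite) U)"

lemma eventually_Fin_otimes:
  "eventually P (Fin_otimes U) \<longleftrightarrow> eventually (\<lambda>j. eventually (\<lambda>n. P (n, j)) cofinite) U"
  unfolding Fin_otimes_def
proof (rule eventually_Abs_filter, rule is_filter.intro)
  fix P Q :: "nat \<times> 'a \<Rightarrow> bool"
  assume P: "\<forall>\<^sub>F j in U. \<forall>\<^sub>F n in cofinite. P (n, j)"
  show "\<forall>\<^sub>F j in U. \<forall>\<^sub>F n in cofinite. P (n, j) \<and> Q (n, j)"
    if "\<forall>\<^sub>F j in U. \<forall>\<^sub>F n in cofinite. Q (n, j)"
    using P that by eventually_elim (rule eventually_conj)
  show "\<forall>\<^sub>F j in U. \<forall>\<^sub>F n in cofinite. Q (n, j)" if "\<forall>x. P x \<longrightarrow> Q x"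
    using P by (rule eventually_mono) (erule eventually_mono, use that in blast)
qed simp

lemma proper_filter_on_cofinite: "proper_filter_on UNIV (cofinite :: nat filter)"
  by (simp add: proper_filter_on_def)

lemma proper_filter_on_Fin_otimes:
  assumes "proper_filter_on J U"
  shows "proper_filter_on (UNIV \<times> J) (Fin_otimes U)"
proof -
  have U: "U \<noteq> bot" "eventually (\<lambda>j. j \<in> J) U"
    using assms by (simp_all add: proper_filter_on_def le_principal)
  have "Fin_otimes U \<noteq> bot"
    using U(1) by (simp add: trivial_limit_def eventually_Fin_otimes eventually_cofinite)
  moreover have "eventually (\<lambda>j. eventually (\<lambda>n. (n :: nat, j) \<in> UNIV \<times> J) cofinite) U"
    using U(2) by (rule eventually_mono) simp
  ultimately show ?thesis
    by (simp add: proper_filter_on_def le_principal eventually_Fin_otimes)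
qed


section \<open>Reduced products and reduced powers\<close>

definition prod_Dom :: "'i set \<Rightarrow> ('i \<Rightarrow> ('f, 'p, 'a) fo_structure) \<Rightarrow> ('i \<Rightarrow> 'a) set" where
  "prod_Dom I M = (\<Pi>\<^sub>E i\<in>I. Dom (M i))"

definition red_rel ::
  "'i set \<Rightarrow> 'i filter \<Rightarrow> ('i \<Rightarrow> ('f, 'p, 'a) fo_structure) \<Rightarrow> (('i \<Rightarrow> 'a) \<times> ('i \<Rightarrow> 'a)) set" where
  "red_rel I F M =
     {(a, b). a \<in> prod_Dom I M \<and> b \<in> prod_Dom I M \<and> eventually (\<lambda>i. a i = b i) F}"

text \<open>
  Symbols are interpreted through chosen representatives of the classes; by
  \<open>red_prod_fun_int\<close> and \<open>red_prod_rel_int\<close> below the choice is irrelevant.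
\<close>

definition rep :: "'b set \<Rightarrow> 'b" where
  "rep c = (SOME a. a \<in> c)"

definition red_prod ::
  "'i set \<Rightarrow> 'i filter \<Rightarrow> ('i \<Rightarrow> ('f, 'p, 'a) fo_structure) \<Rightarrow> ('f, 'p, ('i \<Rightarrow> 'a) set) fo_structure"
where
  "red_prod I F M =
     \<lparr>Dom = prod_Dom I M // red_rel I F M,
      fun_int = (\<lambda>f cs. red_rel I F M `` {\<lambda>i\<in>I. fun_int (M i) f (map (\<lambda>c. rep c i) cs)}),
      rel_int = (\<lambda>r cs. eventually (\<lambda>i. rel_int (M i) r (map (\<lambda>c. rep c i) cs)) F)\<rparr>"

definition red_power ::
  "'i set \<Rightarrow> 'i filter \<Rightarrow> ('f, 'p, 'a) fo_structure \<Rightarrow> ('f, 'p, ('i \<Rightarrow> 'a) set) fo_structure" where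
  "red_power I F N = red_prod I F (\<lambda>_. N)"

lemma equiv_red_rel: "equiv (prod_Dom I M) (red_rel I F M)"
proof (rule equivI)
  show "red_rel I F M \<subseteq> prod_Dom I M \<times> prod_Dom I M"
    by (auto simp: red_rel_def)
  show "refl_on (prod_Dom I M) (red_rel I F M)"
    by (auto simp: refl_on_def red_rel_def)
  show "sym (red_rel I F M)"
    by (auto simp: sym_def red_rel_def eq_commute)
  show "trans (red_rel I F M)"
  proof (rule transI)
    fix a b c assume ab: "(a, b) \<in> red_rel I F M" and bc: "(b, c) \<in> red_rel I F M"
    then have "eventually (\<lambda>i. a i = b i) F" "eventually (\<lambda>i. b i = c i) F"
      by (simp_all add: red_rel_def)
    then have "eventually (\<lambda>i. a i = c i) F"
      by (rule eventually_elim2) simp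
    with ab bc show "(a, c) \<in> red_rel I F M"
      by (simp add: red_rel_def)
  qed
qed

lemma eventually_rep_class:
  assumes "set as \<subseteq> prod_Dom I M"
  shows "eventually (\<lambda>i. map (\<lambda>c. rep c i) (map (\<lambda>a. red_rel I F M `` {a}) as)
           = map (\<lambda>a. a i) as) F"
proof -
  have "\<forall>a\<in>set as. eventually (\<lambda>i. rep (red_rel I F M `` {a}) i = a i) F"
  proof
    fix a assume "a \<in> set as"
    then have "a \<in> red_rel I F M `` {a}"
      using assms by (auto simp: red_rel_def)
    then have "rep (red_rel I F M `` {a}) \<in> red_rel I F M `` {a}"
      unfolding rep_def by (rule someI[where P = "\<lambda>x. x \<in> _"])
    then show "eventually (\<lambda>i. rep (red_rel I F M `` {a}) i = a i) F"
      by (auto simp: red_rel_def eq_commute)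
  qed
  then show ?thesis
    by (simp add: eventually_ball_finite)
qed

lemma red_prod_fun_int:
  assumes "\<And>i. i \<in> I \<Longrightarrow> is_structure L (M i)"
    and "f \<in> funs L" "length as = funar L f" "set as \<subseteq> prod_Dom I M"
  shows "fun_int (red_prod I F M) f (map (\<lambda>a. red_rel I F M `` {a}) as)
           = red_rel I F M `` {\<lambda>i\<in>I. fun_int (M i) f (map (\<lambda>a. a i) as)}"
proof -
  let ?cs = "map (\<lambda>a. red_rel I F M `` {a}) as"
  have rep: "rep c \<in> prod_Dom I M" if c: "c \<in> set ?cs" for c
  proof -
    from c assms(4) have "\<exists>a. a \<in> c" by (auto simp: red_rel_def)
    then have "rep c \<in> c" unfolding rep_def by (rule someI_ex)
    then show ?thesis using c by (auto simp: red_rel_def)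
  qed
  have 1: "(\<lambda>i\<in>I. fun_int (M i) f (map (\<lambda>c. rep c i) ?cs)) \<in> prod_Dom I M"
    unfolding prod_Dom_def
  proof (rule restrict_PiE_iff[THEN iffD2], rule ballI)
    fix i assume i: "i \<in> I"
    have "set (map (\<lambda>c. rep c i) ?cs) \<subseteq> Dom (M i)"
    proof
      fix x assume "x \<in> set (map (\<lambda>c. rep c i) ?cs)"
      then obtain c where "c \<in> set ?cs" "x = rep c i"
        unfolding set_map[of "\<lambda>c. rep c i"] by (elim imageE)
      with rep i show "x \<in> Dom (M i)"
        unfolding prod_Dom_def by (blast dest: PiE_mem)
    qed
    then show "fun_int (M i) f (map (\<lambda>c. rep c i) ?cs) \<in> Dom (M i)"
      using assms(1)[OF i] assms(2,3) unfolding is_structure_def by simp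
  qed
  have 2: "(\<lambda>i\<in>I. fun_int (M i) f (map (\<lambda>a. a i) as)) \<in> prod_Dom I M"
    unfolding prod_Dom_def
  proof (rule restrict_PiE_iff[THEN iffD2], rule ballI)
    fix i assume i: "i \<in> I"
    have "set (map (\<lambda>a. a i) as) \<subseteq> Dom (M i)"
      using assms(4) i unfolding prod_Dom_def by (auto dest!: subsetD PiE_mem)
    then show "fun_int (M i) f (map (\<lambda>a. a i) as) \<in> Dom (M i)"
      using assms(1)[OF i] assms(2,3) unfolding is_structure_def by simp
  qed
  have "eventually (\<lambda>i. (\<lambda>i\<in>I. fun_int (M i) f (map (\<lambda>c. rep c i) ?cs)) i
                       = (\<lambda>i\<in>I. fun_int (M i) f (map (\<lambda>a. a i) as)) i) F"
    using eventually_rep_class[OF assms(4), of F]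
    by (rule eventually_mono) (simp only: restrict_def)
  with 1 2 have "(\<lambda>i\<in>I. fun_int (M i) f (map (\<lambda>c. rep c i) ?cs),
                  \<lambda>i\<in>I. fun_int (M i) f (map (\<lambda>a. a i) as)) \<in> red_rel I F M"
    by (simp add: red_rel_def)
  from equiv_class_eq[OF equiv_red_rel this] show ?thesis
    by (simp add: red_prod_def)
qed

lemma red_prod_rel_int:
  assumes "set as \<subseteq> prod_Dom I M"
  shows "rel_int (red_prod I F M) r (map (\<lambda>a. red_rel I F M `` {a}) as)
           \<longleftrightarrow> eventually (\<lambda>i. rel_int (M i) r (map (\<lambda>a. a i) as)) F"
proof -
  have "eventually (\<lambda>i. rel_int (M i) r (map (\<lambda>c. rep c i) (map (\<lambda>a. red_rel I F M `` {a}) as))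
                    \<longleftrightarrow> rel_int (M i) r (map (\<lambda>a. a i) as)) F"
    using eventually_rep_class[OF assms, of F] by (rule eventually_mono) (simp only:)
  then show ?thesis
    by (simp add: red_prod_def eventually_subst)
qed


section \<open>A universe of index sets\<close>

text \<open>
  HOL cannot quantify over all sets inside a formula, so index sets are taken to be subsets of the
  following type. As \<open>'j\<close> is an arbitrary type, every index set of every type embeds into some instance;
  the remaining summands make every instance large enough (two power sets above the size of the
  language and of both structures) to contain the index sets which the Keisler-Shelah theorem
  requires.
\<close>

type_synonym ('j, 'f, 'p, 'a, 'b) idx = "('j + 'f + 'p + 'a + 'b + nat) set set"

end

theory Submission
  imports Defs
begin

text \<open>
  Palyutin formulas satisfy a Los theorem for arbitrary reduced products, so \<open>M \<equiv>\<^sub>P M\<^sup>F\<close> for every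
  filter \<open>F\<close>; hence each of the conditions (ii)-(v) implies \<open>M \<equiv>\<^sub>P N\<close>. Conversely, as \<open>P(\<omega>)/Fin\<close> is
  atomless, in a reduced power modulo the Frechet filter
  \<open>\<exists>x (\<pi> \<and> \<not>\<psi>\<^sub>1 \<and> \<dots> \<and> \<not>\<psi>\<^sub>n)\<close> is equivalent to the conjunction of \<open>\<exists>x \<pi>\<close> and the formulas
  \<open>\<not>(\<exists>x \<pi> \<and> \<forall>x (\<pi> \<rightarrow> \<psi>\<^sub>i))\<close>. Every formula is therefore a Boolean combination of Palyutin formulas
  there, uniformly in the structure, and (ii) follows from (i). Then (iii) is the theorem of
  Keisler and Shelah for the two Frechet powers.

  For Keisler-Shelah (without GCH), let \<open>\<kappa>\<close> bound the sizes of the language and of both structures and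
  take \<open>2\<^sup>\<kappa>\<close> as index set. It carries a family of \<open>2\<close> to the power \<open>2\<^sup>\<kappa>\<close> functions into \<open>\<kappa>\<close> such that any
  \<open>\<kappa>\<close> of them can be prescribed independently. A transfinite back-and-forth construction matches all
  functions from the index set to \<open>M\<close> with functions to \<open>N\<close>: the partner of a given function is a member
  of the family which is still independent of all requirements imposed so far. The sets of
  indices at which matched tuples satisfy the same formulas have the finite intersection property,
  and any ultrafilter containing them makes the matching an isomorphism.
\<close>

section \<open>Satisfaction, isomorphism and reduced products\<close>

text \<open>A filter respects conjunction but neither negation nor disjunction. The guard \<exists>x
  \<phi> in the last clause for Palyutin formulas is what lets an implication through: it provides a
  point satisfying \<phi> in almost every coordinate. In the Keisler-Shelah construction
  2^(2^\<kappa>) functions have to be matched, and the finite intersection property by itself is too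
  weak an induction hypothesis. What is carried along is that every finite set of requirements
  leaves the unspent members of the family independent. The family has as many members as there are
  stages, and everything spent before a given stage has smaller cardinality, so a fresh member
  always exists; this replaces GCH. Prescribing \<kappa> values at once, instead of finitely many,
  pays for the diagonal argument in \<open>indep_graph\<close>, which needs one counterexample for
  every possible value of a function into \<kappa>. In the code \<kappa> is the type
  \<open>'k\<close>, the index set is \<open>'k set\<close>, and stages, tasks and members of the
  family are all indexed by \<open>'k set set\<close>.\<close>

lemma sat_cong:
  fixes M :: "('f, 'p, 'a) fo_structure"
  assumes "\<And>x. x \<in> free_vars \<phi> \<Longrightarrow> e x = e' x"
  shows "sat M e \<phi> \<longleftrightarrow> sat M e' \<phi>"
proof -
  have tm: "tm_val M e t = tm_val M e' t" if "\<And>x. x \<in> tm_vars t \<Longrightarrow> e x = e' x" for t :: "'f tm" and e e' :: "nat \<Rightarrow> 'a"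
    using that
  proof (induction t)
    case (App f ts)
    have "tm_val M e t = tm_val M e' t" if "t \<in> set ts" for t
      by (rule App.IH[OF that]) (use App.prems that in auto)
    then have "map (tm_val M e) ts = map (tm_val M e') ts" by simp
    then show ?case by (simp only: tm_val.simps)
  qed simp
  show ?thesis using assms
  proof (induction \<phi> arbitrary: e e')
    case (Eq s t) then show ?case using tm[of s e e'] tm[of t e e'] by simp
  next
    case (Rel r ts)
    have "tm_val M e t = tm_val M e' t" if "t \<in> set ts" for t
      by (rule tm, rule Rel.prems) (use that in auto)
    then have "map (tm_val M e) ts = map (tm_val M e') ts" by simp
    then show ?case by (simp only: sat.simps)
  next
    case (Neg \<phi>)
    from Neg.IH[of e e'] Neg.prems show ?case by simp
  next
    case (Conj \<phi> \<psi>)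
    from Conj.IH(1)[of e e'] Conj.IH(2)[of e e'] Conj.prems show ?case by simp
  next
    case (Disj \<phi> \<psi>)
    from Disj.IH(1)[of e e'] Disj.IH(2)[of e e'] Disj.prems show ?case by simp
  next
    case (Imp \<phi> \<psi>)
    from Imp.IH(1)[of e e'] Imp.IH(2)[of e e'] Imp.prems show ?case by simp
  next
    case (Ex x \<phi>)
    have "sat M (e(x := a)) \<phi> \<longleftrightarrow> sat M (e'(x := a)) \<phi>" for a
      by (rule Ex.IH) (use Ex.prems in auto)
    then show ?case by simp
  next
    case (All x \<phi>)
    have "sat M (e(x := a)) \<phi> \<longleftrightarrow> sat M (e'(x := a)) \<phi>" for a
      by (rule All.IH) (use All.prems in auto)
    then show ?case by simp
  qed simp_all
qed

lemma finite_free_vars: "finite (free_vars \<phi>)"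
proof -
  have "finite (tm_vars t)" for t :: "'f tm" by (induction t) auto
  then show ?thesis by (induction \<phi>) auto
qed

lemma models_sentence:
  assumes "free_vars \<phi> = {}" and "range e \<subseteq> Dom M"
  shows "models M \<phi> \<longleftrightarrow> sat M e \<phi>"
proof -
  have "sat M e' \<phi> \<longleftrightarrow> sat M e \<phi>" for e'
    by (rule sat_cong) (simp add: assms(1))
  then show ?thesis unfolding models_def using assms(2) by blast
qed

lemma tm_val_in_Dom:
  assumes "is_structure L M" "is_tm L t" "range e \<subseteq> Dom M"
  shows "tm_val M e t \<in> Dom M"
  using assms(2)
proof (induction t)
  case (Var x) then show ?case using assms(3) by auto
next
  case (App f ts)
  then have "set (map (tm_val M e) ts) \<subseteq> Dom M" "length (map (tm_val M e) ts) = funar L f" "f \<in> funs L"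
    by auto
  then show ?case using assms(1) unfolding is_structure_def by simp
qed

lemma range_upd: "range e \<subseteq> D \<Longrightarrow> a \<in> D \<Longrightarrow> range (e(x := a)) \<subseteq> D"
  by auto

lemma isomorphic_sym:
  assumes M: "is_structure L M" and "isomorphic L M N"
  shows "isomorphic L N M"
proof -
  obtain h where h: "bij_betw h (Dom M) (Dom N)"
    and f: "\<And>f as. \<lbrakk>f \<in> funs L; set as \<subseteq> Dom M; length as = funar L f\<rbrakk> \<Longrightarrow>
              h (fun_int M f as) = fun_int N f (map h as)"
    and r: "\<And>r as. \<lbrakk>r \<in> rels L; set as \<subseteq> Dom M; length as = relar L r\<rbrakk> \<Longrightarrow>
              rel_int M r as \<longleftrightarrow> rel_int N r (map h as)"
    using assms(2) unfolding isomorphic_def by blast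
  let ?g = "inv_into (Dom M) h"
  have g: "bij_betw ?g (Dom N) (Dom M)" by (rule bij_betw_inv_into[OF h])
  have pull: "set (map ?g bs) \<subseteq> Dom M" "map h (map ?g bs) = bs" if "set bs \<subseteq> Dom N" for bs
  proof -
    show "set (map ?g bs) \<subseteq> Dom M" using that g by (auto simp: bij_betw_def)
    show "map h (map ?g bs) = bs"
      using that bij_betw_inv_into_right[OF h] by (auto intro!: map_idI)
  qed
  have "?g (fun_int N f bs) = fun_int M f (map ?g bs)"
    if "f \<in> funs L" "set bs \<subseteq> Dom N" "length bs = funar L f" for f bs
  proof -
    have "fun_int M f (map ?g bs) \<in> Dom M"
      using M that pull(1)[OF that(2)] unfolding is_structure_def by simp
    moreover have "h (fun_int M f (map ?g bs)) = fun_int N f bs"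
      using f[OF that(1) pull(1)[OF that(2)]] that pull(2)[OF that(2)] by simp
    ultimately show ?thesis
      using bij_betw_inv_into_left[OF h] by metis
  qed
  moreover have "rel_int N r bs \<longleftrightarrow> rel_int M r (map ?g bs)"
    if "r \<in> rels L" "set bs \<subseteq> Dom N" "length bs = relar L r" for r bs
    using r[OF that(1) pull(1)[OF that(2)]] that pull(2)[OF that(2)] by simp
  ultimately show ?thesis unfolding isomorphic_def using g by blast
qed

lemma isomorphic_trans:
  assumes "isomorphic L M N" "isomorphic L N K"
  shows "isomorphic L M K"
proof -
  obtain h where h: "bij_betw h (Dom M) (Dom N)"
    and hf: "\<And>f as. \<lbrakk>f \<in> funs L; set as \<subseteq> Dom M; length as = funar L f\<rbrakk> \<Longrightarrow>
              h (fun_int M f as) = fun_int N f (map h as)"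
    and hr: "\<And>r as. \<lbrakk>r \<in> rels L; set as \<subseteq> Dom M; length as = relar L r\<rbrakk> \<Longrightarrow>
              rel_int M r as \<longleftrightarrow> rel_int N r (map h as)"
    using assms(1) unfolding isomorphic_def by blast
  obtain g where g: "bij_betw g (Dom N) (Dom K)"
    and gf: "\<And>f as. \<lbrakk>f \<in> funs L; set as \<subseteq> Dom N; length as = funar L f\<rbrakk> \<Longrightarrow>
              g (fun_int N f as) = fun_int K f (map g as)"
    and gr: "\<And>r as. \<lbrakk>r \<in> rels L; set as \<subseteq> Dom N; length as = relar L r\<rbrakk> \<Longrightarrow>
              rel_int N r as \<longleftrightarrow> rel_int K r (map g as)"
    using assms(2) unfolding isomorphic_def by blast
  have im: "set (map h as) \<subseteq> Dom N" if "set as \<subseteq> Dom M" for as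
    using that h by (auto simp: bij_betw_def)
  have "bij_betw (g \<circ> h) (Dom M) (Dom K)" by (rule bij_betw_trans[OF h g])
  moreover have "(g \<circ> h) (fun_int M f as) = fun_int K f (map (g \<circ> h) as)"
    if "f \<in> funs L" "set as \<subseteq> Dom M" "length as = funar L f" for f as
    using hf[OF that] gf[OF that(1) im[OF that(2)]] that(3) by simp
  moreover have "rel_int M r as \<longleftrightarrow> rel_int K r (map (g \<circ> h) as)"
    if "r \<in> rels L" "set as \<subseteq> Dom M" "length as = relar L r" for r as
    using hr[OF that] gr[OF that(1) im[OF that(2)]] that(3) by simp
  ultimately show ?thesis unfolding isomorphic_def by blast
qed

lemma isomorphic_imp_elem_equiv:
  assumes M: "is_structure L M" and "isomorphic L M N"
  shows "elem_equiv L M N"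
proof -
  obtain h where h: "bij_betw h (Dom M) (Dom N)"
    and f: "\<And>f as. \<lbrakk>f \<in> funs L; set as \<subseteq> Dom M; length as = funar L f\<rbrakk> \<Longrightarrow>
              h (fun_int M f as) = fun_int N f (map h as)"
    and r: "\<And>r as. \<lbrakk>r \<in> rels L; set as \<subseteq> Dom M; length as = relar L r\<rbrakk> \<Longrightarrow>
              rel_int M r as \<longleftrightarrow> rel_int N r (map h as)"
    using assms(2) unfolding isomorphic_def by blast
  have surj: "h ` Dom M = Dom N" and inj: "inj_on h (Dom M)" using h by (auto simp: bij_betw_def)
  have tm: "h (tm_val M e t) = tm_val N (h \<circ> e) t"
    if "is_tm L t" "range e \<subseteq> Dom M" for t e
    using that(1)
  proof (induction t)
    case (App g ts)
    then have "map h (map (tm_val M e) ts) = map (tm_val N (h \<circ> e)) ts"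
      by (simp del: o_apply add: o_apply[of h "tm_val M e"])
    moreover have "set (map (tm_val M e) ts) \<subseteq> Dom M"
      using App.prems tm_val_in_Dom[OF M _ that(2)] by auto
    ultimately show ?case using f[of g "map (tm_val M e) ts"] App.prems by (simp del: map_map o_apply add: tm_val.simps(2)[of N])
  qed simp
  have upd: "h \<circ> e(x := a) = (h \<circ> e)(x := h a)" for e x a by auto
  have sat: "sat M e \<phi> \<longleftrightarrow> sat N (h \<circ> e) \<phi>" if "is_fm L \<phi>" "range e \<subseteq> Dom M" for \<phi> e
    using that
  proof (induction \<phi> arbitrary: e)
    case (Eq s t)
    then have "tm_val M e s \<in> Dom M" "tm_val M e t \<in> Dom M"
      using tm_val_in_Dom[OF M] by auto
    then have "tm_val M e s = tm_val M e t \<longleftrightarrow> h (tm_val M e s) = h (tm_val M e t)"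
      using inj by (auto dest: inj_onD)
    then show ?case using Eq tm by (simp del: o_apply)
  next
    case (Rel p ts)
    have "map h (map (tm_val M e) ts) = map (tm_val N (h \<circ> e)) ts" using Rel tm by auto
    moreover have "set (map (tm_val M e) ts) \<subseteq> Dom M"
      using Rel.prems tm_val_in_Dom[OF M _ Rel.prems(2)] by auto
    ultimately show ?case using r[of p "map (tm_val M e) ts"] Rel.prems
      by (simp del: map_map o_apply add: sat.simps(4)[of N])
  next
    case (Ex x \<phi>)
    have "sat M (e(x := a)) \<phi> \<longleftrightarrow> sat N ((h \<circ> e)(x := h a)) \<phi>" if "a \<in> Dom M" for a
      by (rule Ex.IH[of "e(x := a)", unfolded upd, OF _ range_upd[OF Ex.prems(2) that]])
        (use Ex.prems in simp)
    then show ?case by (simp del: o_apply flip: surj)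
  next
    case (All x \<phi>)
    have "sat M (e(x := a)) \<phi> \<longleftrightarrow> sat N ((h \<circ> e)(x := h a)) \<phi>" if "a \<in> Dom M" for a
      by (rule All.IH[of "e(x := a)", unfolded upd, OF _ range_upd[OF All.prems(2) that]])
        (use All.prems in simp)
    then show ?case by (simp del: o_apply flip: surj)
  qed auto
  obtain a where a: "a \<in> Dom M" using M by (auto simp: is_structure_def)
  have "models M \<phi> \<longleftrightarrow> models N \<phi>" if "is_fm L \<phi>" "free_vars \<phi> = {}" for \<phi>
  proof -
    have "range (\<lambda>_::nat. a) \<subseteq> Dom M" "range (h \<circ> (\<lambda>_::nat. a)) \<subseteq> Dom N" using a surj by auto
    then show ?thesis using sat[OF that(1)] models_sentence[OF that(2)] by metis
  qed
  then show ?thesis by (auto simp: elem_equiv_def)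
qed

lemma palyutin_is_fm: "\<phi> \<in> palyutin L \<Longrightarrow> is_fm L \<phi>"
  by (induction rule: palyutin.induct) auto

lemma elem_equiv_imp_palyutin_equiv: "elem_equiv L M N \<Longrightarrow> palyutin_equiv L M N"
  by (auto simp: elem_equiv_def palyutin_equiv_def dest: palyutin_is_fm)

section \<open>Elements, functions and terms of reduced products\<close>

abbreviation red_class where
  "red_class I F M a \<equiv> red_rel I F M `` {a}"

lemma red_prod_Dom: "Dom (red_prod I F M) = red_class I F M ` prod_Dom I M"
  by (auto simp: red_prod_def quotient_def)

lemma red_class_eq_iff:
  assumes "a \<in> prod_Dom I M" "b \<in> prod_Dom I M"
  shows "red_class I F M a = red_class I F M b \<longleftrightarrow> eventually (\<lambda>i. a i = b i) F"
  using eq_equiv_class_iff[OF equiv_red_rel assms] assms by (simp add: red_rel_def)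

lemma fun_int_in_prod_Dom:
  assumes "\<And>i. i \<in> I \<Longrightarrow> is_structure L (M i)"
    and "f \<in> funs L" "length as = funar L f" "set as \<subseteq> prod_Dom I M"
  shows "(\<lambda>i\<in>I. fun_int (M i) f (map (\<lambda>a. a i) as)) \<in> prod_Dom I M"
  unfolding prod_Dom_def
proof (rule restrict_PiE_iff[THEN iffD2], rule ballI)
  fix i assume i: "i \<in> I"
  have "set (map (\<lambda>a. a i) as) \<subseteq> Dom (M i)"
    using assms(4) i unfolding prod_Dom_def by (auto dest!: subsetD PiE_mem)
  then show "fun_int (M i) f (map (\<lambda>a. a i) as) \<in> Dom (M i)"
    using assms(1)[OF i] assms(2,3) unfolding is_structure_def by simp
qed

lemma set_red_class_list:
  assumes "set cs \<subseteq> red_class I F M ` prod_Dom I M"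
  obtains as where "set as \<subseteq> prod_Dom I M" "cs = map (red_class I F M) as"
proof -
  have "\<forall>c\<in>set cs. \<exists>a. a \<in> prod_Dom I M \<and> c = red_class I F M a" using assms by auto
  then obtain g where "\<forall>c\<in>set cs. g c \<in> prod_Dom I M \<and> c = red_class I F M (g c)" by metis
  then have "set (map g cs) \<subseteq> prod_Dom I M" "cs = map (red_class I F M) (map g cs)"
    by (auto simp: map_idI)
  then show ?thesis using that by blast
qed

lemma prod_Dom_nonempty:
  assumes "\<And>i. i \<in> I \<Longrightarrow> is_structure L (M i)"
  shows "prod_Dom I M \<noteq> {}"
  using assms by (auto simp: prod_Dom_def PiE_eq_empty_iff is_structure_def)

lemma red_prod_is_structure:
  assumes "\<And>i. i \<in> I \<Longrightarrow> is_structure L (M i)"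
  shows "is_structure L (red_prod I F M)"
  unfolding is_structure_def
proof (intro conjI ballI allI impI)
  show "Dom (red_prod I F M) \<noteq> {}"
    using prod_Dom_nonempty[of I L M, OF assms] by (simp add: red_prod_Dom)
  fix f cs assume f: "f \<in> funs L" and cs: "set cs \<subseteq> Dom (red_prod I F M) \<and> length cs = funar L f"
  then obtain as where as: "set as \<subseteq> prod_Dom I M" "cs = map (red_class I F M) as"
    using set_red_class_list[of cs I F M] unfolding red_prod_Dom by blast
  with cs have l: "length as = funar L f" by simp
  have "fun_int (red_prod I F M) f cs = red_class I F M (\<lambda>i\<in>I. fun_int (M i) f (map (\<lambda>a. a i) as))"
    unfolding as(2) by (rule red_prod_fun_int[OF assms f l as(1)])
  then show "fun_int (red_prod I F M) f cs \<in> Dom (red_prod I F M)"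
    using fun_int_in_prod_Dom[OF assms f l as(1)] by (simp add: red_prod_Dom)
qed

lemma red_prod_tm_val:
  assumes M: "\<And>i. i \<in> I \<Longrightarrow> is_structure L (M i)"
    and e: "range e \<subseteq> prod_Dom I M" and "is_tm L t"
  shows "tm_val (red_prod I F M) (\<lambda>n. red_class I F M (e n)) t
           = red_class I F M (\<lambda>i\<in>I. tm_val (M i) (\<lambda>n. e n i) t)"
    and "(\<lambda>i\<in>I. tm_val (M i) (\<lambda>n. e n i) t) \<in> prod_Dom I M"
proof -
  have e': "range (\<lambda>n. e n i) \<subseteq> Dom (M i)" if "i \<in> I" for i
    using e that unfolding prod_Dom_def by (auto dest!: subsetD PiE_mem)
  have in_Dom: "(\<lambda>i\<in>I. tm_val (M i) (\<lambda>n. e n i) s) \<in> prod_Dom I M" if "is_tm L s" for s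
    unfolding prod_Dom_def using tm_val_in_Dom[OF M that e'] by (simp add: restrict_PiE_iff)
  then show "(\<lambda>i\<in>I. tm_val (M i) (\<lambda>n. e n i) t) \<in> prod_Dom I M" using assms(3) .
  show "tm_val (red_prod I F M) (\<lambda>n. red_class I F M (e n)) t
           = red_class I F M (\<lambda>i\<in>I. tm_val (M i) (\<lambda>n. e n i) t)"
    using assms(3)
  proof (induction t)
    case (Var x)
    have "e x \<in> prod_Dom I M" using e by auto
    then have "(\<lambda>i\<in>I. e x i) = e x" unfolding prod_Dom_def by (simp add: PiE_restrict)
    then show ?case by simp
  next
    case (App f ts)
    let ?as = "map (\<lambda>t. \<lambda>i\<in>I. tm_val (M i) (\<lambda>n. e n i) t) ts"
    have 1: "map (tm_val (red_prod I F M) (\<lambda>n. red_class I F M (e n))) ts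
      = map (red_class I F M) ?as" using App by (simp del: restrict_apply)
    have 2: "set ?as \<subseteq> prod_Dom I M" using App.prems in_Dom by auto
    have 3: "(\<lambda>i\<in>I. fun_int (M i) f (map (\<lambda>a. a i) ?as)) =
       (\<lambda>i\<in>I. tm_val (M i) (\<lambda>n. e n i) (App f ts))"
      by (auto simp: fun_eq_iff restrict_def o_def)
    show ?case unfolding tm_val.simps(2)[of "red_prod I F M"] 1
      using red_prod_fun_int[OF M _ _ 2, of f F] App.prems unfolding 3 by (simp del: map_map restrict_apply tm_val.simps)
  qed
qed

section \<open>Palyutin formulas in reduced products\<close>

text \<open>Choice in every coordinate at once, with an arbitrary point of the nonempty factor where
  \<open>Q\<close> has no witness. As the conclusion is an implication, the set of coordinates with
  a witness need not be known beforehand.\<close>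

lemma prod_Dom_choice:
  assumes "\<And>i. i \<in> I \<Longrightarrow> is_structure L (M i)"
  obtains a where "a \<in> prod_Dom I M"
    and "\<And>i b. i \<in> I \<Longrightarrow> b \<in> Dom (M i) \<Longrightarrow> Q i b \<Longrightarrow> Q i (a i)"
proof -
  have "\<forall>i\<in>I. \<exists>b\<in>Dom (M i). (\<exists>b\<in>Dom (M i). Q i b) \<longrightarrow> Q i b"
  proof
    fix i assume "i \<in> I"
    then obtain b where "b \<in> Dom (M i)" using assms by (fastforce simp: is_structure_def)
    then show "\<exists>b\<in>Dom (M i). (\<exists>b\<in>Dom (M i). Q i b) \<longrightarrow> Q i b" by blast
  qed
  then obtain g where g: "\<And>i. i \<in> I \<Longrightarrow> g i \<in> Dom (M i) \<and> ((\<exists>b\<in>Dom (M i). Q i b) \<longrightarrow> Q i (g i))"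
    by metis
  show ?thesis
    by (rule that[of "restrict g I"]) (use g in \<open>auto simp: prod_Dom_def\<close>)
qed

lemma prod_Dom_upd:
  assumes "range e \<subseteq> prod_Dom I M" "a \<in> prod_Dom I M"
  shows "(\<lambda>n. red_class I F M (e n))(x := red_class I F M a) = (\<lambda>n. red_class I F M ((e(x := a)) n))"
    and "range (e(x := a)) \<subseteq> prod_Dom I M"
    and "(\<lambda>n. (e(x := a)) n i) = (\<lambda>n. e n i)(x := a i)"
proof -
  show "range (e(x := a)) \<subseteq> prod_Dom I M" by (rule range_upd[OF assms])
qed (rule ext, simp)+

lemma red_prod_sat_Ex_iff:
  "sat (red_prod I F M) (\<lambda>n. red_class I F M (e n)) (Ex x \<phi>) \<longleftrightarrow>
    (\<exists>a\<in>prod_Dom I M. sat (red_prod I F M) (\<lambda>n. red_class I F M ((e(x := a)) n)) \<phi>)"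
proof -
  have "(\<lambda>n. red_class I F M (e n))(x := red_class I F M a) = (\<lambda>n. red_class I F M ((e(x := a)) n))" for a
    by (rule ext) simp
  then show ?thesis unfolding sat.simps red_prod_Dom by (simp only: bex_simps)
qed

lemma red_prod_sat_All_iff:
  "sat (red_prod I F M) (\<lambda>n. red_class I F M (e n)) (All x \<phi>) \<longleftrightarrow>
    (\<forall>a\<in>prod_Dom I M. sat (red_prod I F M) (\<lambda>n. red_class I F M ((e(x := a)) n)) \<phi>)"
proof -
  have "(\<lambda>n. red_class I F M (e n))(x := red_class I F M a) = (\<lambda>n. red_class I F M ((e(x := a)) n))" for a
    by (rule ext) simp
  then show ?thesis unfolding sat.simps red_prod_Dom by (simp only: ball_simps)
qed

text \<open>Witnesses for \<exists> and counterexamples for \<forall> are chosen coordinatewise by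
  \<open>prod_Dom_choice\<close>; conjunction corresponds to intersection of filter sets, and
  properness settles \<open>Bot\<close>.\<close>

theorem palyutin_red_prod:
  assumes M: "\<And>i. i \<in> I \<Longrightarrow> is_structure L (M i)" and F: "proper_filter_on I F"
    and "\<phi> \<in> palyutin L" and "range e \<subseteq> prod_Dom I M"
  shows "sat (red_prod I F M) (\<lambda>n. red_class I F M (e n)) \<phi>
           \<longleftrightarrow> eventually (\<lambda>i. sat (M i) (\<lambda>n. e n i) \<phi>) F"
proof -
  have I: "eventually (\<lambda>i. i \<in> I) F" and F': "F \<noteq> bot"
    using F by (auto simp: proper_filter_on_def le_principal)
  have Dom: "a i \<in> Dom (M i)" if "a \<in> prod_Dom I M" "i \<in> I" for a i
    using that by (auto simp: prod_Dom_def)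
  let ?P = "red_prod I F M" and ?c = "red_class I F M"
  have sat_Ex: "sat ?P (\<lambda>n. ?c (e n)) (Ex x \<phi>) \<longleftrightarrow> (\<forall>\<^sub>F i in F. sat (M i) (\<lambda>n. e n i) (Ex x \<phi>))"
    if IH: "\<And>e. range e \<subseteq> prod_Dom I M \<Longrightarrow>
              sat ?P (\<lambda>n. ?c (e n)) \<phi> \<longleftrightarrow> (\<forall>\<^sub>F i in F. sat (M i) (\<lambda>n. e n i) \<phi>)"
      and e: "range e \<subseteq> prod_Dom I M" for \<phi> x e
    unfolding red_prod_sat_Ex_iff
  proof
    assume "\<exists>a\<in>prod_Dom I M. sat ?P (\<lambda>n. ?c ((e(x := a)) n)) \<phi>"
    then obtain a where a: "a \<in> prod_Dom I M" "\<forall>\<^sub>F i in F. sat (M i) ((\<lambda>n. e n i)(x := a i)) \<phi>"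
      using IH[OF prod_Dom_upd(2)[OF e]] by (auto simp only: prod_Dom_upd(3)[OF e])
    show "\<forall>\<^sub>F i in F. sat (M i) (\<lambda>n. e n i) (Ex x \<phi>)"
      using a(2) I by eventually_elim (use Dom[OF a(1)] in auto)
  next
    assume ev: "\<forall>\<^sub>F i in F. sat (M i) (\<lambda>n. e n i) (Ex x \<phi>)"
    obtain a where a: "a \<in> prod_Dom I M"
      "\<And>i b. i \<in> I \<Longrightarrow> b \<in> Dom (M i) \<Longrightarrow> sat (M i) ((\<lambda>n. e n i)(x := b)) \<phi> \<Longrightarrow>
          sat (M i) ((\<lambda>n. e n i)(x := a i)) \<phi>"
      using prod_Dom_choice[of I L M "\<lambda>i b. sat (M i) ((\<lambda>n. e n i)(x := b)) \<phi>", OF M] by blast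
    have "\<forall>\<^sub>F i in F. sat (M i) ((\<lambda>n. e n i)(x := a i)) \<phi>"
      using ev I by eventually_elim (use a(2) in auto)
    then show "\<exists>a\<in>prod_Dom I M. sat ?P (\<lambda>n. ?c ((e(x := a)) n)) \<phi>"
      using IH[OF prod_Dom_upd(2)[OF e a(1)]] a(1) by (auto simp only: prod_Dom_upd(3)[OF e a(1)])
  qed
  show ?thesis using assms(3,4)
  proof (induction \<phi> arbitrary: e)
    case Top then show ?case by simp
  next
    case Bot then show ?case using F' by simp
  next
    case (Eq s t)
    then have st: "is_tm L s" "is_tm L t" by auto
    have v: "tm_val ?P (\<lambda>n. ?c (e n)) t = ?c (\<lambda>i\<in>I. tm_val (M i) (\<lambda>n. e n i) t)"
      "(\<lambda>i\<in>I. tm_val (M i) (\<lambda>n. e n i) t) \<in> prod_Dom I M" if "is_tm L t" for t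
      using red_prod_tm_val[of I L M e t] M Eq.prems that by blast+
    have "sat ?P (\<lambda>n. ?c (e n)) (Eq s t) \<longleftrightarrow>
       (\<forall>\<^sub>F i in F. (\<lambda>i\<in>I. tm_val (M i) (\<lambda>n. e n i) s) i = (\<lambda>i\<in>I. tm_val (M i) (\<lambda>n. e n i) t) i)"
      unfolding sat.simps v(1)[OF st(1)] v(1)[OF st(2)]
      by (rule red_class_eq_iff[OF v(2)[OF st(1)] v(2)[OF st(2)]])
    also have "\<dots> \<longleftrightarrow> (\<forall>\<^sub>F i in F. sat (M i) (\<lambda>n. e n i) (Eq s t))"
      by (rule eventually_subst) (use I in \<open>eventually_elim, simp\<close>)
    finally show ?case .
  next
    case (Rel r ts)
    then have ts: "\<And>t. t \<in> set ts \<Longrightarrow> is_tm L t" by auto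
    have v: "tm_val ?P (\<lambda>n. ?c (e n)) t = ?c (\<lambda>i\<in>I. tm_val (M i) (\<lambda>n. e n i) t)"
      "(\<lambda>i\<in>I. tm_val (M i) (\<lambda>n. e n i) t) \<in> prod_Dom I M" if "is_tm L t" for t
      using red_prod_tm_val[of I L M e t] M Rel.prems that by blast+
    let ?as = "map (\<lambda>t. \<lambda>i\<in>I. tm_val (M i) (\<lambda>n. e n i) t) ts"
    have 1: "map (tm_val ?P (\<lambda>n. ?c (e n))) ts = map ?c ?as"
      using v(1)[OF ts] by (simp del: restrict_apply)
    have 2: "set ?as \<subseteq> prod_Dom I M" using v(2)[OF ts] by auto
    have "sat ?P (\<lambda>n. ?c (e n)) (Rel r ts) \<longleftrightarrow> (\<forall>\<^sub>F i in F. rel_int (M i) r (map (\<lambda>a. a i) ?as))"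
      unfolding sat.simps 1 by (rule red_prod_rel_int[OF 2])
    also have "\<dots> \<longleftrightarrow> (\<forall>\<^sub>F i in F. sat (M i) (\<lambda>n. e n i) (Rel r ts))"
      by (rule eventually_subst) (use I in \<open>eventually_elim, simp add: o_def\<close>)
    finally show ?case .
  next
    case (Conj \<phi> \<psi>) then show ?case by (simp add: eventually_conj_iff)
  next
    case (Ex \<phi> x) show ?case by (rule sat_Ex[OF Ex.IH Ex.prems])
  next
    case (All \<phi> x)
    note e = All.prems
    show ?case unfolding red_prod_sat_All_iff
    proof
      assume all: "\<forall>a\<in>prod_Dom I M. sat ?P (\<lambda>n. ?c ((e(x := a)) n)) \<phi>"
      obtain a where a: "a \<in> prod_Dom I M"
        "\<And>i b. i \<in> I \<Longrightarrow> b \<in> Dom (M i) \<Longrightarrow> \<not> sat (M i) ((\<lambda>n. e n i)(x := b)) \<phi> \<Longrightarrow>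
          \<not> sat (M i) ((\<lambda>n. e n i)(x := a i)) \<phi>"
        using prod_Dom_choice[of I L M "\<lambda>i b. \<not> sat (M i) ((\<lambda>n. e n i)(x := b)) \<phi>", OF M] by blast
      from all a(1) have "sat ?P (\<lambda>n. ?c ((e(x := a)) n)) \<phi>" by blast
      then have "\<forall>\<^sub>F i in F. sat (M i) ((\<lambda>n. e n i)(x := a i)) \<phi>"
        using All.IH[OF prod_Dom_upd(2)[OF e a(1)]] by (simp only: prod_Dom_upd(3)[OF e a(1)])
      then show "\<forall>\<^sub>F i in F. sat (M i) (\<lambda>n. e n i) (All x \<phi>)"
        using I by eventually_elim (use a(2) in auto)
    next
      assume ev: "\<forall>\<^sub>F i in F. sat (M i) (\<lambda>n. e n i) (All x \<phi>)"
      show "\<forall>a\<in>prod_Dom I M. sat ?P (\<lambda>n. ?c ((e(x := a)) n)) \<phi>"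
      proof
        fix a assume a: "a \<in> prod_Dom I M"
        have "\<forall>\<^sub>F i in F. sat (M i) ((\<lambda>n. e n i)(x := a i)) \<phi>"
          using ev I by eventually_elim (use Dom[OF a] in auto)
        then show "sat ?P (\<lambda>n. ?c ((e(x := a)) n)) \<phi>"
          using All.IH[OF prod_Dom_upd(2)[OF e a]] by (simp only: prod_Dom_upd(3)[OF e a])
      qed
    qed
  next
    case (ExAllImp \<phi> \<psi> x)
    note e = ExAllImp.prems
    have Ex': "sat ?P (\<lambda>n. ?c (e n)) (Ex x \<phi>) \<longleftrightarrow> (\<forall>\<^sub>F i in F. sat (M i) (\<lambda>n. e n i) (Ex x \<phi>))"
      by (rule sat_Ex[OF ExAllImp.IH(1) e])
    have "sat ?P (\<lambda>n. ?c (e n)) (All x (Imp \<phi> \<psi>)) \<longleftrightarrow>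
            (\<forall>\<^sub>F i in F. sat (M i) (\<lambda>n. e n i) (All x (Imp \<phi> \<psi>)))"
      if ex: "\<forall>\<^sub>F i in F. sat (M i) (\<lambda>n. e n i) (Ex x \<phi>)"
      unfolding red_prod_sat_All_iff
    proof
      assume all: "\<forall>a\<in>prod_Dom I M. sat ?P (\<lambda>n. ?c ((e(x := a)) n)) (Imp \<phi> \<psi>)"
      let ?s = "\<lambda>i b. sat (M i) ((\<lambda>n. e n i)(x := b))"
      \<comment> \<open>Asked of \<open>a i\<close>: satisfy \<phi>, and refute \<psi> if some point
        satisfying \<phi> does. Such a point exists wherever \<phi> has a witness, hence almost
        everywhere by \<open>ex\<close>. If \<psi> nevertheless holds at \<open>a i\<close>, the
        implication holds throughout that coordinate.\<close>
      obtain a where a: "a \<in> prod_Dom I M"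
        "\<And>i b. i \<in> I \<Longrightarrow> b \<in> Dom (M i) \<Longrightarrow>
          ?s i b \<phi> \<and> ((\<exists>b\<in>Dom (M i). ?s i b \<phi> \<and> \<not> ?s i b \<psi>) \<longrightarrow> \<not> ?s i b \<psi>) \<Longrightarrow>
          ?s i (a i) \<phi> \<and> ((\<exists>b\<in>Dom (M i). ?s i b \<phi> \<and> \<not> ?s i b \<psi>) \<longrightarrow> \<not> ?s i (a i) \<psi>)"
        using prod_Dom_choice[of I L M "\<lambda>i b. ?s i b \<phi> \<and>
          ((\<exists>b\<in>Dom (M i). ?s i b \<phi> \<and> \<not> ?s i b \<psi>) \<longrightarrow> \<not> ?s i b \<psi>)", OF M] by blast
      have a': "\<forall>\<^sub>F i in F. ?s i (a i) \<phi> \<and>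
            ((\<exists>b\<in>Dom (M i). ?s i b \<phi> \<and> \<not> ?s i b \<psi>) \<longrightarrow> \<not> ?s i (a i) \<psi>)"
        using ex I by eventually_elim (use a(2) in \<open>metis sat.simps(9)\<close>)
      then have "\<forall>\<^sub>F i in F. ?s i (a i) \<phi>" by (rule eventually_mono) blast
      then have "sat ?P (\<lambda>n. ?c ((e(x := a)) n)) \<phi>"
        using ExAllImp.IH(1)[OF prod_Dom_upd(2)[OF e a(1)]] by (simp only: prod_Dom_upd(3)[OF e a(1)])
      then have "sat ?P (\<lambda>n. ?c ((e(x := a)) n)) \<psi>" using all a(1) by auto
      then have "\<forall>\<^sub>F i in F. ?s i (a i) \<psi>"
        using ExAllImp.IH(2)[OF prod_Dom_upd(2)[OF e a(1)]] by (simp only: prod_Dom_upd(3)[OF e a(1)])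
      then show "\<forall>\<^sub>F i in F. sat (M i) (\<lambda>n. e n i) (All x (Imp \<phi> \<psi>))"
        using a' by eventually_elim auto
    next
      assume ev: "\<forall>\<^sub>F i in F. sat (M i) (\<lambda>n. e n i) (All x (Imp \<phi> \<psi>))"
      show "\<forall>a\<in>prod_Dom I M. sat ?P (\<lambda>n. ?c ((e(x := a)) n)) (Imp \<phi> \<psi>)"
      proof
        fix a assume a: "a \<in> prod_Dom I M"
        have "\<forall>\<^sub>F i in F. sat (M i) ((\<lambda>n. e n i)(x := a i)) \<phi> \<longrightarrow> sat (M i) ((\<lambda>n. e n i)(x := a i)) \<psi>"
          using ev I by eventually_elim (use Dom[OF a] in auto)
        then have "(\<forall>\<^sub>F i in F. sat (M i) ((\<lambda>n. e n i)(x := a i)) \<phi>) \<longrightarrow>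
            (\<forall>\<^sub>F i in F. sat (M i) ((\<lambda>n. e n i)(x := a i)) \<psi>)"
          by (rule impI[OF eventually_mp])
        then show "sat ?P (\<lambda>n. ?c ((e(x := a)) n)) (Imp \<phi> \<psi>)"
          unfolding sat.simps using ExAllImp.IH(1)[OF prod_Dom_upd(2)[OF e a]]
            ExAllImp.IH(2)[OF prod_Dom_upd(2)[OF e a]] by (simp only: prod_Dom_upd(3)[OF e a])
      qed
    qed
    then show ?case
      using Ex' unfolding sat.simps(6) eventually_conj_iff by blast
  qed
qed

lemma env_red_prod:
  assumes "range e \<subseteq> Dom (red_prod I F M)"
  obtains e' where "range e' \<subseteq> prod_Dom I M" "e = (\<lambda>n. red_class I F M (e' n))"
proof -
  have "\<forall>n. \<exists>a. a \<in> prod_Dom I M \<and> e n = red_class I F M a"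
    using assms by (auto simp: red_prod_Dom)
  then obtain e' where "\<forall>n. e' n \<in> prod_Dom I M \<and> e n = red_class I F M (e' n)" by metis
  then show ?thesis using that[of e'] by auto
qed

text \<open>For a sentence the truth value in the Los theorem is the same at all coordinates, and a
  proper filter tells the constant conditions true and false apart.\<close>

lemma palyutin_equiv_red_power:
  assumes M: "is_structure L M" and F: "proper_filter_on I F"
  shows "palyutin_equiv L M (red_power I F M)"
  unfolding palyutin_equiv_def
proof (intro ballI impI)
  fix \<phi> assume \<phi>: "\<phi> \<in> palyutin L" "free_vars \<phi> = {}"
  obtain a where a: "a \<in> Dom M" using M by (auto simp: is_structure_def)
  let ?e = "\<lambda>_::nat. (\<lambda>i\<in>I. a)"
  have e: "range ?e \<subseteq> prod_Dom I (\<lambda>_. M)" using a by (auto simp: prod_Dom_def)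
  have "models (red_power I F M) \<phi> \<longleftrightarrow> sat (red_power I F M) (\<lambda>n. red_class I F (\<lambda>_. M) (?e n)) \<phi>"
    using e by (intro models_sentence[OF \<phi>(2)]) (auto simp: red_power_def red_prod_Dom)
  also have "\<dots> \<longleftrightarrow> (\<forall>\<^sub>F i in F. sat M (\<lambda>n. ?e n i) \<phi>)"
    unfolding red_power_def using palyutin_red_prod[OF _ F \<phi>(1) e] M by blast
  also have "\<dots> \<longleftrightarrow> (\<forall>\<^sub>F i in F. models M \<phi>)"
  proof (rule eventually_subst)
    have "eventually (\<lambda>i. i \<in> I) F" using F by (auto simp: proper_filter_on_def le_principal)
    then show "\<forall>\<^sub>F i in F. sat M (\<lambda>n. ?e n i) \<phi> \<longleftrightarrow> models M \<phi>"
      by eventually_elim (use a models_sentence[OF \<phi>(2), of "\<lambda>_. a" M] in auto)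
  qed
  also have "\<dots> \<longleftrightarrow> models M \<phi>" using F by (auto simp: proper_filter_on_def eventually_const)
  finally show "models M \<phi> \<longleftrightarrow> models (red_power I F M) \<phi>" by simp
qed

section \<open>Splitting infinite sets\<close>

lemma infinite_split:
  assumes "infinite A"
  obtains B C where "B \<subseteq> A" "C \<subseteq> A" "B \<inter> C = {}" "infinite B" "infinite C"
proof -
  obtain f :: "nat \<Rightarrow> 'a" where f: "inj f" "range f \<subseteq> A"
    using infinite_countable_subset[OF assms] by blast
  have "inj (\<lambda>n. f (2 * n))" "inj (\<lambda>n. f (2 * n + 1))"
    by (auto intro!: injI dest!: injD[OF f(1)])
  then have "infinite (range (\<lambda>n. f (2 * n)))" "infinite (range (\<lambda>n. f (2 * n + 1)))"
    by (metis finite_imageD infinite_UNIV_nat)+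
  moreover have "range (\<lambda>n. f (2 * n)) \<inter> range (\<lambda>n. f (2 * n + 1)) = {}"
    by (auto dest!: injD[OF f(1)]) presburger
  moreover have "range (\<lambda>n. f (2 * n)) \<subseteq> A" "range (\<lambda>n. f (2 * n + 1)) \<subseteq> A"
    using f(2) by auto
  ultimately show ?thesis using that by blast
qed

text \<open>Each member of the family is treated by halving the current \<open>B\<close>: two
  disjoint halves cannot both leave only finitely many points of \<open>S\<close>. Shrinking
  \<open>B\<close> does no harm to the members treated earlier.\<close>

lemma infinite_subset_avoiding:
  assumes "finite \<S>" "\<And>S. S \<in> \<S> \<Longrightarrow> infinite S" "infinite A"
  obtains B where "B \<subseteq> A" "infinite B" "\<And>S. S \<in> \<S> \<Longrightarrow> infinite (S - B)"
proof -
  have "\<exists>B\<subseteq>A. infinite B \<and> (\<forall>S\<in>\<S>. infinite (S - B))"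
    using assms(1,2)
  proof (induction \<S>)
    case empty then show ?case using assms(3) by auto
  next
    case (insert S \<S>)
    then obtain B where B: "B \<subseteq> A" "infinite B" "\<forall>S\<in>\<S>. infinite (S - B)" by auto
    obtain B1 B2 where B12: "B1 \<subseteq> B" "B2 \<subseteq> B" "B1 \<inter> B2 = {}" "infinite B1" "infinite B2"
      using infinite_split[OF B(2)] by blast
    have "S \<subseteq> (S - B1) \<union> (S - B2)" using B12(3) by blast
    then have "infinite (S - B1) \<or> infinite (S - B2)"
      using insert.prems by (meson finite_UnI insertI1 rev_finite_subset)
    moreover have "infinite (T - B')" if "T \<in> \<S>" "B' \<subseteq> B" for T B'
      using B(3) that by (meson Diff_mono finite_subset order_refl)
    ultimately show ?case using B12 B(1) by (metis insert_iff order_trans)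
  qed
  then show ?thesis using that by blast
qed

text \<open>The disjoint sets are presented as the fibres of one labelling \<open>c\<close>, which
  makes disjointness automatic and lets a coordinate look up which \<open>q\<close> it has to serve.
  A new label is written on an infinite part of \<open>A q\<close> that spares infinitely much of
  every earlier fibre.\<close>

lemma infinite_disjoint_refinement:
  assumes "finite \<Psi>" "\<And>q. q \<in> \<Psi> \<Longrightarrow> infinite (A q)"
  obtains c where "\<And>q. q \<in> \<Psi> \<Longrightarrow> infinite {i \<in> A q. c i = q}"
proof -
  have "\<exists>c. \<forall>q\<in>\<Psi>. infinite {i \<in> A q. c i = q}"
    using assms
  proof (induction \<Psi>)
    case (insert q \<Psi>)
    then obtain c where c: "\<forall>q\<in>\<Psi>. infinite {i \<in> A q. c i = q}" by auto
    let ?S = "\<lambda>q. {i \<in> A q. c i = q}"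
    have 1: "finite (?S ` \<Psi>)" using insert.hyps(1) by simp
    have 2: "infinite S" if "S \<in> ?S ` \<Psi>" for S using that c by blast
    have 3: "infinite (A q)" using insert.prems by simp
    obtain B where B: "B \<subseteq> A q" "infinite B" "\<And>S. S \<in> ?S ` \<Psi> \<Longrightarrow> infinite (S - B)"
      using infinite_subset_avoiding[OF 1 2 3] by blast
    let ?c = "\<lambda>i. if i \<in> B then q else c i"
    have "infinite {i \<in> A q. ?c i = q}"
      using B(2) by (rule contrapos_nn) (erule rev_finite_subset, use B(1) in auto)
    moreover have "infinite {i \<in> A q'. ?c i = q'}" if "q' \<in> \<Psi>" for q'
    proof -
      have "infinite (?S q' - B)" using B(3) that by blast
      then show ?thesis by (rule contrapos_nn) (erule rev_finite_subset, auto)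
    qed
    ultimately show ?case by (intro exI[of _ ?c]) blast
  qed auto
  then show ?thesis using that by blast
qed

text \<open>
  The Boolean algebra of subsets of \<open>\<omega>\<close> modulo finite sets is atomless, so the sets of coordinates
  at which the various \<open>\<psi>\<close> can be refuted may be shrunk to disjoint sets which are still not
  negligible; one element then refutes all the \<open>\<psi>\<close> simultaneously.
\<close>

lemma frechet_power_Ex_conj:
  assumes M: "is_structure L M" and \<pi>: "\<pi> \<in> palyutin L" and \<Psi>: "finite \<Psi>" "\<Psi> \<subseteq> palyutin L"
    and e: "range e \<subseteq> Dom (red_power (UNIV :: nat set) cofinite M)"
  defines "P \<equiv> red_power (UNIV :: nat set) cofinite M"
  shows "(\<exists>a\<in>Dom P. sat P (e(x := a)) \<pi> \<and> (\<forall>\<psi>\<in>\<Psi>. \<not> sat P (e(x := a)) \<psi>)) \<longleftrightarrow>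
     sat P e (Ex x \<pi>) \<and> (\<forall>\<psi>\<in>\<Psi>. \<not> sat P e (Conj (Ex x \<pi>) (All x (Imp \<pi> \<psi>))))"
proof
  assume R: "sat P e (Ex x \<pi>) \<and> (\<forall>\<psi>\<in>\<Psi>. \<not> sat P e (Conj (Ex x \<pi>) (All x (Imp \<pi> \<psi>))))"
  let ?I = "UNIV :: nat set" and ?F = "cofinite :: nat filter"
  let ?M = "\<lambda>_::nat. M" and ?c = "red_class (UNIV :: nat set) cofinite (\<lambda>_. M)"
  obtain d where d: "range d \<subseteq> prod_Dom ?I ?M" "e = (\<lambda>n. ?c (d n))"
    using e env_red_prod[of e ?I ?F ?M] unfolding red_power_def by blast
  have los: "sat P (\<lambda>n. ?c (d n)) \<phi> \<longleftrightarrow> (\<forall>\<^sub>F i in cofinite. sat M (\<lambda>n. d n i) \<phi>)"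
    if "\<phi> \<in> palyutin L" "range d \<subseteq> prod_Dom ?I ?M" for \<phi> d
    unfolding P_def red_power_def
    using palyutin_red_prod[OF _ proper_filter_on_cofinite that] M by blast
  let ?s = "\<lambda>i b. sat M ((\<lambda>n. d n i)(x := b))"
  have ex: "\<forall>\<^sub>F i in cofinite. \<exists>b\<in>Dom M. ?s i b \<pi>"
    using R los[OF palyutin.Ex[OF \<pi>] d(1)] unfolding d(2) by simp
  define A where "A \<psi> = {i. \<exists>b\<in>Dom M. ?s i b \<pi> \<and> \<not> ?s i b \<psi>}" for \<psi>
  have "infinite (A \<psi>)" if "\<psi> \<in> \<Psi>" for \<psi>
  proof
    assume "finite (A \<psi>)"
    then have "\<forall>\<^sub>F i in cofinite. i \<notin> A \<psi>" by (simp add: eventually_cofinite)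
    with ex have "\<forall>\<^sub>F i in cofinite. sat M (\<lambda>n. d n i) (Conj (Ex x \<pi>) (All x (Imp \<pi> \<psi>)))"
      by eventually_elim (auto simp: A_def)
    moreover have "\<psi> \<in> palyutin L" using that \<Psi>(2) by blast
    ultimately have "sat P e (Conj (Ex x \<pi>) (All x (Imp \<pi> \<psi>)))"
      using los[OF palyutin.ExAllImp[OF \<pi>] d(1)] unfolding d(2) by blast
    then show False using R that by blast
  qed
  then obtain c where c: "\<And>\<psi>. \<psi> \<in> \<Psi> \<Longrightarrow> infinite {i \<in> A \<psi>. c i = \<psi>}"
    using infinite_disjoint_refinement[OF \<Psi>(1)] by blast
  \<comment> \<open>Coordinate \<open>i\<close> is responsible only for the formula
    \<open>c i\<close>; where that formula cannot be refuted together with \<pi>, nothing but \<pi>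
    is demanded.\<close>
  obtain a where a: "a \<in> prod_Dom ?I ?M"
    "\<And>i b. b \<in> Dom M \<Longrightarrow> ?s i b \<pi> \<and> (i \<in> A (c i) \<longrightarrow> \<not> ?s i b (c i)) \<Longrightarrow>
        ?s i (a i) \<pi> \<and> (i \<in> A (c i) \<longrightarrow> \<not> ?s i (a i) (c i))"
    using prod_Dom_choice[of ?I L ?M "\<lambda>i b. ?s i b \<pi> \<and> (i \<in> A (c i) \<longrightarrow> \<not> ?s i b (c i))"] M
    by (metis UNIV_I)
  have ev: "\<forall>\<^sub>F i in cofinite. ?s i (a i) \<pi> \<and> (i \<in> A (c i) \<longrightarrow> \<not> ?s i (a i) (c i))"
    using ex
  proof eventually_elim
    case (elim i)
    show ?case
    proof (cases "i \<in> A (c i)")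
      case True
      then obtain b where "b \<in> Dom M" "?s i b \<pi>" "\<not> ?s i b (c i)" by (auto simp: A_def)
      then show ?thesis using a(2) by blast
    next
      case False then show ?thesis using elim a(2) by blast
    qed
  qed
  note upd = prod_Dom_upd[OF d(1) a(1)]
  have los': "sat P (e(x := ?c a)) \<phi> \<longleftrightarrow> (\<forall>\<^sub>F i in cofinite. ?s i (a i) \<phi>)" if "\<phi> \<in> palyutin L" for \<phi>
    using los[OF that upd(2)] unfolding d(2) by (simp only: upd(1,3))
  have "sat P (e(x := ?c a)) \<pi>" unfolding los'[OF \<pi>] using ev by (rule eventually_mono) blast
  moreover have "\<not> sat P (e(x := ?c a)) \<psi>" if "\<psi> \<in> \<Psi>" for \<psi>
  proof
    assume "sat P (e(x := ?c a)) \<psi>"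
    then have "\<forall>\<^sub>F i in cofinite. ?s i (a i) \<psi>" using los' that \<Psi>(2) by blast
    then have "\<forall>\<^sub>F i in cofinite. \<not> (i \<in> A \<psi> \<and> c i = \<psi>)" using ev by eventually_elim auto
    then show False using c[OF that] by (simp add: eventually_cofinite)
  qed
  moreover have "?c a \<in> Dom P" using a(1) by (simp add: P_def red_power_def red_prod_Dom)
  ultimately show "\<exists>a\<in>Dom P. sat P (e(x := a)) \<pi> \<and> (\<forall>\<psi>\<in>\<Psi>. \<not> sat P (e(x := a)) \<psi>)" by blast
qed auto

text \<open>
  A structure with an assignment is represented by the valuation \<open>\<phi> \<mapsto> sat M e \<phi>\<close>, so that one normal form
  can serve structures over different types. A disjunct \<open>(\<pi>, \<Psi>)\<close> needs only one positive formula \<open>\<pi>\<close>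
  because \<open>B\<close> will be closed under conjunction.
\<close>

definition dnf :: "('f, 'p) fm set \<Rightarrow> (('f, 'p) fm \<Rightarrow> bool) set \<Rightarrow> ((('f, 'p) fm \<Rightarrow> bool) \<Rightarrow> bool) \<Rightarrow> bool"
  where "dnf B W Q \<longleftrightarrow> (\<exists>D. set D \<subseteq> B \<times> lists B \<and>
     (\<forall>v\<in>W. Q v \<longleftrightarrow> (\<exists>(\<pi>, \<Psi>)\<in>set D. v \<pi> \<and> (\<forall>\<psi>\<in>set \<Psi>. \<not> v \<psi>))))"

text \<open>The members of \<open>W\<close> are a priori arbitrary predicates on formulas, so their
  behaviour on \<open>Top\<close> and \<open>Conj\<close> is demanded along with the closure of
  \<open>B\<close>.\<close>

definition conj_closed :: "('f, 'p) fm set \<Rightarrow> (('f, 'p) fm \<Rightarrow> bool) set \<Rightarrow> bool" where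
  "conj_closed B W \<longleftrightarrow> Top \<in> B \<and> (\<forall>\<phi>\<in>B. \<forall>\<psi>\<in>B. Conj \<phi> \<psi> \<in> B) \<and>
     (\<forall>v\<in>W. v Top \<and> (\<forall>\<phi> \<psi>. v (Conj \<phi> \<psi>) \<longleftrightarrow> v \<phi> \<and> v \<psi>))"

lemma dnfI:
  assumes "set D \<subseteq> B \<times> lists B"
    and "\<And>v. v \<in> W \<Longrightarrow> Q v \<longleftrightarrow> (\<exists>(\<pi>, \<Psi>)\<in>set D. v \<pi> \<and> (\<forall>\<psi>\<in>set \<Psi>. \<not> v \<psi>))"
  shows "dnf B W Q"
  unfolding dnf_def by (intro exI[of _ D] conjI ballI assms)

lemma dnfE:
  assumes "dnf B W Q"
  obtains D where "set D \<subseteq> B \<times> lists B"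
    and "\<And>v. v \<in> W \<Longrightarrow> Q v \<longleftrightarrow> (\<exists>(\<pi>, \<Psi>)\<in>set D. v \<pi> \<and> (\<forall>\<psi>\<in>set \<Psi>. \<not> v \<psi>))"
  using assms unfolding dnf_def by (elim exE conjE) (rule that, assumption, erule (1) bspec)

lemma dnf_cong: "dnf B W Q \<Longrightarrow> (\<And>v. v \<in> W \<Longrightarrow> Q v \<longleftrightarrow> R v) \<Longrightarrow> dnf B W R"
  unfolding dnf_def by (simp cong: ball_cong)

lemma dnf_mono:
  assumes "dnf B W Q" "B \<subseteq> C"
  shows "dnf C W Q"
proof -
  have "B \<times> lists B \<subseteq> C \<times> lists C" using assms(2) lists_mono[OF assms(2)] by (rule Sigma_mono)
  with assms(1) show ?thesis unfolding dnf_def by (elim exE conjE) (intro exI conjI, erule (1) order_trans)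
qed

lemma dnf_literal:
  assumes "\<pi> \<in> B"
  shows "dnf B W (\<lambda>v. v \<pi>)"
  unfolding dnf_def by (rule exI[of _ "[(\<pi>, [])]"]) (use assms in auto)

lemma dnf_negated_literal:
  assumes "conj_closed B W" "\<pi> \<in> B"
  shows "dnf B W (\<lambda>v. \<not> v \<pi>)"
  unfolding dnf_def by (rule exI[of _ "[(Top, [\<pi>])]"]) (use assms in \<open>auto simp: conj_closed_def\<close>)

lemma dnf_False: "dnf B W (\<lambda>v. False)"
  unfolding dnf_def by (rule exI[of _ "[]"]) auto

lemma dnf_disj:
  assumes "dnf B W Q" "dnf B W R"
  shows "dnf B W (\<lambda>v. Q v \<or> R v)"
proof -
  obtain D where D: "set D \<subseteq> B \<times> lists B"
    and Q: "\<And>v. v \<in> W \<Longrightarrow> Q v \<longleftrightarrow> (\<exists>(\<pi>, \<Psi>)\<in>set D. v \<pi> \<and> (\<forall>\<psi>\<in>set \<Psi>. \<not> v \<psi>))"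
    by (rule dnfE[OF assms(1)]) (rule that)
  obtain E where E: "set E \<subseteq> B \<times> lists B"
    and R: "\<And>v. v \<in> W \<Longrightarrow> R v \<longleftrightarrow> (\<exists>(\<pi>, \<Psi>)\<in>set E. v \<pi> \<and> (\<forall>\<psi>\<in>set \<Psi>. \<not> v \<psi>))"
    by (rule dnfE[OF assms(2)]) (rule that)
  show ?thesis
    by (rule dnfI[of "D @ E"]) (use D E in \<open>simp_all add: Q R bex_Un\<close>)
qed

lemma dnf_conj:
  assumes B: "conj_closed B W" and "dnf B W Q" "dnf B W R"
  shows "dnf B W (\<lambda>v. Q v \<and> R v)"
proof -
  obtain D where D: "set D \<subseteq> B \<times> lists B"
    and Q: "\<And>v. v \<in> W \<Longrightarrow> Q v \<longleftrightarrow> (\<exists>(\<pi>, \<Psi>)\<in>set D. v \<pi> \<and> (\<forall>\<psi>\<in>set \<Psi>. \<not> v \<psi>))"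
    by (rule dnfE[OF assms(2)]) (rule that)
  obtain E where E: "set E \<subseteq> B \<times> lists B"
    and R: "\<And>v. v \<in> W \<Longrightarrow> R v \<longleftrightarrow> (\<exists>(\<pi>, \<Psi>)\<in>set E. v \<pi> \<and> (\<forall>\<psi>\<in>set \<Psi>. \<not> v \<psi>))"
    by (rule dnfE[OF assms(3)]) (rule that)
  let ?c = "\<lambda>((\<pi>, \<Psi>), (\<pi>', \<Psi>')). (Conj \<pi> \<pi>', \<Psi> @ \<Psi>')"
  let ?X = "map ?c (List.product D E)"
  have "set ?X \<subseteq> B \<times> lists B"
  proof
    fix p assume "p \<in> set ?X"
    then obtain \<pi> \<Psi> \<pi>' \<Psi>' where "(\<pi>, \<Psi>) \<in> set D" "(\<pi>', \<Psi>') \<in> set E" "p = (Conj \<pi> \<pi>', \<Psi> @ \<Psi>')" by auto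
    moreover from this have "\<pi> \<in> B" "set \<Psi> \<subseteq> B" "\<pi>' \<in> B" "set \<Psi>' \<subseteq> B"
      using subsetD[OF D, of "(\<pi>, \<Psi>)"] subsetD[OF E, of "(\<pi>', \<Psi>')"] by auto
    moreover have "Conj \<pi> \<pi>' \<in> B" if "\<pi> \<in> B" "\<pi>' \<in> B"
      using B that unfolding conj_closed_def by blast
    ultimately show "p \<in> B \<times> lists B" by auto
  qed
  moreover have "Q v \<and> R v \<longleftrightarrow> (\<exists>(\<pi>, \<Psi>)\<in>set ?X. v \<pi> \<and> (\<forall>\<psi>\<in>set \<Psi>. \<not> v \<psi>))" if v: "v \<in> W" for v
  proof -
    have "(\<exists>(\<pi>, \<Psi>)\<in>set ?X. v \<pi> \<and> (\<forall>\<psi>\<in>set \<Psi>. \<not> v \<psi>)) \<longleftrightarrow>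
      (\<exists>p\<in>set D. \<exists>q\<in>set E. v (Conj (fst p) (fst q)) \<and> (\<forall>\<psi>\<in>set (snd p) \<union> set (snd q). \<not> v \<psi>))"
      by (simp add: split_beta Bex_def)
    also have "\<dots> \<longleftrightarrow> (\<exists>p\<in>set D. \<exists>q\<in>set E. (v (fst p) \<and> (\<forall>\<psi>\<in>set (snd p). \<not> v \<psi>)) \<and>
        (v (fst q) \<and> (\<forall>\<psi>\<in>set (snd q). \<not> v \<psi>)))"
    proof -
      have "v (Conj \<phi> \<psi>) \<longleftrightarrow> v \<phi> \<and> v \<psi>" for \<phi> \<psi>
        using B v by (simp add: conj_closed_def)
      then show ?thesis by (simp only: ball_Un conj_ac)
    qed
    also have "\<dots> \<longleftrightarrow> Q v \<and> R v" unfolding Q[OF v] R[OF v] split_beta by blast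
    finally show ?thesis by simp
  qed
  ultimately show ?thesis by (rule dnfI)
qed

text \<open>The negation of one disjunct is a disjunction of literals, and the negations of all
  disjuncts are conjoined by \<open>dnf_conj\<close>.\<close>

lemma dnf_not:
  assumes B: "conj_closed B W" and "dnf B W Q"
  shows "dnf B W (\<lambda>v. \<not> Q v)"
proof -
  obtain D where D: "set D \<subseteq> B \<times> lists B"
    and Q: "\<And>v. v \<in> W \<Longrightarrow> Q v \<longleftrightarrow> (\<exists>(\<pi>, \<Psi>)\<in>set D. v \<pi> \<and> (\<forall>\<psi>\<in>set \<Psi>. \<not> v \<psi>))"
    by (rule dnfE[OF assms(2)]) (rule that)
  have ex: "dnf B W (\<lambda>v. \<exists>\<psi>\<in>set \<Psi>. v \<psi>)" if "set \<Psi> \<subseteq> B" for \<Psi>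
    using that
  proof (induction \<Psi>)
    case Nil then show ?case by (simp add: dnf_False)
  next
    case (Cons \<psi> \<Psi>)
    then show ?case using dnf_disj[OF dnf_literal[of \<psi> B W]] by simp
  qed
  have "dnf B W (\<lambda>v. \<not> (\<exists>(\<pi>, \<Psi>)\<in>set D. v \<pi> \<and> (\<forall>\<psi>\<in>set \<Psi>. \<not> v \<psi>)))"
    using D
  proof (induction D)
    case Nil
    have "dnf B W (\<lambda>v. v Top)" using B by (intro dnf_literal) (simp add: conj_closed_def)
    then show ?case by (rule dnf_cong) (use B in \<open>auto simp: conj_closed_def\<close>)
  next
    case (Cons p D)
    obtain \<pi> \<Psi> where p: "p = (\<pi>, \<Psi>)" "\<pi> \<in> B" "set \<Psi> \<subseteq> B" using Cons.prems by fastforce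
    have "dnf B W (\<lambda>v. (\<not> v \<pi> \<or> (\<exists>\<psi>\<in>set \<Psi>. v \<psi>)) \<and>
        \<not> (\<exists>(\<pi>, \<Psi>)\<in>set D. v \<pi> \<and> (\<forall>\<psi>\<in>set \<Psi>. \<not> v \<psi>)))"
      using Cons p by (intro dnf_conj[OF B] dnf_disj dnf_negated_literal[OF B] ex) auto
    then show ?case by (rule dnf_cong) (auto simp: p(1))
  qed
  then show ?thesis by (rule dnf_cong) (simp add: Q)
qed

text \<open>Putting the valuations of both powers into one \<open>W\<close> yields a normal form
  common to them. The bound on free variables ensures that a sentence is reduced to Palyutin
  sentences. Only \<exists> needs an idea, namely \<open>frechet_power_Ex_conj\<close> applied to
  every disjunct; \<forall> is treated through negation.\<close>

lemma frechet_power_dnf: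
  fixes M :: "('f, 'p, 'a) fo_structure" and N :: "('f, 'p, 'b) fo_structure"
  assumes M: "is_structure L M" and N: "is_structure L N" and "is_fm L \<phi>"
  defines "P \<equiv> red_power (UNIV :: nat set) cofinite M"
    and "Q \<equiv> red_power (UNIV :: nat set) cofinite N"
  defines "W \<equiv> sat P ` {e. range e \<subseteq> Dom P} \<union> sat Q ` {e. range e \<subseteq> Dom Q}"
  shows "dnf {\<pi> \<in> palyutin L. free_vars \<pi> \<subseteq> free_vars \<phi>} W (\<lambda>v. v \<phi>)"
proof -
  let ?B = "\<lambda>V. {\<pi> \<in> palyutin L. free_vars \<pi> \<subseteq> V}"
  have cl: "conj_closed (?B V) W" for V
    unfolding conj_closed_def W_def by (auto intro: palyutin.intros)
  have W: "v \<in> W \<longleftrightarrow> (\<exists>e. range e \<subseteq> Dom P \<and> v = sat P e) \<or> (\<exists>e. range e \<subseteq> Dom Q \<and> v = sat Q e)" for v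
    unfolding W_def by blast
  have dnf_Ex: "dnf (?B (V - {x})) W (\<lambda>v. v (Ex x \<phi>))" if \<phi>: "dnf (?B V) W (\<lambda>v. v \<phi>)" for V x \<phi>
  proof -
    obtain D where D: "set D \<subseteq> ?B V \<times> lists (?B V)"
      and v: "\<And>v. v \<in> W \<Longrightarrow> v \<phi> \<longleftrightarrow> (\<exists>(\<pi>, \<Psi>)\<in>set D. v \<pi> \<and> (\<forall>\<psi>\<in>set \<Psi>. \<not> v \<psi>))"
      by (rule dnfE[OF \<phi>]) (rule that)
    let ?g = "\<lambda>(\<pi>, \<Psi>). (Ex x \<pi>, map (\<lambda>\<psi>. Conj (Ex x \<pi>) (All x (Imp \<pi> \<psi>))) \<Psi>)"
    have "set (map ?g D) \<subseteq> ?B (V - {x}) \<times> lists (?B (V - {x}))"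
    proof
      fix p assume "p \<in> set (map ?g D)"
      then obtain \<pi> \<Psi> where "(\<pi>, \<Psi>) \<in> set D" and p: "p = ?g (\<pi>, \<Psi>)" by auto
      then have \<pi>: "\<pi> \<in> palyutin L" "free_vars \<pi> \<subseteq> V"
        using D by auto
      have \<Psi>: "\<psi> \<in> palyutin L \<and> free_vars \<psi> \<subseteq> V" if "\<psi> \<in> set \<Psi>" for \<psi>
        using subsetD[OF D \<open>(\<pi>, \<Psi>) \<in> set D\<close>] that by auto
      from \<pi> have "Ex x \<pi> \<in> ?B (V - {x})" by (auto intro: palyutin.Ex)
      moreover have "Conj (Ex x \<pi>) (All x (Imp \<pi> \<psi>)) \<in> ?B (V - {x})" if "\<psi> \<in> set \<Psi>" for \<psi>
        using \<pi> \<Psi>[OF that] palyutin.ExAllImp[of \<pi> L \<psi> x] by auto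
      ultimately show "p \<in> ?B (V - {x}) \<times> lists (?B (V - {x}))"
        unfolding p prod.case mem_Times_iff fst_conv snd_conv in_lists_conv_set set_map by blast
    qed
    \<comment> \<open>Stated for the power of a structure \<open>K\<close> over a type of its own,
      so that it can be instantiated with \<open>M\<close> as well as with \<open>N\<close>.\<close>
    moreover have "sat R e (Ex x \<phi>) \<longleftrightarrow>
       (\<exists>(\<pi>, \<Psi>)\<in>set (map ?g D). sat R e \<pi> \<and> (\<forall>\<psi>\<in>set \<Psi>. \<not> sat R e \<psi>))"
      if e: "range e \<subseteq> Dom R" and R: "R = red_power (UNIV :: nat set) cofinite K"
        and K: "is_structure L K" and RW: "\<And>e. range e \<subseteq> Dom R \<Longrightarrow> sat R e \<in> W"
      for e R and K :: "('f, 'p, 'k) fo_structure"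
    proof -
      have "sat R e (Ex x \<phi>) \<longleftrightarrow> (\<exists>a\<in>Dom R. \<exists>(\<pi>, \<Psi>)\<in>set D. sat R (e(x := a)) \<pi> \<and>
           (\<forall>\<psi>\<in>set \<Psi>. \<not> sat R (e(x := a)) \<psi>))"
        using v[OF RW[OF range_upd[OF e]]] by (simp cong: bex_cong)
      also have "\<dots> \<longleftrightarrow> (\<exists>(\<pi>, \<Psi>)\<in>set D. \<exists>a\<in>Dom R. sat R (e(x := a)) \<pi> \<and>
           (\<forall>\<psi>\<in>set \<Psi>. \<not> sat R (e(x := a)) \<psi>))"
        by blast
      also have "\<dots> \<longleftrightarrow> (\<exists>(\<pi>, \<Psi>)\<in>set D. sat R e (Ex x \<pi>) \<and>
           (\<forall>\<psi>\<in>set \<Psi>. \<not> sat R e (Conj (Ex x \<pi>) (All x (Imp \<pi> \<psi>)))))"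
      proof (rule bex_cong[OF refl], clarify)
        fix \<pi> \<Psi> assume "(\<pi>, \<Psi>) \<in> set D"
        then have "\<pi> \<in> palyutin L" "set \<Psi> \<subseteq> palyutin L" using D by auto
        then show "(\<exists>a\<in>Dom R. sat R (e(x := a)) \<pi> \<and> (\<forall>\<psi>\<in>set \<Psi>. \<not> sat R (e(x := a)) \<psi>)) \<longleftrightarrow>
            sat R e (Ex x \<pi>) \<and> (\<forall>\<psi>\<in>set \<Psi>. \<not> sat R e (Conj (Ex x \<pi>) (All x (Imp \<pi> \<psi>))))"
          unfolding R using e[unfolded R] by (intro frechet_power_Ex_conj[OF K]) auto
      qed
      also have "\<dots> \<longleftrightarrow> (\<exists>(\<pi>, \<Psi>)\<in>set (map ?g D). sat R e \<pi> \<and> (\<forall>\<psi>\<in>set \<Psi>. \<not> sat R e \<psi>))"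
        by (simp add: split_beta del: sat.simps)
      finally show ?thesis .
    qed
    note * = this
    have "v (Ex x \<phi>) \<longleftrightarrow> (\<exists>(\<pi>, \<Psi>)\<in>set (map ?g D). v \<pi> \<and> (\<forall>\<psi>\<in>set \<Psi>. \<not> v \<psi>))" if "v \<in> W" for v
    proof -
      from that consider e where "range e \<subseteq> Dom P" "v = sat P e"
        | e where "range e \<subseteq> Dom Q" "v = sat Q e"
        unfolding W by blast
      then show ?thesis
      proof cases
        case (1 e)
        show ?thesis unfolding 1(2)
          by (rule *[OF 1(1) meta_eq_to_obj_eq[OF P_def] M]) (use W in blast)
      next
        case (2 e)
        show ?thesis unfolding 2(2)
          by (rule *[OF 2(1) meta_eq_to_obj_eq[OF Q_def] N]) (use W in blast)
      qed
    qed
    ultimately show ?thesis by (rule dnfI)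
  qed
  show ?thesis using assms(3)
  proof (induction \<phi>)
    case Top then show ?case by (intro dnf_literal) (auto intro: palyutin.intros)
  next
    case Bot then show ?case by (intro dnf_literal) (auto intro: palyutin.intros)
  next
    case (Eq s t) then show ?case by (intro dnf_literal) (auto intro: palyutin.intros)
  next
    case (Rel r ts) then show ?case by (intro dnf_literal) (auto intro: palyutin.intros)
  next
    case (Neg \<phi>)
    then have "dnf (?B (free_vars \<phi>)) W (\<lambda>v. \<not> v \<phi>)" by (intro dnf_not[OF cl]) auto
    then have "dnf (?B (free_vars \<phi>)) W (\<lambda>v. v (Neg \<phi>))" by (rule dnf_cong) (auto simp: W)
    then show ?case by simp
  next
    case (Conj \<phi> \<psi>)
    let ?C = "?B (free_vars (Conj \<phi> \<psi>))"
    have 1: "dnf ?C W (\<lambda>v. v \<phi>)" by (rule dnf_mono[OF Conj.IH(1)]) (use Conj.prems in auto)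
    have 2: "dnf ?C W (\<lambda>v. v \<psi>)" by (rule dnf_mono[OF Conj.IH(2)]) (use Conj.prems in auto)
    from dnf_conj[OF cl 1 2] show ?case by (rule dnf_cong) (auto simp: W)
  next
    case (Disj \<phi> \<psi>)
    let ?C = "?B (free_vars (Disj \<phi> \<psi>))"
    have 1: "dnf ?C W (\<lambda>v. v \<phi>)" by (rule dnf_mono[OF Disj.IH(1)]) (use Disj.prems in auto)
    have 2: "dnf ?C W (\<lambda>v. v \<psi>)" by (rule dnf_mono[OF Disj.IH(2)]) (use Disj.prems in auto)
    from dnf_disj[OF 1 2] show ?case by (rule dnf_cong) (auto simp: W)
  next
    case (Imp \<phi> \<psi>)
    let ?C = "?B (free_vars (Imp \<phi> \<psi>))"
    have 1: "dnf ?C W (\<lambda>v. v \<phi>)" by (rule dnf_mono[OF Imp.IH(1)]) (use Imp.prems in auto)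
    have 2: "dnf ?C W (\<lambda>v. v \<psi>)" by (rule dnf_mono[OF Imp.IH(2)]) (use Imp.prems in auto)
    from dnf_disj[OF dnf_not[OF cl 1] 2] show ?case by (rule dnf_cong) (auto simp: W)
  next
    case (Ex x \<phi>)
    then show ?case using dnf_Ex[of "free_vars \<phi>" \<phi> x] by simp
  next
    case (All x \<phi>)
    then have "dnf (?B (free_vars \<phi>)) W (\<lambda>v. \<not> v \<phi>)" by (intro dnf_not[OF cl]) auto
    then have "dnf (?B (free_vars \<phi>)) W (\<lambda>v. v (Neg \<phi>))" by (rule dnf_cong) (auto simp: W)
    from dnf_not[OF cl dnf_Ex[OF this, of x]]
    have "dnf (?B (free_vars \<phi> - {x})) W (\<lambda>v. v (All x \<phi>))" by (rule dnf_cong) (auto simp: W)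
    then show ?case by simp
  qed
qed

text \<open>Each structure is Palyutin equivalent to its Frechet power, so the two powers agree on
  Palyutin sentences, and thus on the common normal form of any sentence. The constant assignments
  \<open>e\<close> and \<open>d\<close> only serve to evaluate sentences.\<close>

theorem palyutin_equiv_imp_frechet_power_elem_equiv:
  fixes M :: "('f, 'p, 'a) fo_structure" and N :: "('f, 'p, 'b) fo_structure"
  assumes M: "is_structure L M" and N: "is_structure L N" and "palyutin_equiv L M N"
  shows "elem_equiv L (red_power (UNIV :: nat set) cofinite M) (red_power (UNIV :: nat set) cofinite N)"
    (is "elem_equiv L ?P ?Q")
  unfolding elem_equiv_def
proof (intro allI impI)
  fix \<phi> assume \<phi>: "is_fm L \<phi> \<and> free_vars \<phi> = {}"
  have PQ: "palyutin_equiv L ?P ?Q"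
    using assms palyutin_equiv_red_power[OF M proper_filter_on_cofinite]
      palyutin_equiv_red_power[OF N proper_filter_on_cofinite]
    unfolding palyutin_equiv_def by blast
  have ne: "Dom (red_power (UNIV :: nat set) cofinite K) \<noteq> {}" if "is_structure L K"
    for K :: "('f, 'p, 'k) fo_structure"
    using red_prod_is_structure[of "UNIV :: nat set" L "\<lambda>_. K" cofinite] that
    unfolding red_power_def is_structure_def by blast
  obtain p q where pq: "p \<in> Dom ?P" "q \<in> Dom ?Q" using ne[OF M] ne[OF N] by blast
  define e d where "e = (\<lambda>_::nat. p)" and "d = (\<lambda>_::nat. q)"
  have e: "range e \<subseteq> Dom ?P" and d: "range d \<subseteq> Dom ?Q" using pq by (auto simp: e_def d_def)
  have pal: "sat ?P e \<pi> \<longleftrightarrow> sat ?Q d \<pi>" if \<pi>: "\<pi> \<in> palyutin L" "free_vars \<pi> = {}" for \<pi>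
    using models_sentence[OF \<pi>(2) e] models_sentence[OF \<pi>(2) d] \<pi> PQ
    unfolding palyutin_equiv_def by blast
  let ?W = "sat ?P ` {e. range e \<subseteq> Dom ?P} \<union> sat ?Q ` {e. range e \<subseteq> Dom ?Q}"
  have "dnf {\<pi> \<in> palyutin L. free_vars \<pi> \<subseteq> {}} ?W (\<lambda>v. v \<phi>)"
    using frechet_power_dnf[OF M N conjunct1[OF \<phi>]] unfolding conjunct2[OF \<phi>] .
  then obtain D where D: "set D \<subseteq> {\<pi> \<in> palyutin L. free_vars \<pi> \<subseteq> {}} \<times> lists {\<pi> \<in> palyutin L. free_vars \<pi> \<subseteq> {}}"
    and v: "\<And>v. v \<in> ?W \<Longrightarrow> v \<phi> \<longleftrightarrow> (\<exists>(\<pi>, \<Psi>)\<in>set D. v \<pi> \<and> (\<forall>\<psi>\<in>set \<Psi>. \<not> v \<psi>))"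
    by (rule dnfE) (rule that)
  have "sat ?P e \<phi> \<longleftrightarrow> (\<exists>(\<pi>, \<Psi>)\<in>set D. sat ?P e \<pi> \<and> (\<forall>\<psi>\<in>set \<Psi>. \<not> sat ?P e \<psi>))"
    by (rule v) (use e in blast)
  moreover have "sat ?Q d \<phi> \<longleftrightarrow> (\<exists>(\<pi>, \<Psi>)\<in>set D. sat ?Q d \<pi> \<and> (\<forall>\<psi>\<in>set \<Psi>. \<not> sat ?Q d \<psi>))"
    by (rule v) (use d in blast)
  moreover have "(sat ?P e \<pi> \<and> (\<forall>\<psi>\<in>set \<Psi>. \<not> sat ?P e \<psi>)) \<longleftrightarrow>
      (sat ?Q d \<pi> \<and> (\<forall>\<psi>\<in>set \<Psi>. \<not> sat ?Q d \<psi>))" if "(\<pi>, \<Psi>) \<in> set D" for \<pi> \<Psi>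
  proof -
    have "\<And>\<psi>. \<psi> \<in> set (\<pi> # \<Psi>) \<Longrightarrow> sat ?P e \<psi> \<longleftrightarrow> sat ?Q d \<psi>"
      using D that by (intro pal) auto
    then show ?thesis by simp
  qed
  then have "(\<exists>(\<pi>, \<Psi>)\<in>set D. sat ?P e \<pi> \<and> (\<forall>\<psi>\<in>set \<Psi>. \<not> sat ?P e \<psi>)) \<longleftrightarrow>
      (\<exists>(\<pi>, \<Psi>)\<in>set D. sat ?Q d \<pi> \<and> (\<forall>\<psi>\<in>set \<Psi>. \<not> sat ?Q d \<psi>))"
    by (intro bex_cong[OF refl]) (simp only: split_paired_all prod.case)
  ultimately have "sat ?P e \<phi> \<longleftrightarrow> sat ?Q d \<phi>" by blast
  then show "models ?P \<phi> \<longleftrightarrow> models ?Q \<phi>"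
    using models_sentence[of \<phi> e ?P] models_sentence[of \<phi> d ?Q] \<phi> d e by blast
qed

section \<open>Cardinalities, ultrafilters and independent families\<close>

unbundle cardinal_syntax

lemma card_of_lists_ordLeq_infinite:
  assumes "infinite B" "|A| \<le>o |B|"
  shows "|lists A| \<le>o |B|"
proof -
  have "|{xs \<in> lists A. length xs = n}| \<le>o |B|" for n
  proof (induction n)
    case 0
    have "{xs \<in> lists A. length xs = 0} = {[]}" by auto
    then show ?case using assms(1) by (metis card_of_singl_ordLeq finite.emptyI)
  next
    case (Suc n)
    have "{xs \<in> lists A. length xs = Suc n} \<subseteq> (\<lambda>(x, xs). x # xs) ` (A \<times> {xs \<in> lists A. length xs = n})"
      by (auto simp: length_Suc_conv image_iff)
    then have "|{xs \<in> lists A. length xs = Suc n}| \<le>o |A \<times> {xs \<in> lists A. length xs = n}|"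
      by (rule surj_imp_ordLeq)
    also have "|A \<times> {xs \<in> lists A. length xs = n}| \<le>o |B|"
      using assms Suc by (intro card_of_Sigma_ordLeq_infinite) auto
    finally show ?case .
  qed
  moreover have "|UNIV :: nat set| \<le>o |B|" using assms(1) infinite_iff_card_of_nat by blast
  ultimately have "|\<Union>n. {xs \<in> lists A. length xs = n}| \<le>o |B|"
    using assms(1) by (intro card_of_UNION_ordLeq_infinite) auto
  moreover have "lists A = (\<Union>n. {xs \<in> lists A. length xs = n})" by auto
  ultimately show ?thesis by simp
qed

lemma card_of_finite_subsets_ordLeq_infinite:
  assumes "infinite B" "|A| \<le>o |B|"
  shows "|{C. finite C \<and> C \<subseteq> A}| \<le>o |B|"
proof -
  have "{C. finite C \<and> C \<subseteq> A} \<subseteq> set ` lists A"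
    by (auto simp: image_iff) (metis finite_list in_listsI subset_iff)
  from ordLeq_transitive[OF surj_imp_ordLeq[OF this] card_of_lists_ordLeq_infinite[OF assms]]
  show ?thesis .
qed

lemma card_of_Plus_ordLeq_infinite:
  assumes "infinite C" "|A| \<le>o |C|" "|B| \<le>o |C|"
  shows "|A <+> B| \<le>o |C|"
  using ordLeq_transitive[OF card_of_Plus_mono[OF assms(2,3)]]
    ordIso_imp_ordLeq[OF card_of_Plus_infinite1[OF assms(1) card_of_refl[THEN ordIso_imp_ordLeq]]]
  by blast

lemma card_of_Plus_ordLess_infinite:
  assumes "infinite A" "|A| <o |C|" "|B| <o |C|"
  shows "|A <+> B| <o |C|"
proof (cases "|B| \<le>o |A|")
  case True
  then show ?thesis using card_of_Plus_infinite1[OF assms(1)] assms(2) ordIso_ordLess_trans by blast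
next
  case False
  then have le: "|A| \<le>o |B|"
    using ordLeq_total[OF card_of_Well_order card_of_Well_order] by blast
  then have "infinite B" using assms(1) card_of_ordLeq_infinite by blast
  from card_of_Plus_infinite2[OF this le] show ?thesis using assms(3) ordIso_ordLess_trans by blast
qed

text \<open>The cardinal of a type is itself a well-order of the type, in which every proper initial
  segment has smaller cardinality. It serves both as the order for transfinite recursion and as the
  source of size bounds on \<open>underS\<close>.\<close>

lemma card_of_UNIV_wf: "wf ( |UNIV :: 'a set| - Id)"
  using card_of_well_order_on[of "UNIV :: 'a set"] unfolding well_order_on_def by simp

lemma card_of_UNIV_underS_total:
  "k \<noteq> l \<Longrightarrow> k \<in> underS |UNIV :: 'a set| l \<or> l \<in> underS |UNIV :: 'a set| k"
  using card_of_well_order_on[of "UNIV :: 'a set"]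
  unfolding well_order_on_def linear_order_on_def total_on_def underS_def by auto

lemma card_of_UNIV_underS_trans:
  assumes "k \<in> underS |UNIV :: 'a set| l" "l \<in> underS |UNIV :: 'a set| m"
  shows "k \<in> underS |UNIV :: 'a set| m"
proof -
  have "trans |UNIV :: 'a set|" "antisym |UNIV :: 'a set|"
    using card_of_well_order_on[of "UNIV :: 'a set"]
    unfolding well_order_on_def linear_order_on_def partial_order_on_def preorder_on_def by auto
  then show ?thesis using assms unfolding underS_def by (auto dest: transD antisymD)
qed

section \<open>The number of formulas\<close>

text \<open>The parameter \<open>c\<close> is meant to be an injection of lists of tokens into
  \<open>'x\<close>. A token is a symbol, a number, or a list of codes already computed, so the
  recursion stays inside \<open>'x\<close>.\<close>

primrec code_tm :: "(('f + 'p + nat + 'x list) list \<Rightarrow> 'x) \<Rightarrow> 'f tm \<Rightarrow> 'x" where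
  "code_tm c (Var n) = c [Inr (Inr (Inl n))]"
| "code_tm c (App f ts) = c [Inl f, Inr (Inr (Inr (map (code_tm c) ts)))]"

text \<open>The numbers 0 to 8 are tags for the constructors, while \<open>Rel\<close> is recognized
  by its leading relation symbol. A term and a formula may receive the same code; this is harmless,
  because the tag determines the kind of every argument.\<close>

primrec code_fm :: "(('f + 'p + nat + 'x list) list \<Rightarrow> 'x) \<Rightarrow> ('f, 'p) fm \<Rightarrow> 'x" where
  "code_fm c Top = c [Inr (Inr (Inl 0))]"
| "code_fm c Bot = c [Inr (Inr (Inl 1))]"
| "code_fm c (Eq s t) = c [Inr (Inr (Inl 2)), Inr (Inr (Inr [code_tm c s, code_tm c t]))]"
| "code_fm c (Rel r ts) = c [Inr (Inl r), Inr (Inr (Inr (map (code_tm c) ts)))]"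
| "code_fm c (Neg \<phi>) = c [Inr (Inr (Inl 3)), Inr (Inr (Inr [code_fm c \<phi>]))]"
| "code_fm c (Conj \<phi> \<psi>) = c [Inr (Inr (Inl 4)), Inr (Inr (Inr [code_fm c \<phi>, code_fm c \<psi>]))]"
| "code_fm c (Disj \<phi> \<psi>) = c [Inr (Inr (Inl 5)), Inr (Inr (Inr [code_fm c \<phi>, code_fm c \<psi>]))]"
| "code_fm c (Imp \<phi> \<psi>) = c [Inr (Inr (Inl 6)), Inr (Inr (Inr [code_fm c \<phi>, code_fm c \<psi>]))]"
| "code_fm c (Ex x \<phi>) = c [Inr (Inr (Inl 7)), Inr (Inr (Inl x)), Inr (Inr (Inr [code_fm c \<phi>]))]"
| "code_fm c (All x \<phi>) = c [Inr (Inr (Inl 8)), Inr (Inr (Inl x)), Inr (Inr (Inr [code_fm c \<phi>]))]"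

lemma inj_code_tm:
  assumes "inj c"
  shows "inj (code_tm c)"
proof -
  have "code_tm c s = code_tm c t \<Longrightarrow> s = t" for s t
  proof (induction s arbitrary: t)
    case (Var n) then show ?case using injD[OF assms] by (cases t) fastforce+
  next
    case (App f ts)
    then obtain us where t: "t = App f us" and "map (code_tm c) ts = map (code_tm c) us"
      using injD[OF assms] by (cases t) fastforce+
    then have "ts = us" using App.IH by (auto intro!: nth_equalityI dest!: map_eq_imp_length_eq
        simp: list_eq_iff_nth_eq)
    then show ?case using t by simp
  qed
  then show ?thesis by (rule injI)
qed

lemma inj_code_fm:
  assumes c: "inj c"
  shows "inj (code_fm c)"
proof -
  note eq = inj_eq[OF c] inj_eq[OF inj_code_tm[OF c]] inj_map_eq_map[OF inj_code_tm[OF c]]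
  have "code_fm c \<phi> = code_fm c \<psi> \<Longrightarrow> \<phi> = \<psi>" for \<phi> \<psi>
    by (induction \<phi> arbitrary: \<psi>; case_tac \<psi>) (simp_all add: eq)
  then show ?thesis by (rule injI)
qed

lemma card_of_fm:
  assumes "infinite (UNIV :: 'x set)"
    and "|UNIV :: 'f set| \<le>o |UNIV :: 'x set|" "|UNIV :: 'p set| \<le>o |UNIV :: 'x set|"
  shows "|UNIV :: ('f, 'p) fm set| \<le>o |UNIV :: 'x set|"
proof -
  have "|UNIV :: nat set| \<le>o |UNIV :: 'x set|" using assms(1) infinite_iff_card_of_nat by blast
  moreover have "|UNIV :: 'x list set| \<le>o |UNIV :: 'x set|"
    using card_of_lists_ordLeq_infinite[OF assms(1), of "UNIV :: 'x set"]
    by (simp add: card_of_refl ordIso_imp_ordLeq lists_UNIV)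
  ultimately have "|UNIV :: ('f + 'p + nat + 'x list) set| \<le>o |UNIV :: 'x set|"
    unfolding UNIV_Plus_UNIV[symmetric] using assms by (intro card_of_Plus_ordLeq_infinite)
  from card_of_lists_ordLeq_infinite[OF assms(1) this]
  obtain c :: "('f + 'p + nat + 'x list) list \<Rightarrow> 'x" where "inj c"
    unfolding lists_UNIV card_of_ordLeq[symmetric] by blast
  from inj_code_fm[OF this] show ?thesis unfolding card_of_ordLeq[symmetric] by blast
qed

section \<open>Ultrafilters from the finite intersection property\<close>

lemma ultrafilter_below:
  assumes "F \<noteq> bot"
  obtains U where "U \<le> F" "ultrafilter_on UNIV U"
proof -
  \<comment> \<open>A smaller filter in this order has more sets, so Zorn's lemma is applied to the
    reversed order, and ultrafilters are the minimal proper filters.\<close>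
  let ?A = "{G. G \<noteq> bot \<and> G \<le> F}" and ?P = "\<lambda>x y :: 'a filter. y \<le> x"
  have "\<exists>m\<in>?A. \<forall>a\<in>?A. ?P m a \<longrightarrow> a = m"
  proof (rule predicate_Zorn)
    show "partial_order_on ?A (relation_of ?P ?A)"
      by (rule partial_order_on_relation_ofI) auto
    fix C assume "C \<in> Chains (relation_of ?P ?A)"
    then have C: "C \<subseteq> ?A" "\<And>G H. G \<in> C \<Longrightarrow> H \<in> C \<Longrightarrow> G \<le> H \<or> H \<le> G"
      by (auto simp: Chains_def relation_of_def)
    show "\<exists>u\<in>?A. \<forall>a\<in>C. ?P a u"
    proof (cases "C = {}")
      case True then show ?thesis using assms by auto
    next
      case False
      \<comment> \<open>A finite nonempty part of a chain attains its infimum, which is therefore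
        proper; by compactness of properness the infimum of the whole chain is proper too.\<close>
      have min: "Inf X \<in> X" if "finite X" "X \<noteq> {}" "X \<subseteq> C" for X
        using that
      proof (induction X rule: finite_ne_induct)
        case (insert G X)
        then have "Inf X \<in> C" "G \<in> C" by auto
        then have "inf G (Inf X) = G \<or> inf G (Inf X) = Inf X" using C(2) by (metis inf.absorb1 inf.absorb2)
        then show ?case using insert by auto
      qed simp
      have "Inf C \<noteq> bot"
      proof (rule INF_filter_not_bot[of C "\<lambda>G. G", simplified])
        fix X assume X: "X \<subseteq> C" "finite X"
        show "Inf X \<noteq> bot"
        proof (cases "X = {}")
          case True
          have "F \<le> Inf X" unfolding True by simp
          then show ?thesis using assms by (metis le_bot)
        next
          case X': False then show ?thesis using min[OF X(2) X' X(1)] X(1) C(1) by blast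
        qed
      qed
      moreover have "Inf C \<le> F" using False C(1) by (metis (mono_tags, lifting) Inf_lower2 ex_in_conv mem_Collect_eq subsetD)
      ultimately show ?thesis by (intro bexI[of _ "Inf C"]) (auto intro: Inf_lower)
    qed
  qed
  then obtain U where U: "U \<noteq> bot" "U \<le> F" "\<And>G. G \<noteq> bot \<Longrightarrow> G \<le> U \<Longrightarrow> G = U"
    by (auto intro: order_trans)
  have "eventually (\<lambda>j. j \<in> A) U \<or> eventually (\<lambda>j. j \<in> UNIV - A) U" for A
  proof (cases "inf U (principal A) = bot")
    case True
    then have "eventually (\<lambda>j. j \<in> UNIV - A) U"
      by (auto simp: trivial_limit_def eventually_inf_principal)
    then show ?thesis ..
  next
    case False
    then have "inf U (principal A) = U" using U(3) by simp
    then have "U \<le> principal A" by (metis inf.cobounded2)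
    then show ?thesis by (simp add: le_principal)
  qed
  then have "ultrafilter_on UNIV U" using U(1) by (simp add: ultrafilter_on_def proper_filter_on_def)
  then show ?thesis using that U(2) by blast
qed

lemma ultrafilter_of_fip:
  assumes "\<And>C. finite C \<Longrightarrow> C \<subseteq> X \<Longrightarrow> (\<Inter>c\<in>C. E c) \<noteq> {}"
  obtains U where "ultrafilter_on UNIV U" "\<And>c. c \<in> X \<Longrightarrow> eventually (\<lambda>j. j \<in> E c) U"
proof -
  have "(INF c\<in>X. principal (E c)) \<noteq> bot"
  proof (rule INF_filter_not_bot)
    fix C assume "C \<subseteq> X" "finite C"
    then have "(\<Inter>c\<in>C. E c) \<noteq> {}" using assms by blast
    then show "(INF c\<in>C. principal (E c)) \<noteq> bot"
      using \<open>finite C\<close> by (simp add: INF_principal_finite principal_eq_bot_iff)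
  qed
  then obtain U where U: "U \<le> (INF c\<in>X. principal (E c))" "ultrafilter_on UNIV U"
    by (rule ultrafilter_below)
  have "eventually (\<lambda>j. j \<in> E c) U" if "c \<in> X" for c
    using order_trans[OF U(1) INF_lower[OF that]] by (simp add: le_principal)
  then show ?thesis using that U(2) by blast
qed

section \<open>Independent families of functions\<close>

text \<open>\<open>S\<close> holds the members of the family that are already spent. To the
  remaining ones \<open>E\<close> looks as rich as the whole index set: it meets every set given by
  at most \<open>|'k|\<close> prescribed values. For \<open>S = {}\<close> and
  \<open>E = UNIV\<close> this is the classical notion of an independent family of
  functions.\<close>

definition indep :: "('t \<Rightarrow> 'j \<Rightarrow> 'k) \<Rightarrow> 't set \<Rightarrow> 'j set \<Rightarrow> bool" where
  "indep f S E \<longleftrightarrow>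
     (\<forall>A p. |A| \<le>o |UNIV :: 'k set| \<longrightarrow> A \<inter> S = {} \<longrightarrow> (\<exists>j\<in>E. \<forall>t\<in>A. f t j = p t))"

lemma indep_mono:
  fixes f :: "'t \<Rightarrow> 'j \<Rightarrow> 'k"
  assumes "indep f S E" "S \<subseteq> S'" "E \<subseteq> E'"
  shows "indep f S' E'"
  unfolding indep_def
proof (intro allI impI)
  fix A p assume "|A| \<le>o |UNIV :: 'k set|" "A \<inter> S' = {}"
  moreover from this assms(2) have "A \<inter> S = {}" by blast
  ultimately have "\<exists>j\<in>E. \<forall>t\<in>A. f t j = p t"
    using assms(1) unfolding indep_def by simp
  then show "\<exists>j\<in>E'. \<forall>t\<in>A. f t j = p t" using assms(3) by blast
qed

text \<open>
  An index \<open>j\<close> codes a \<open>'k\<close>-sequence \<open>s\<close> of points together with a table assigning values in \<open>'k\<close> to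
  possible traces of a set on \<open>s\<close>; \<open>f t j\<close> looks up the trace of \<open>t\<close>. At most \<open>|'k|\<close> sets are separated
  by a suitable \<open>s\<close>.
\<close>

lemma indep_family_exists:
  assumes inf: "infinite (UNIV :: 'k set)"
  shows "\<exists>f :: 'k set set \<Rightarrow> 'k set \<Rightarrow> 'k. indep f {} UNIV"
proof -
  have k2: "|UNIV :: ('k \<times> 'k) set| \<le>o |UNIV :: 'k set|"
    using card_of_Times_same_infinite[OF inf] by (simp add: ordIso_imp_ordLeq)
  have "|UNIV :: nat set| \<le>o |UNIV :: 'k set|" using inf infinite_iff_card_of_nat by blast
  then have "|(UNIV :: 'k set) \<times> (UNIV :: nat set)| \<le>o |UNIV :: 'k set|"
    using inf by (intro card_of_Sigma_ordLeq_infinite) (auto simp: card_of_refl ordIso_imp_ordLeq)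
  then have "|(UNIV :: nat set) \<times> (UNIV :: 'k set)| \<le>o |UNIV :: 'k set|"
    using card_of_Times_commute ordIso_ordLeq_trans by blast
  then have "|(UNIV :: 'k set) \<times> ((UNIV :: nat set) \<times> (UNIV :: 'k set))| \<le>o |UNIV :: 'k set|"
    using inf by (intro card_of_Sigma_ordLeq_infinite) (auto simp: card_of_refl ordIso_imp_ordLeq)
  then obtain e :: "'k \<times> nat \<times> 'k \<Rightarrow> 'k" where e: "inj e"
    unfolding card_of_ordLeq[symmetric] by auto
  obtain q :: "'k \<times> 'k \<Rightarrow> 'k" where q: "inj q"
    using k2 unfolding card_of_ordLeq[symmetric] by auto
  \<comment> \<open>The injection \<open>e\<close> cuts \<open>j\<close> into three tables: rows
    with tag 0 are the points of the sequence, rows with tag 1 the listed traces, and rows with tag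
    2 the values belonging to these traces. A point is a subset of \<open>'k\<close>, and a trace is
    the set of numbers of those points that lie in \<open>t\<close>.\<close>
  define f where "f t j = (let k = SOME k. {i. {x. e (i, 0, x) \<in> j} \<in> t} = {x. e (k, 1, x) \<in> j}
    in THE x. e (k, 2, x) \<in> j)" for t and j :: "'k set"
  have "\<exists>j\<in>UNIV. \<forall>t\<in>A. f t j = p t" if A: "|A| \<le>o |UNIV :: 'k set|" for A p
  proof (cases "A = {}")
    case False
    obtain a :: "'k \<Rightarrow> 'k set set" where a: "a ` UNIV = A"
      using iffD2[OF card_of_ordLeq2[OF False] A] by (elim exE) (rule that)
    \<comment> \<open>The point numbered \<open>q (k, l)\<close> separates \<open>a k\<close> from
      \<open>a l\<close> if they differ; otherwise it is arbitrary.\<close>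
    define s where "s i = (SOME x. \<forall>k l. i = q (k, l) \<longrightarrow> a k \<noteq> a l \<longrightarrow> (x \<in> a k) \<noteq> (x \<in> a l))" for i
    have s: "(s (q (k, l)) \<in> a k) \<noteq> (s (q (k, l)) \<in> a l)" if kl: "a k \<noteq> a l" for k l
    proof -
      obtain x where "(x \<in> a k) \<noteq> (x \<in> a l)" using kl by blast
      then have "\<forall>k' l'. q (k, l) = q (k', l') \<longrightarrow> a k' \<noteq> a l' \<longrightarrow> (x \<in> a k') \<noteq> (x \<in> a l')"
        by (auto dest!: injD[OF q])
      from someI[of "\<lambda>x. \<forall>k' l'. q (k, l) = q (k', l') \<longrightarrow> a k' \<noteq> a l' \<longrightarrow> (x \<in> a k') \<noteq> (x \<in> a l')", OF this]
      show ?thesis using kl unfolding s_def[symmetric] by blast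
    qed
    define j where "j = {e (i, 0, x) | i x. x \<in> s i} \<union> {e (k, 1, i) | k i. s i \<in> a k} \<union>
      {e (k, 2, p (a k)) | k. True}"
    have j0: "{x. e (i, 0, x) \<in> j} = s i" for i
      unfolding j_def by (auto dest!: injD[OF e])
    have j1: "{x. e (k, 1, x) \<in> j} = {i. s i \<in> a k}" for k
      unfolding j_def by (auto dest!: injD[OF e])
    have j2: "(THE x. e (k, 2, x) \<in> j) = p (a k)" for k
      unfolding j_def by (rule the_equality) (auto dest!: injD[OF e])
    have "f (a k) j = p (a k)" for k
    proof -
      \<comment> \<open>The row found need not be row \<open>k\<close>, but it has the same trace,
        hence belongs to the same set and carries the same value.\<close>
      let ?k = "SOME k'. {i. s i \<in> a k} = {i. s i \<in> a k'}"
      have "{i. s i \<in> a k} = {i. s i \<in> a ?k}" by (rule someI[of _ k]) simp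
      then have "a k = a ?k" using s[of k ?k] by blast
      then show ?thesis unfolding f_def j0 j1 j2 Let_def by simp
    qed
    then show ?thesis using a by auto
  qed auto
  then have "indep f {} UNIV" unfolding indep_def by blast
  then show ?thesis by (rule exI[of _ f])
qed

text \<open>
  If no small \<open>Z\<close> worked, one could choose counterexamples \<open>(s\<^sub>k, A\<^sub>k, p\<^sub>k)\<close> for \<open>k :: 'k\<close>
  with pairwise disjoint supports. All of them together with the equations \<open>f s\<^sub>k j = k\<close> have a common
  solution \<open>j \<in> E\<close>, which contradicts the choice of the counterexample for \<open>k = g j\<close>.
\<close>

lemma indep_graph:
  fixes f :: "'t \<Rightarrow> 'j \<Rightarrow> 'k"
  assumes inf: "infinite (UNIV :: 'k set)" and E: "indep f S E"
  obtains Z where "|Z| \<le>o |UNIV :: 'k set|"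
    and "\<And>s. s \<notin> S \<union> Z \<Longrightarrow> indep f (insert s (S \<union> Z)) {j \<in> E. f s j = g j}"
proof -
  let ?small = "\<lambda>A. |A :: 't set| \<le>o |UNIV :: 'k set|"
  \<comment> \<open>Neither \<open>S\<close> nor \<open>Z\<close> occurs here: disjointness from
    them is asked of the support separately, so that one predicate serves all stages of the
    recursion.\<close>
  define bad where "bad c \<longleftrightarrow> (case c of (s, A, p) \<Rightarrow> ?small A \<and> s \<notin> A \<and>
    (\<forall>j\<in>E. (\<forall>t\<in>A. f t j = p t) \<longrightarrow> f s j \<noteq> g j))" for c :: "'t \<times> 't set \<times> ('t \<Rightarrow> 'k)"
  define supp where "supp c = (case c of (s, A, p) \<Rightarrow> insert s A)" for c :: "'t \<times> 't set \<times> ('t \<Rightarrow> 'k)"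
  have small_supp: "?small (supp c)" if "bad c" for c
  proof -
    have "|UNIV :: 'k set| \<le>o |UNIV :: 'k set|" by (simp add: card_of_refl ordIso_imp_ordLeq)
    moreover obtain s A p where c: "c = (s, A, p)" by (cases c)
    moreover have "|{s}| \<le>o |UNIV :: 'k set|" by (intro card_of_singl_ordLeq) auto
    ultimately have "|{s} <+> A| \<le>o |UNIV :: 'k set|"
      using that inf by (intro card_of_Plus_ordLeq_infinite) (auto simp: bad_def)
    from ordLeq_transitive[OF card_of_Un_Plus_ordLeq this] show ?thesis by (simp add: c supp_def)
  qed
  have "\<exists>Z. ?small Z \<and> (\<forall>s. s \<notin> S \<union> Z \<longrightarrow> indep f (insert s (S \<union> Z)) {j \<in> E. f s j = g j})"
  proof (rule ccontr)
    assume neg: "\<not> ?thesis"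
    have bad_ex: "\<exists>c. bad c \<and> supp c \<inter> (S \<union> Z) = {}" if Z: "?small Z" for Z
    proof -
      obtain s where s: "s \<notin> S \<union> Z" and "\<not> indep f (insert s (S \<union> Z)) {j \<in> E. f s j = g j}"
        using neg Z by blast
      from this(2) obtain A p where Ap: "?small A" "A \<inter> insert s (S \<union> Z) = {}"
        "\<not> (\<exists>j\<in>{j \<in> E. f s j = g j}. \<forall>t\<in>A. f t j = p t)"
        unfolding indep_def not_all not_imp by (elim exE conjE) (rule that)
      have "bad (s, A, p)" using Ap by (auto simp: bad_def)
      moreover have "supp (s, A, p) \<inter> (S \<union> Z) = {}" using Ap(2) s by (auto simp: supp_def)
      ultimately have "bad (s, A, p) \<and> supp (s, A, p) \<inter> (S \<union> Z) = {}" ..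
      then show ?thesis ..
    qed
    let ?r = "|UNIV :: 'k set|"
    let ?P = "\<lambda>F k c. bad c \<and> supp c \<inter> (S \<union> (\<Union>l\<in>underS ?r k. supp (F l))) = {}"
    have "\<exists>F. \<forall>k. ?P F k (F k)"
    proof (rule dependent_wf_choice[OF card_of_UNIV_wf])
      fix F G :: "'k \<Rightarrow> 't \<times> 't set \<times> ('t \<Rightarrow> 'k)" and k c
      assume "\<And>l. (l, k) \<in> ?r - Id \<Longrightarrow> F l = G l"
      then have "(\<Union>l\<in>underS ?r k. supp (F l)) = (\<Union>l\<in>underS ?r k. supp (G l))"
        by (intro SUP_cong) (auto simp: underS_def)
      then show "?P F k c = ?P G k c" by simp
    next
      fix k and F :: "'k \<Rightarrow> 't \<times> 't set \<times> ('t \<Rightarrow> 'k)"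
      assume "\<And>l. (l, k) \<in> ?r - Id \<Longrightarrow> ?P F l (F l)"
      then have "bad (F l)" if "l \<in> underS ?r k" for l using that by (auto simp: underS_def)
      then have "?small (\<Union>l\<in>underS ?r k. supp (F l))"
        using inf by (intro card_of_UNION_ordLeq_infinite) (auto intro!: card_of_mono1 small_supp)
      from bad_ex[OF this] show "\<exists>c. ?P F k c" .
    qed
    then obtain F where F: "\<And>k. bad (F k)" "\<And>k. supp (F k) \<inter> S = {}"
      and F': "\<And>k l. l \<in> underS ?r k \<Longrightarrow> supp (F k) \<inter> supp (F l) = {}" by blast
    have disj: "k = l" if "t \<in> supp (F k)" "t \<in> supp (F l)" for k l t
      using that card_of_UNIV_underS_total[of k l] F'[of k l] F'[of l k] by blast
    define s A p where "s k = fst (F k)" and "A k = fst (snd (F k))" and "p k = snd (snd (F k))" for k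
    have Fk: "F k = (s k, A k, p k)" for k by (simp add: s_def A_def p_def)
    have sk: "s k \<in> supp (F k)" and Ak: "A k \<subseteq> supp (F k)" for k by (auto simp: Fk supp_def)
    have sA: "s k \<notin> A k" for k using F(1)[of k] by (simp add: Fk bad_def)
    \<comment> \<open>All counterexamples merged into one prescription: value \<open>k\<close> at
      \<open>s k\<close>, and \<open>p k\<close> on \<open>A k\<close>. Disjoint supports make
      \<open>k\<close> unique for a given point, and \<open>sA\<close> keeps the two clauses
      apart.\<close>
    define p' where "p' t = (let k = THE k. t \<in> supp (F k) in if t = s k then k else p k t)" for t
    have the: "(THE k. t \<in> supp (F k)) = k" if "t \<in> supp (F k)" for t k
      using that disj by blast
    have p's: "p' (s k) = k" for k unfolding p'_def the[OF sk] by simp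
    have p'A: "p' t = p k t" if "t \<in> A k" for k t
      using that sA[of k] the[OF subsetD[OF Ak that]] by (auto simp: p'_def)
    have "?small (\<Union>k. supp (F k))"
      using inf by (intro card_of_UNION_ordLeq_infinite) (auto simp: card_of_refl ordIso_imp_ordLeq small_supp F)
    moreover have "(\<Union>k. supp (F k)) \<inter> S = {}" using F(2) by blast
    ultimately obtain j where j: "j \<in> E" "\<forall>t\<in>(\<Union>k. supp (F k)). f t j = p' t"
      using E unfolding indep_def by blast
    let ?k = "g j"
    have "f (s ?k) j = p' (s ?k)" using j(2) sk by blast
    then have "f (s ?k) j = g j" unfolding p's .
    moreover have "\<forall>t\<in>A ?k. f t j = p ?k t"
    proof
      fix t assume t: "t \<in> A ?k"
      then have "f t j = p' t" using j(2) Ak by blast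
      then show "f t j = p ?k t" using p'A[OF t] by simp
    qed
    ultimately show False using F(1)[of ?k] j(1) by (simp add: Fk bad_def)
  qed
  then show ?thesis using that by blast
qed

section \<open>The Keisler-Shelah theorem\<close>

fun rename_tm :: "(nat \<Rightarrow> nat) \<Rightarrow> 'f tm \<Rightarrow> 'f tm" where
  "rename_tm \<rho> (Var x) = Var (\<rho> x)"
| "rename_tm \<rho> (App f ts) = App f (map (rename_tm \<rho>) ts)"

text \<open>Bound variables receive a name outside the image of the free variables of the body,
  which prevents capture. The renaming \<rho> need not be injective; this matters because the list
  of a condition may contain repetitions.\<close>

fun rename_fm :: "(nat \<Rightarrow> nat) \<Rightarrow> ('f, 'p) fm \<Rightarrow> ('f, 'p) fm" where
  "rename_fm \<rho> Top = Top"
| "rename_fm \<rho> Bot = Bot"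
| "rename_fm \<rho> (Eq s t) = Eq (rename_tm \<rho> s) (rename_tm \<rho> t)"
| "rename_fm \<rho> (Rel r ts) = Rel r (map (rename_tm \<rho>) ts)"
| "rename_fm \<rho> (Neg \<phi>) = Neg (rename_fm \<rho> \<phi>)"
| "rename_fm \<rho> (Conj \<phi> \<psi>) = Conj (rename_fm \<rho> \<phi>) (rename_fm \<rho> \<psi>)"
| "rename_fm \<rho> (Disj \<phi> \<psi>) = Disj (rename_fm \<rho> \<phi>) (rename_fm \<rho> \<psi>)"
| "rename_fm \<rho> (Imp \<phi> \<psi>) = Imp (rename_fm \<rho> \<phi>) (rename_fm \<rho> \<psi>)"
| "rename_fm \<rho> (Ex x \<phi>) =
     (let y = SOME y. y \<notin> \<rho> ` free_vars \<phi> in Ex y (rename_fm (\<rho>(x := y)) \<phi>))"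
| "rename_fm \<rho> (All x \<phi>) =
     (let y = SOME y. y \<notin> \<rho> ` free_vars \<phi> in All y (rename_fm (\<rho>(x := y)) \<phi>))"

lemma fresh_renaming: "(SOME y. y \<notin> \<rho> ` free_vars \<phi>) \<notin> (\<rho> ` free_vars \<phi> :: nat set)"
proof -
  have "\<exists>y. y \<notin> \<rho> ` free_vars \<phi>"
    using finite_free_vars[of \<phi>] by (intro ex_new_if_finite) auto
  then show ?thesis by (rule someI_ex)
qed

lemma tm_val_rename: "tm_val M e (rename_tm \<rho> t) = tm_val M (\<lambda>n. e (\<rho> n)) t"
  by (induction t) (simp_all add: o_def cong: map_cong)

lemma is_tm_rename: "is_tm L (rename_tm \<rho> t) \<longleftrightarrow> is_tm L t"
  by (induction t) auto

lemma tm_vars_rename: "tm_vars (rename_tm \<rho> t) = \<rho> ` tm_vars t"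
  by (induction t) auto

lemma sat_rename: "sat M e (rename_fm \<rho> \<phi>) \<longleftrightarrow> sat M (\<lambda>n. e (\<rho> n)) \<phi>"
proof (induction \<phi> arbitrary: e \<rho>)
  case (Eq s t) then show ?case by (simp add: tm_val_rename)
next
  case (Rel r ts) then show ?case by (simp add: tm_val_rename o_def)
next
  case (Ex x \<phi>)
  let ?y = "SOME y. y \<notin> \<rho> ` free_vars \<phi>"
  have "sat M (\<lambda>n. (e(?y := a)) ((\<rho>(x := ?y)) n)) \<phi> \<longleftrightarrow> sat M ((\<lambda>n. e (\<rho> n))(x := a)) \<phi>" for a
  proof (rule sat_cong)
    fix n assume "n \<in> free_vars \<phi>"
    then have "\<rho> n \<noteq> ?y" using fresh_renaming[of \<rho> \<phi>] by (metis image_eqI)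
    then show "(e(?y := a)) ((\<rho>(x := ?y)) n) = ((\<lambda>n. e (\<rho> n))(x := a)) n" by simp
  qed
  then show ?case by (simp only: rename_fm.simps Let_def sat.simps Ex.IH)
next
  case (All x \<phi>)
  let ?y = "SOME y. y \<notin> \<rho> ` free_vars \<phi>"
  have "sat M (\<lambda>n. (e(?y := a)) ((\<rho>(x := ?y)) n)) \<phi> \<longleftrightarrow> sat M ((\<lambda>n. e (\<rho> n))(x := a)) \<phi>" for a
  proof (rule sat_cong)
    fix n assume "n \<in> free_vars \<phi>"
    then have "\<rho> n \<noteq> ?y" using fresh_renaming[of \<rho> \<phi>] by (metis image_eqI)
    then show "(e(?y := a)) ((\<rho>(x := ?y)) n) = ((\<lambda>n. e (\<rho> n))(x := a)) n" by simp
  qed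
  then show ?case by (simp only: rename_fm.simps Let_def sat.simps All.IH)
qed simp_all

lemma is_fm_rename: "is_fm L (rename_fm \<rho> \<phi>) \<longleftrightarrow> is_fm L \<phi>"
  by (induction \<phi> arbitrary: \<rho>) (simp_all add: is_tm_rename Let_def)

lemma free_vars_rename: "free_vars (rename_fm \<rho> \<phi>) \<subseteq> \<rho> ` free_vars \<phi>"
proof (induction \<phi> arbitrary: \<rho>)
  case (Ex x \<phi>)
  let ?y = "SOME y. y \<notin> \<rho> ` free_vars \<phi>"
  have "(\<rho>(x := ?y)) ` free_vars \<phi> \<subseteq> insert ?y (\<rho> ` (free_vars \<phi> - {x}))" by auto
  from subset_trans[OF Ex.IH[of "\<rho>(x := ?y)"] this] show ?case
    unfolding rename_fm.simps Let_def free_vars.simps by blast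
next
  case (All x \<phi>)
  let ?y = "SOME y. y \<notin> \<rho> ` free_vars \<phi>"
  have "(\<rho>(x := ?y)) ` free_vars \<phi> \<subseteq> insert ?y (\<rho> ` (free_vars \<phi> - {x}))" by auto
  from subset_trans[OF All.IH[of "\<rho>(x := ?y)"] this] show ?case
    unfolding rename_fm.simps Let_def free_vars.simps by blast
next
  case (Conj \<phi> \<psi>) then show ?case by (simp add: image_Un) blast
next
  case (Disj \<phi> \<psi>) then show ?case by (simp add: image_Un) blast
next
  case (Imp \<phi> \<psi>) then show ?case by (simp add: image_Un) blast
qed (auto simp: tm_vars_rename)

definition conjs :: "('f, 'p) fm list \<Rightarrow> ('f, 'p) fm" where
  "conjs \<phi>s = foldr Conj \<phi>s Top"

lemma sat_conjs: "sat M e (conjs \<phi>s) \<longleftrightarrow> (\<forall>\<phi>\<in>set \<phi>s. sat M e \<phi>)"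
  by (induction \<phi>s) (simp_all add: conjs_def)

lemma is_fm_conjs: "is_fm L (conjs \<phi>s) \<longleftrightarrow> (\<forall>\<phi>\<in>set \<phi>s. is_fm L \<phi>)"
  by (induction \<phi>s) (simp_all add: conjs_def)

lemma free_vars_conjs: "free_vars (conjs \<phi>s) = (\<Union>\<phi>\<in>set \<phi>s. free_vars \<phi>)"
  by (induction \<phi>s) (simp_all add: conjs_def)

text \<open>
  A condition \<open>(\<phi>, l)\<close> is a formula with its \<open>n\<close>-th variable replaced by the \<open>n\<close>-th entry of the list \<open>l\<close>
  of variables taken from an arbitrary type \<open>'t\<close>. (Entries beyond the end of \<open>l\<close> are junk, but no
  such variable occurs free in \<open>\<phi>\<close>.)
\<close>

definition conditions :: "('f, 'p) fo_signature \<Rightarrow> 't set \<Rightarrow> (('f, 'p) fm \<times> 't list) set" where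
  "conditions L V = {(\<phi>, l). is_fm L \<phi> \<and> free_vars \<phi> \<subseteq> {..<length l} \<and> set l \<subseteq> V}"

definition agree :: "('f, 'p, 'a) fo_structure \<Rightarrow> ('f, 'p, 'b) fo_structure \<Rightarrow>
    (('f, 'p) fm \<times> 't list) set \<Rightarrow> ('t \<Rightarrow> 'a) \<Rightarrow> ('t \<Rightarrow> 'b) \<Rightarrow> bool" where
  "agree M N C \<alpha> \<beta> \<longleftrightarrow>
     (\<forall>(\<phi>, l)\<in>C. sat M (\<lambda>n. \<alpha> (l ! n)) \<phi> \<longleftrightarrow> sat N (\<lambda>n. \<beta> (l ! n)) \<phi>)"

lemma agree_sym: "agree M N C \<alpha> \<beta> \<longleftrightarrow> agree N M C \<beta> \<alpha>"
  unfolding agree_def by (intro ball_cong) auto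

lemma agree_cong:
  assumes "C \<subseteq> conditions L V" "\<And>s. s \<in> V \<Longrightarrow> \<alpha> s = \<alpha>' s" "\<And>s. s \<in> V \<Longrightarrow> \<beta> s = \<beta>' s"
  shows "agree M N C \<alpha> \<beta> \<longleftrightarrow> agree M N C \<alpha>' \<beta>'"
proof -
  have "sat M (\<lambda>n. \<alpha> (l ! n)) \<phi> \<longleftrightarrow> sat M (\<lambda>n. \<alpha>' (l ! n)) \<phi>"
    "sat N (\<lambda>n. \<beta> (l ! n)) \<phi> \<longleftrightarrow> sat N (\<lambda>n. \<beta>' (l ! n)) \<phi>" if "(\<phi>, l) \<in> C" for \<phi> l
  proof -
    have *: "l ! n \<in> V" if "n \<in> free_vars \<phi>" for n
      using that assms(1) \<open>(\<phi>, l) \<in> C\<close> by (fastforce simp: conditions_def)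
    show "sat M (\<lambda>n. \<alpha> (l ! n)) \<phi> \<longleftrightarrow> sat M (\<lambda>n. \<alpha>' (l ! n)) \<phi>"
      by (rule sat_cong) (simp add: * assms)
    show "sat N (\<lambda>n. \<beta> (l ! n)) \<phi> \<longleftrightarrow> sat N (\<lambda>n. \<beta>' (l ! n)) \<phi>"
      by (rule sat_cong) (simp add: * assms)
  qed
  then show ?thesis unfolding agree_def by (intro ball_cong) auto
qed

text \<open>
  \<open>C'\<close> consists of the existential formulas describing which subsets of \<open>C\<close> are realized by a value of
  the variable \<open>t\<close>.
\<close>

lemma agree_extend:
  fixes M :: "('f, 'p, 'a) fo_structure" and N :: "('f, 'p, 'b) fo_structure"
    and C :: "(('f, 'p) fm \<times> 't list) set"
  assumes C: "finite C" "C \<subseteq> conditions L (insert t V)"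
 obtains C' where "finite C'" "C' \<subseteq> conditions L (V - {t})"
    and "\<And>\<alpha> \<beta> x. agree M N C' \<alpha> \<beta> \<Longrightarrow> x \<in> Dom M \<Longrightarrow>
           \<exists>y\<in>Dom N. agree M N C (\<alpha>(t := x)) (\<beta>(t := y))"
proof -
  define W where "W = (\<Union>c\<in>C. set (snd c)) - {t}"
  have "finite W" unfolding W_def using C(1) by simp
  from finite_distinct_list[OF this] obtain v where v: "set v = W" by (elim exE conjE) (rule that)
  have WV: "W \<subseteq> V - {t}"
  proof
    fix s assume "s \<in> W"
    then obtain c where "c \<in> C" "s \<in> set (snd c)" "s \<noteq> t" unfolding W_def by blast
    moreover from this C(2) have "c \<in> conditions L (insert t V)" by blast
    ultimately show "s \<in> V - {t}" by (auto simp: conditions_def)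
  qed
  define k where "k = length v"
  \<comment> \<open>Slot \<open>k\<close> lies one past the end of \<open>v\<close> and is reserved
    for \<open>t\<close>; it becomes the variable bound in \<open>\<psi> P\<close>.\<close>
  define pos where "pos s = (if s = t then k else (SOME i. i < k \<and> v ! i = s))" for s
  have pos: "pos s < k \<and> v ! pos s = s" if "s \<in> W" for s
  proof -
    have "\<exists>i. i < k \<and> v ! i = s" using that v by (metis in_set_conv_nth k_def)
    then show ?thesis using that someI_ex[of "\<lambda>i. i < k \<and> v ! i = s"] by (auto simp: pos_def W_def)
  qed
  have pos_le: "pos s \<le> k" if "s \<in> insert t W" for s
  proof (cases "s = t")
    case True then show ?thesis by (simp add: pos_def)
  next
    case False then show ?thesis using that pos[of s] by simp
  qed
  define ren where "ren c = (case c of (\<phi>, l) \<Rightarrow> rename_fm (\<lambda>n. pos (l ! n)) \<phi>)"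
    for c :: "('f, 'p) fm \<times> 't list"
  have lW: "set l \<subseteq> insert t W" if "(\<phi>, l) \<in> C" for \<phi> l
    using that unfolding W_def by force
  have ren_sat: "sat R ((\<lambda>n. \<gamma> (v ! n))(k := x)) (ren (\<phi>, l)) \<longleftrightarrow> sat R (\<lambda>n. (\<gamma>(t := x)) (l ! n)) \<phi>"
    if c: "(\<phi>, l) \<in> C" for R :: "('f, 'p, 'c) fo_structure" and \<gamma> x \<phi> l
    unfolding ren_def prod.case sat_rename
  proof (rule sat_cong)
    fix n assume "n \<in> free_vars \<phi>"
    then have "n < length l" using subsetD[OF C(2) c] by (auto simp: conditions_def)
    then have "l ! n \<in> insert t W" using subsetD[OF lW[OF c] nth_mem] by blast
    then show "((\<lambda>n. \<gamma> (v ! n))(k := x)) (pos (l ! n)) = (\<gamma>(t := x)) (l ! n)"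
    proof (cases "l ! n = t")
      case True then show ?thesis by (simp add: pos_def)
    next
      case False then show ?thesis using \<open>l ! n \<in> insert t W\<close> pos[of "l ! n"] by auto
    qed
  qed
  have ren_fm: "is_fm L (ren c)" "free_vars (ren c) \<subseteq> {..k}" if "c \<in> C" for c
  proof -
    obtain \<phi> l where c: "c = (\<phi>, l)" by (cases c)
    with that C(2) have cl: "is_fm L \<phi>" "free_vars \<phi> \<subseteq> {..<length l}" by (auto simp: conditions_def)
    then show "is_fm L (ren c)" by (simp add: c ren_def is_fm_rename)
    have "pos (l ! n) \<le> k" if "n \<in> free_vars \<phi>" for n
    proof -
      have "n < length l" using that cl(2) by blast
      then show ?thesis using subsetD[OF lW nth_mem] \<open>c \<in> C\<close> unfolding c by (intro pos_le) blast
    qed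
    then show "free_vars (ren c) \<subseteq> {..k}"
      using free_vars_rename[of "\<lambda>n. pos (l ! n)" \<phi>] unfolding c ren_def by auto
  qed
  obtain cs where cs: "set cs = C" using finite_list[OF C(1)] by blast
  \<comment> \<open>Some value of \<open>t\<close> makes the conditions in \<open>P\<close> true and
    the other conditions in \<open>C\<close> false. A value \<open>y\<close> realizing the pattern
    of \<open>x\<close> therefore agrees with \<open>x\<close> on all of \<open>C\<close>.\<close>
  define \<psi> where "\<psi> P = Ex k (conjs (map (\<lambda>c. if c \<in> P then ren c else Neg (ren c)) cs))" for P
  have \<psi>: "is_fm L (\<psi> P)" "free_vars (\<psi> P) \<subseteq> {..<k}" for P
    using ren_fm by (fastforce simp: \<psi>_def is_fm_conjs free_vars_conjs cs)+
  \<comment> \<open>This set depends on neither \<alpha>, \<beta> nor \<open>x\<close>, so it can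
    later be used for all indices \<open>j\<close> simultaneously.\<close>
  let ?C' = "(\<lambda>P. (\<psi> P, v)) ` Pow C"
  show ?thesis
  proof (rule that[of ?C'])
    show "finite ?C'" using C(1) by simp
    show "?C' \<subseteq> conditions L (V - {t})"
      using \<psi> v WV by (auto simp: conditions_def k_def)
    fix \<alpha> \<beta> x assume ag: "agree M N ?C' \<alpha> \<beta>" and x: "x \<in> Dom M"
    define P where "P = {c \<in> C. sat M ((\<lambda>n. \<alpha> (v ! n))(k := x)) (ren c)}"
    have "sat M (\<lambda>n. \<alpha> (v ! n)) (\<psi> P)"
      unfolding \<psi>_def sat.simps sat_conjs using x by (intro bexI[of _ x]) (auto simp: P_def cs)
    moreover have "P \<in> Pow C" by (auto simp: P_def)
    ultimately have "sat N (\<lambda>n. \<beta> (v ! n)) (\<psi> P)" using ag by (auto simp: agree_def)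
    then obtain y where y: "y \<in> Dom N"
      and *: "\<And>c. c \<in> C \<Longrightarrow> sat N ((\<lambda>n. \<beta> (v ! n))(k := y)) (if c \<in> P then ren c else Neg (ren c))"
      unfolding \<psi>_def sat.simps sat_conjs by (auto simp: cs)
    have **: "sat M ((\<lambda>n. \<alpha> (v ! n))(k := x)) (ren c) \<longleftrightarrow> sat N ((\<lambda>n. \<beta> (v ! n))(k := y)) (ren c)"
      if "c \<in> C" for c
      using *[OF that] that by (cases "c \<in> P") (auto simp: P_def)
    have "agree M N C (\<alpha>(t := x)) (\<beta>(t := y))"
      unfolding agree_def
    proof clarify
      fix \<phi> l assume c: "(\<phi>, l) \<in> C"
      show "sat M (\<lambda>n. (\<alpha>(t := x)) (l ! n)) \<phi> \<longleftrightarrow> sat N (\<lambda>n. (\<beta>(t := y)) (l ! n)) \<phi>"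
        using **[OF c] unfolding ren_sat[OF c] .
    qed
    then show "\<exists>y\<in>Dom N. agree M N C (\<alpha>(t := x)) (\<beta>(t := y))" using y by blast
  qed
qed

text \<open>The induction hypothesis of the back-and-forth: \<open>V\<close> is the set of stages
  already matched and \<open>S\<close> the set of members of the family spent on them. Independence,
  rather than mere nonemptiness of the agreement sets, is what allows a further stage.\<close>

definition consistent :: "('f, 'p) fo_signature \<Rightarrow> ('f, 'p, 'a) fo_structure \<Rightarrow> ('f, 'p, 'b) fo_structure \<Rightarrow>
    ('t \<Rightarrow> 'j \<Rightarrow> 'k) \<Rightarrow> 't set \<Rightarrow> 't set \<Rightarrow> ('t \<Rightarrow> 'j \<Rightarrow> 'a) \<Rightarrow> ('t \<Rightarrow> 'j \<Rightarrow> 'b) \<Rightarrow> bool" where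
  "consistent L M N f V S a b \<longleftrightarrow> (\<forall>C. finite C \<longrightarrow> C \<subseteq> conditions L V \<longrightarrow>
     indep f S {j. agree M N C (\<lambda>s. a s j) (\<lambda>s. b s j)})"

lemma consistent_sym: "consistent L M N f V S a b \<Longrightarrow> consistent L N M f V S b a"
  unfolding consistent_def
proof (intro allI impI)
  fix C assume *: "\<forall>C. finite C \<longrightarrow> C \<subseteq> conditions L V \<longrightarrow> indep f S {j. agree M N C (\<lambda>s. a s j) (\<lambda>s. b s j)}"
    and C: "finite C" "C \<subseteq> conditions L V"
  have "{j. agree M N C (\<lambda>s. a s j) (\<lambda>s. b s j)} = {j. agree N M C (\<lambda>s. b s j) (\<lambda>s. a s j)}"
    by (intro Collect_cong agree_sym)
  from *[rule_format, OF C, unfolded this] show "indep f S {j. agree N M C (\<lambda>s. b s j) (\<lambda>s. a s j)}" .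
qed

lemma consistent_cong:
  assumes con: "consistent L M N f V S a b"
    and ab: "\<And>s. s \<in> V \<Longrightarrow> a s = a' s" "\<And>s. s \<in> V \<Longrightarrow> b s = b' s"
  shows "consistent L M N f V S a' b'"
  unfolding consistent_def
proof (intro allI impI)
  fix C assume C: "finite C" "C \<subseteq> conditions L V"
  have eq: "{j. agree M N C (\<lambda>s. a s j) (\<lambda>s. b s j)} = {j. agree M N C (\<lambda>s. a' s j) (\<lambda>s. b' s j)}"
    by (intro Collect_cong agree_cong[OF C(2)]) (simp_all add: ab)
  have "indep f S {j. agree M N C (\<lambda>s. a s j) (\<lambda>s. b s j)}"
    using con C unfolding consistent_def by blast
  then show "indep f S {j. agree M N C (\<lambda>s. a' s j) (\<lambda>s. b' s j)}" unfolding eq .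
qed

lemma card_of_conditions:
  fixes B :: "'c set"
  assumes B: "infinite B" and "|UNIV :: ('f, 'p) fm set| \<le>o |B|" "|V| \<le>o |B|"
  shows "|conditions (L :: ('f, 'p) fo_signature) V| \<le>o |B|"
proof -
  have "|(UNIV :: ('f, 'p) fm set) \<times> lists V| \<le>o |B|"
    using assms card_of_lists_ordLeq_infinite[OF B assms(3)]
    by (intro card_of_Sigma_ordLeq_infinite) auto
  moreover have "conditions L V \<subseteq> UNIV \<times> lists V" by (auto simp: conditions_def)
  ultimately show ?thesis using card_of_mono1 ordLeq_transitive by blast
qed

lemma card_of_Un_ordLeq_infinite:
  assumes "infinite C" "|A| \<le>o |C|" "|B| \<le>o |C|"
  shows "|A \<union> B| \<le>o |C|"
  using ordLeq_transitive[OF card_of_Un_Plus_ordLeq card_of_Plus_ordLeq_infinite[OF assms]] .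

lemma card_of_insert_ordLeq_infinite:
  assumes "infinite C" "|A| \<le>o |C|"
  shows "|insert x A| \<le>o |C|"
proof -
  have "|{x}| \<le>o |C|" using assms(1) by (intro card_of_singl_ordLeq) auto
  from card_of_Un_ordLeq_infinite[OF assms(1) this assms(2)] show ?thesis by simp
qed

text \<open>
  For every finite set of conditions on the new pair \<open>(x, y)\<close> there is a partial Skolem function \<open>g\<close>
  giving the right values of \<open>y\<close>; by \<open>indep_graph\<close>, all but few members of the family \<open>f\<close> agree with
  \<open>g\<close> sufficiently often. One member \<open>f s\<close> serves all these \<open>g\<close> at once.
\<close>

lemma consistent_extend:
  fixes M :: "('f, 'p, 'a) fo_structure" and N :: "('f, 'p, 'b) fo_structure"
    and f :: "'t \<Rightarrow> 'j \<Rightarrow> 'k" and B :: "'c set" and d :: "'k \<Rightarrow> 'b"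
  assumes inf: "infinite (UNIV :: 'k set)"
    and con: "consistent L M N f V S a b" and t: "t \<notin> V"
    and x: "\<And>j. x j \<in> Dom M" and d: "range d = Dom N"
    and B: "infinite B" "|B| <o |UNIV :: 't set|" "|UNIV :: 'k set| \<le>o |B|"
      "|UNIV :: ('f, 'p) fm set| \<le>o |B|" "|V| \<le>o |B|" "|S| \<le>o |B|"
  shows "\<exists>y R. (\<forall>j. y j \<in> Dom N) \<and> |R| \<le>o |B| \<and>
    consistent L M N f (insert t V) (S \<union> R) (a(t := x)) (b(t := y))"
proof -
  define CC where "CC = {C. finite C \<and> C \<subseteq> conditions L (insert t V)}"
  define E where "E C y = {j. agree M N C (\<lambda>s. (a(t := x)) s j) (\<lambda>s. (b(t := y)) s j)}" for C y
  have "\<forall>C\<in>CC. \<exists>Z. |Z| \<le>o |UNIV :: 'k set| \<and>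
     (\<forall>s. s \<notin> S \<union> Z \<longrightarrow> indep f (insert s (S \<union> Z)) (E C (\<lambda>j. d (f s j))))"
  proof
    fix C assume "C \<in> CC"
    then have C: "finite C" "C \<subseteq> conditions L (insert t V)" by (auto simp: CC_def)
    obtain C' where C': "finite C'" "C' \<subseteq> conditions L (V - {t})"
      and ext: "\<And>\<alpha> \<beta> x. agree M N C' \<alpha> \<beta> \<Longrightarrow> x \<in> Dom M \<Longrightarrow>
           \<exists>y\<in>Dom N. agree M N C (\<alpha>(t := x)) (\<beta>(t := y))"
      by (rule agree_extend[OF C, of M N]) (rule that)
    define g where "g j = (SOME k. agree M N C ((\<lambda>s. a s j)(t := x j)) ((\<lambda>s. b s j)(t := d k)))" for j
    let ?E' = "{j. agree M N C' (\<lambda>s. a s j) (\<lambda>s. b s j)}"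
    have g: "agree M N C ((\<lambda>s. a s j)(t := x j)) ((\<lambda>s. b s j)(t := d (g j)))" if j: "j \<in> ?E'" for j
    proof -
      obtain y where "y \<in> Dom N" "agree M N C ((\<lambda>s. a s j)(t := x j)) ((\<lambda>s. b s j)(t := y))"
        using ext[of "\<lambda>s. a s j" "\<lambda>s. b s j" "x j"] j x by blast
      then have "\<exists>k. agree M N C ((\<lambda>s. a s j)(t := x j)) ((\<lambda>s. b s j)(t := d k))"
        using d by (metis imageE)
      then show ?thesis unfolding g_def by (rule someI_ex)
    qed
    have "V - {t} = V" using t by simp
    then have "indep f S ?E'" using con C' unfolding consistent_def by simp
    then obtain Z where Z: "|Z| \<le>o |UNIV :: 'k set|"
      "\<And>s. s \<notin> S \<union> Z \<Longrightarrow> indep f (insert s (S \<union> Z)) {j \<in> ?E'. f s j = g j}"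
      by (rule indep_graph[OF inf, where g = g]) (rule that)
    have "{j \<in> ?E'. f s j = g j} \<subseteq> E C (\<lambda>j. d (f s j))" for s
    proof
      fix j assume j: "j \<in> {j \<in> ?E'. f s j = g j}"
      have "(\<lambda>s. (a(t := x)) s j) = (\<lambda>s. a s j)(t := x j)"
        "(\<lambda>s'. (b(t := \<lambda>j. d (f s j))) s' j) = (\<lambda>s. b s j)(t := d (g j))"
        using j by auto
      then show "j \<in> E C (\<lambda>j. d (f s j))" using g[of j] j unfolding E_def by simp
    qed
    then have "\<forall>s. s \<notin> S \<union> Z \<longrightarrow> indep f (insert s (S \<union> Z)) (E C (\<lambda>j. d (f s j)))"
      using indep_mono[OF Z(2) order_refl] by blast
    then show "\<exists>Z. |Z| \<le>o |UNIV :: 'k set| \<and>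
       (\<forall>s. s \<notin> S \<union> Z \<longrightarrow> indep f (insert s (S \<union> Z)) (E C (\<lambda>j. d (f s j))))"
      using Z(1) by blast
  qed
  from bchoice[OF this] obtain Z where Z: "\<And>C. C \<in> CC \<Longrightarrow> |Z C| \<le>o |UNIV :: 'k set|"
    and Zs: "\<And>C s. C \<in> CC \<Longrightarrow> s \<notin> S \<union> Z C \<Longrightarrow> indep f (insert s (S \<union> Z C)) (E C (\<lambda>j. d (f s j)))"
    by blast
  have "|insert t V| \<le>o |B|" by (rule card_of_insert_ordLeq_infinite[OF B(1) B(5)])
  then have "|CC| \<le>o |B|" unfolding CC_def
    by (intro card_of_finite_subsets_ordLeq_infinite[OF B(1)] card_of_conditions[OF B(1) B(4)])
  moreover have "|Z C| \<le>o |B|" if "C \<in> CC" for C using Z[OF that] B(3) ordLeq_transitive by blast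
  ultimately have R0: "|\<Union>C\<in>CC. Z C| \<le>o |B|"
    by (intro card_of_UNION_ordLeq_infinite[OF B(1)]) auto
  \<comment> \<open>There are at most \<open>|B|\<close> finite sets of conditions, and each
    excludes at most \<open>|'k|\<close> members. Together with those spent earlier they do not
    exhaust the family, so one member is good for all \<open>C\<close> in \<open>CC\<close>.\<close>
  have "S \<union> (\<Union>C\<in>CC. Z C) \<noteq> UNIV"
  proof
    assume eq: "S \<union> (\<Union>C\<in>CC. Z C) = UNIV"
    have "|S \<union> (\<Union>C\<in>CC. Z C)| \<le>o |B|" by (rule card_of_Un_ordLeq_infinite[OF B(1) B(6) R0])
    then show False using B(2) not_ordLess_ordLeq unfolding eq by blast
  qed
  then obtain s where s: "s \<notin> S \<union> (\<Union>C\<in>CC. Z C)" by blast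
  define y where "y j = d (f s j)" for j
  define R where "R = insert s (\<Union>C\<in>CC. Z C)"
  have "consistent L M N f (insert t V) (S \<union> R) (a(t := x)) (b(t := y))"
    unfolding consistent_def
  proof (intro allI impI)
    fix C assume "finite C" "C \<subseteq> conditions L (insert t V)"
    then have C: "C \<in> CC" by (simp add: CC_def)
    have "indep f (insert s (S \<union> Z C)) (E C y)" unfolding y_def using Zs[OF C] s C by blast
    then show "indep f (S \<union> R) {j. agree M N C (\<lambda>s. (a(t := x)) s j) (\<lambda>s. (b(t := y)) s j)}"
      by (rule indep_mono) (use C in \<open>auto simp: R_def E_def\<close>)
  qed
  moreover have "|R| \<le>o |B|" unfolding R_def by (rule card_of_insert_ordLeq_infinite[OF B(1) R0])
  moreover have "\<forall>j. y j \<in> Dom N" using d by (auto simp: y_def)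
  ultimately show ?thesis by blast
qed

section \<open>The transfinite back-and-forth\<close>

text \<open>A task names a side of the back-and-forth and a function on the index set, with values
  coded in \<open>'k\<close>. It is read off from a set: elements with tag 0 form the graph of the
  function, and any element with tag 1 sets the flag. Hence there are enough stages for all
  tasks.\<close>

lemma enumerate_tasks:
  assumes inf: "infinite (UNIV :: 'k set)"
  shows "\<exists>task :: 'k set set \<Rightarrow> bool \<times> ('k set \<Rightarrow> 'k). surj task"
proof -
  let ?J = "UNIV :: 'k set set" and ?K = "UNIV :: 'k set"
  have KJ: "|?K| \<le>o |?J|" using card_of_Pow[of ?K] by (simp add: ordLess_imp_ordLeq)
  then have infJ: "infinite ?J" using inf card_of_ordLeq_infinite by blast
  have "|UNIV :: nat set| \<le>o |?K|" using inf infinite_iff_card_of_nat by blast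
  then have "|?K \<times> (UNIV :: nat set)| \<le>o |?K|"
    using inf by (intro card_of_Sigma_ordLeq_infinite) (auto simp: card_of_refl ordIso_imp_ordLeq)
  with KJ have "|?K \<times> (UNIV :: nat set)| \<le>o |?J|" using ordLeq_transitive by blast
  then have "|?J \<times> (?K \<times> (UNIV :: nat set))| \<le>o |?J|"
    using infJ by (intro card_of_Sigma_ordLeq_infinite) (auto simp: card_of_refl ordIso_imp_ordLeq)
  then obtain h :: "'k set \<times> 'k \<times> nat \<Rightarrow> 'k set" where h: "inj h"
    unfolding card_of_ordLeq[symmetric] by auto
  define task where "task t = (\<exists>j k. h (j, k, 1) \<in> t, \<lambda>j. SOME k. h (j, k, 0) \<in> t)" for t
  have "\<exists>t. task t = (c, \<kappa>)" for c \<kappa>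
  proof -
    let ?t = "{h (j, \<kappa> j, 0) | j. True} \<union> {h (j, k, 1) | j k. c}"
    have "h (j, k, 0) \<in> ?t \<longleftrightarrow> k = \<kappa> j" for j k by (auto dest: injD[OF h])
    moreover have "(\<exists>j k. h (j, k, 1) \<in> ?t) \<longleftrightarrow> c" by (auto dest: injD[OF h])
    ultimately have "task ?t = (c, \<kappa>)" unfolding task_def by simp
    then show ?thesis ..
  qed
  then have "surj task" unfolding surj_def by (metis surj_pair)
  then show ?thesis by blast
qed

lemma card_of_UNIV_underS_mono:
  "s \<in> underS |UNIV :: 'a set| t \<Longrightarrow> underS |UNIV :: 'a set| s \<subseteq> underS |UNIV :: 'a set| t"
  by (rule subsetI) (rule card_of_UNIV_underS_trans)

text \<open>Stage \<open>t\<close> puts the function named by its task on one side and finds a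
  partner on the other. As every task occurs, all functions into both domains get matched.\<close>

lemma generic_matching_family:
  fixes M :: "('f, 'p, 'a) fo_structure" and N :: "('f, 'p, 'b) fo_structure"
  assumes inf: "infinite (UNIV :: 'k set)"
    and M: "is_structure L M" "|Dom M| \<le>o |UNIV :: 'k set|"
    and N: "is_structure L N" "|Dom N| \<le>o |UNIV :: 'k set|"
    and fm: "|UNIV :: ('f, 'p) fm set| \<le>o |UNIV :: 'k set|"
    and MN: "elem_equiv L M N"
  obtains a :: "'k set set \<Rightarrow> 'k set \<Rightarrow> 'a" and b :: "'k set set \<Rightarrow> 'k set \<Rightarrow> 'b"
  where "range a = {x. range x \<subseteq> Dom M}" "range b = {y. range y \<subseteq> Dom N}"
    and "\<And>C. finite C \<Longrightarrow> C \<subseteq> conditions L UNIV \<Longrightarrow> \<exists>j. agree M N C (\<lambda>s. a s j) (\<lambda>s. b s j)"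
proof -
  let ?J = "UNIV :: 'k set set" and ?K = "UNIV :: 'k set" and ?T = "UNIV :: 'k set set set"
  let ?r = "|UNIV :: 'k set set set|"
  have KJ: "|?K| \<le>o |?J|" using card_of_Pow[of ?K] by (simp add: ordLess_imp_ordLeq)
  have infJ: "infinite ?J" using inf KJ card_of_ordLeq_infinite by blast
  have JT: "|?J| <o |?T|" using card_of_Pow[of ?J] by simp
  obtain f :: "'k set set \<Rightarrow> 'k set \<Rightarrow> 'k" where f: "indep f {} UNIV"
    using indep_family_exists[OF inf] by blast
  obtain task :: "'k set set \<Rightarrow> bool \<times> ('k set \<Rightarrow> 'k)" where task: "surj task"
    using enumerate_tasks[OF inf] by blast
  have neM: "Dom M \<noteq> {}" and neN: "Dom N \<noteq> {}" using M N by (auto simp: is_structure_def)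
  obtain c :: "'k \<Rightarrow> 'a" where c: "range c = Dom M"
    using iffD2[OF card_of_ordLeq2[OF neM] M(2)] by (elim exE) (rule that)
  obtain d :: "'k \<Rightarrow> 'b" where d: "range d = Dom N"
    using iffD2[OF card_of_ordLeq2[OF neN] N(2)] by (elim exE) (rule that)
  \<comment> \<open>A bound for all sizes arising at stage \<open>t\<close>. It stays below the size
    of the family because proper initial segments of a cardinal are smaller than the
    cardinal.\<close>
  define B where "B t = ?J <+> underS ?r t" for t
  have infB: "infinite (B t)" for t using infJ by (simp add: B_def finite_Plus_iff)
  have JB: "|?J| \<le>o |B t|" for t unfolding B_def by (rule card_of_Plus1)
  have KB: "|?K| \<le>o |B t|" for t by (rule ordLeq_transitive[OF KJ JB])
  have VB: "|underS ?r t| \<le>o |B t|" for t unfolding B_def by (rule card_of_Plus2)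
  have fmB: "|UNIV :: ('f, 'p) fm set| \<le>o |B t|" for t by (rule ordLeq_transitive[OF fm KB])
  have BT: "|B t| <o |?T|" for t
  proof -
    have "|underS ?r t| <o ?r"
      by (rule card_of_underS[OF card_of_Card_order]) (simp only: Field_card_of UNIV_I)
    then show ?thesis unfolding B_def by (rule card_of_Plus_ordLess_infinite[OF infJ JT])
  qed
  have B_mono: "|B s| \<le>o |B t|" if "s \<in> underS ?r t" for s t
  proof -
    have "underS ?r s \<subseteq> underS ?r t" by (rule card_of_UNIV_underS_mono[OF that])
    then show ?thesis unfolding B_def by (intro card_of_Plus_mono2 card_of_mono1)
  qed
  \<comment> \<open>The default value makes these functions depend on \<open>F\<close> only below
    \<open>t\<close>, as recursive choice requires; \<open>consistent_cong\<close> removes it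
    afterwards.\<close>
  let ?a = "\<lambda>F t s. if s \<in> underS ?r t then fst (F s) else (\<lambda>_. c undefined)"
  let ?b = "\<lambda>F t s. if s \<in> underS ?r t then fst (snd (F s)) else (\<lambda>_. d undefined)"
  let ?S = "\<lambda>F t. \<Union>s\<in>underS ?r t. snd (snd (F s))"
  \<comment> \<open>Consistency of the earlier stages as a whole is not yet available during the
    choice of \<open>F\<close>, so its extension is demanded conditionally and the premise is
    discharged later by induction. If the premise fails, any values performing the task will
    do.\<close>
  define P where "P F t w \<longleftrightarrow> (case w of (x, y, R) \<Rightarrow>
     (\<forall>j. x j \<in> Dom M) \<and> (\<forall>j. y j \<in> Dom N) \<and> |R| \<le>o |B t| \<and>
     (if fst (task t) then x = c \<circ> snd (task t) else y = d \<circ> snd (task t)) \<and>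
     (consistent L M N f (underS ?r t) (?S F t) (?a F t) (?b F t) \<longrightarrow>
      consistent L M N f (insert t (underS ?r t)) (?S F t \<union> R) ((?a F t)(t := x)) ((?b F t)(t := y))))"
    for F t w
  have "\<exists>F. \<forall>t. P F t (F t)"
  proof (rule dependent_wf_choice[OF card_of_UNIV_wf])
    fix F G :: "'k set set \<Rightarrow> ('k set \<Rightarrow> 'a) \<times> ('k set \<Rightarrow> 'b) \<times> 'k set set set" and t w
    assume "\<And>s. (s, t) \<in> ?r - Id \<Longrightarrow> F s = G s"
    then have eq: "F s = G s" if "s \<in> underS ?r t" for s using that by (auto simp: underS_def)
    have "?a F t = ?a G t" "?b F t = ?b G t" using eq by (simp_all add: fun_eq_iff)
    moreover have "?S F t = ?S G t" using eq by (intro SUP_cong) simp_all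
    ultimately show "P F t w = P G t w" unfolding P_def by (simp only:)
  next
    fix t and F :: "'k set set \<Rightarrow> ('k set \<Rightarrow> 'a) \<times> ('k set \<Rightarrow> 'b) \<times> 'k set set set"
    assume "\<And>s. (s, t) \<in> ?r - Id \<Longrightarrow> P F s (F s)"
    then have "P F s (F s)" if "s \<in> underS ?r t" for s using that by (auto simp: underS_def)
    then have R: "|snd (snd (F s))| \<le>o |B s|" if "s \<in> underS ?r t" for s
      using that by (fastforce simp: P_def)
    have "|snd (snd (F s))| \<le>o |B t|" if "s \<in> underS ?r t" for s
      by (rule ordLeq_transitive[OF R[OF that] B_mono[OF that]])
    then have SB: "|?S F t| \<le>o |B t|"
      by (intro card_of_UNION_ordLeq_infinite[OF infB VB]) blast
    have t: "t \<notin> underS ?r t" by (simp add: underS_def)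
    have cM: "c k \<in> Dom M" and dN: "d k \<in> Dom N" for k using c d by auto
    show "\<exists>w. P F t w"
    proof (cases "consistent L M N f (underS ?r t) (?S F t) (?a F t) (?b F t)")
      case False
      have "|{}| \<le>o |B t|" by (rule card_of_empty)
      then have "P F t (c \<circ> snd (task t), d \<circ> snd (task t), {})"
        unfolding P_def using False cM dN by simp
      then show ?thesis ..
    next
      case con: True
      show ?thesis
      proof (cases "fst (task t)")
        case True
        let ?x = "c \<circ> snd (task t)"
        obtain y R where "\<forall>j. y j \<in> Dom N" "|R| \<le>o |B t|"
          "consistent L M N f (insert t (underS ?r t)) (?S F t \<union> R) ((?a F t)(t := ?x)) ((?b F t)(t := y))"
          using consistent_extend[OF inf con t _ d infB BT KB fmB VB SB, of ?x] cM by auto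
        then have "P F t (?x, y, R)" unfolding P_def using True cM by simp
        then show ?thesis ..
      next
        case False
        let ?y = "d \<circ> snd (task t)"
        obtain x R where "\<forall>j. x j \<in> Dom M" "|R| \<le>o |B t|"
          "consistent L N M f (insert t (underS ?r t)) (?S F t \<union> R) ((?b F t)(t := ?y)) ((?a F t)(t := x))"
          using consistent_extend[OF inf consistent_sym[OF con] t _ c infB BT KB fmB VB SB, of ?y] dN by auto
        moreover from this(3) have "consistent L M N f (insert t (underS ?r t)) (?S F t \<union> R)
            ((?a F t)(t := x)) ((?b F t)(t := ?y))" by (rule consistent_sym)
        ultimately have "P F t (x, ?y, R)" unfolding P_def using False dN by simp
        then show ?thesis ..
      qed
    qed
  qed
  then obtain F where F: "\<And>t. P F t (F t)" by blast
  define a b R where "a t = fst (F t)" and "b t = fst (snd (F t))" and "R t = snd (snd (F t))" for t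
  let ?S' = "\<lambda>V. \<Union>s\<in>V. R s"
  have Ft: "F t = (a t, b t, R t)" for t by (simp add: a_def b_def R_def)
  have aM: "a t j \<in> Dom M" and bN: "b t j \<in> Dom N" for t j
    using F[of t] unfolding Ft P_def by auto
  have step: "consistent L M N f (insert t (underS ?r t)) (?S' (insert t (underS ?r t))) a b"
    if con: "consistent L M N f (underS ?r t) (?S' (underS ?r t)) a b" for t
  proof -
    have "consistent L M N f (underS ?r t) (?S F t) (?a F t) (?b F t)"
      unfolding R_def[symmetric]
      by (rule consistent_cong[OF con]) (simp_all add: a_def b_def)
    then have *: "consistent L M N f (insert t (underS ?r t)) (?S F t \<union> R t)
        ((?a F t)(t := a t)) ((?b F t)(t := b t))"
      using F[of t] unfolding Ft[of t] P_def by simp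
    have "?S' (insert t (underS ?r t)) = ?S F t \<union> R t" by (auto simp: R_def)
    moreover have "consistent L M N f (insert t (underS ?r t)) (?S F t \<union> R t) a b"
      by (rule consistent_cong[OF *]) (auto simp: a_def b_def)
    ultimately show ?thesis by simp
  qed
  \<comment> \<open>A finite \<open>C\<close> mentions finitely many stages. The latest of them,
    \<open>s\<close>, places \<open>C\<close> over \<open>insert s (underS ?r s)\<close>, where
    \<open>step\<close> applies; passing to \<open>V\<close> merely enlarges the spent set. The same
    statement covers each \<open>underS ?r t\<close> and finally \<open>UNIV\<close>.\<close>
  have limit: "consistent L M N f V (?S' V) a b"
    if V: "\<And>s. s \<in> V \<Longrightarrow> underS ?r s \<subseteq> V"
      and con: "\<And>s. s \<in> V \<Longrightarrow> consistent L M N f (underS ?r s) (?S' (underS ?r s)) a b" for V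
    unfolding consistent_def
  proof (intro allI impI)
    fix C assume C: "finite C" "C \<subseteq> conditions L V"
    let ?E = "{j. agree M N C (\<lambda>s. a s j) (\<lambda>s. b s j)}"
    define U where "U = (\<Union>c\<in>C. set (snd c))"
    have UV: "U \<subseteq> V"
    proof
      fix s assume "s \<in> U"
      then obtain c where "c \<in> C" "s \<in> set (snd c)" unfolding U_def by blast
      moreover from this C(2) have "c \<in> conditions L V" by blast
      ultimately show "s \<in> V" by (auto simp: conditions_def)
    qed
    show "indep f (?S' V) ?E"
    proof (cases "U = {}")
      \<comment> \<open>No stage is mentioned, so \<open>C\<close> consists of sentences. Elementary
        equivalence makes them agree at every index, and the original family supplies
        independence.\<close>
      case True
      have "j \<in> ?E" for j
      proof -
        have "sat M (\<lambda>n. a (l ! n) j) \<phi> \<longleftrightarrow> sat N (\<lambda>n. b (l ! n) j) \<phi>" if c: "(\<phi>, l) \<in> C" for \<phi> l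
        proof -
          have "l = []" using True c unfolding U_def by force
          then have "is_fm L \<phi>" and fv: "free_vars \<phi> = {}"
            using subsetD[OF C(2) c] by (auto simp: conditions_def)
          then have "models M \<phi> \<longleftrightarrow> models N \<phi>" using MN by (simp add: elem_equiv_def)
          moreover have "models M \<phi> \<longleftrightarrow> sat M (\<lambda>n. a (l ! n) j) \<phi>"
            by (rule models_sentence[OF fv]) (use aM in auto)
          moreover have "models N \<phi> \<longleftrightarrow> sat N (\<lambda>n. b (l ! n) j) \<phi>"
            by (rule models_sentence[OF fv]) (use bN in auto)
          ultimately show ?thesis by blast
        qed
        then show ?thesis unfolding agree_def by blast
      qed
      then have "UNIV \<subseteq> ?E" by blast
      then show ?thesis by (rule indep_mono[OF f empty_subsetI])
    next
      case False
      have "finite U" unfolding U_def using C(1) by simp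
      then have "\<exists>s\<in>U. U \<subseteq> insert s (underS ?r s)" using False
      proof (induction U rule: finite_ne_induct)
        case (insert u U)
        then obtain s where s: "s \<in> U" "U \<subseteq> insert s (underS ?r s)" by blast
        consider "u = s" | "u \<in> underS ?r s" | "s \<in> underS ?r u"
          using card_of_UNIV_underS_total[of u s] by blast
        then show ?case
        proof cases
          case 3
          have "U \<subseteq> underS ?r u" using s(2) 3 card_of_UNIV_underS_mono[OF 3] by blast
          then show ?thesis by blast
        qed (use s in blast)+
      qed auto
      then obtain s where s: "s \<in> U" "U \<subseteq> insert s (underS ?r s)" by blast
      have "C \<subseteq> conditions L (insert s (underS ?r s))"
      proof
        fix c assume c: "c \<in> C"
        then have "set (snd c) \<subseteq> insert s (underS ?r s)" using s(2) unfolding U_def by blast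
        then show "c \<in> conditions L (insert s (underS ?r s))"
          using subsetD[OF C(2) c] by (auto simp: conditions_def)
      qed
      moreover have sV: "s \<in> V" using s(1) UV by blast
      ultimately have "indep f (?S' (insert s (underS ?r s))) ?E"
        using step[OF con[OF sV]] C(1) unfolding consistent_def by blast
      then show ?thesis
        by (rule indep_mono) (use V[OF sV] sV in blast)+
    qed
  qed
  have "consistent L M N f (underS ?r t) (?S' (underS ?r t)) a b" for t
  proof (induction t rule: wf_induct_rule[OF card_of_UNIV_wf])
    case (1 t)
    show ?case
    proof (rule limit)
      fix s assume s: "s \<in> underS ?r t"
      show "underS ?r s \<subseteq> underS ?r t" by (rule card_of_UNIV_underS_mono[OF s])
      show "consistent L M N f (underS ?r s) (?S' (underS ?r s)) a b"
        by (rule 1) (use s in \<open>auto simp: underS_def\<close>)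
    qed
  qed
  note below = this
  have all: "consistent L M N f UNIV (?S' UNIV) a b" by (rule limit) (rule subset_UNIV, rule below)
  show ?thesis
  proof
    have "\<exists>t. a t = x" if x: "range x \<subseteq> Dom M" for x
    proof -
      have "\<forall>j. \<exists>k. c k = x j" using x unfolding c[symmetric] by (auto simp: image_subset_iff image_iff eq_commute)
      then obtain \<kappa> where \<kappa>: "\<And>j. c (\<kappa> j) = x j" by metis
      obtain t where "task t = (True, \<kappa>)" using task by (metis surjD)
      then have "a t = x" using F[of t] \<kappa> unfolding Ft[of t] P_def by auto
      then show ?thesis ..
    qed
    then show "range a = {x. range x \<subseteq> Dom M}" using aM by blast
    have "\<exists>t. b t = y" if y: "range y \<subseteq> Dom N" for y
    proof -
      have "\<forall>j. \<exists>k. d k = y j" using y unfolding d[symmetric] by (auto simp: image_subset_iff image_iff eq_commute)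
      then obtain \<kappa> where \<kappa>: "\<And>j. d (\<kappa> j) = y j" by metis
      obtain t where "task t = (False, \<kappa>)" using task by (metis surjD)
      then have "b t = y" using F[of t] \<kappa> unfolding Ft[of t] P_def by auto
      then show ?thesis ..
    qed
    then show "range b = {y. range y \<subseteq> Dom N}" using bN by blast
    fix C assume "finite C" "C \<subseteq> conditions L (UNIV :: 'k set set set)"
    then have "indep f (?S' UNIV) {j. agree M N C (\<lambda>s. a s j) (\<lambda>s. b s j)}"
      using all unfolding consistent_def by blast
    \<comment> \<open>With an empty prescription, independence says that the agreement set is
      nonempty.\<close>
    from this[unfolded indep_def, rule_format, OF card_of_empty Int_empty_left]
    show "\<exists>j. agree M N C (\<lambda>s. a s j) (\<lambda>s. b s j)" by blast
  qed
qed

text \<open>\<open>T\<close> names the elements of both structures, repetitions allowed. Equations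
  between variables make the passage from \<alpha> t to \<beta> t a well-defined injection. That a
  function takes a given value is again an atomic formula, so functions are preserved as
  well.\<close>

lemma isomorphic_by_atomic:
  assumes A: "is_structure L A" and B: "is_structure L B"
    and \<alpha>: "\<alpha> ` T = Dom A" and \<beta>: "\<beta> ` T = Dom B"
    and Eq: "\<And>s t e. is_fm L (Eq s t) \<Longrightarrow> range e \<subseteq> T \<Longrightarrow>
      sat A (\<lambda>n. \<alpha> (e n)) (Eq s t) \<longleftrightarrow> sat B (\<lambda>n. \<beta> (e n)) (Eq s t)"
    and Rel: "\<And>r ts e. is_fm L (Rel r ts) \<Longrightarrow> range e \<subseteq> T \<Longrightarrow>
      sat A (\<lambda>n. \<alpha> (e n)) (Rel r ts) \<longleftrightarrow> sat B (\<lambda>n. \<beta> (e n)) (Rel r ts)"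
  shows "isomorphic L A B"
proof -
  \<comment> \<open>A list of names continued by the default \<open>t\<close>. In
    \<open>f_eq\<close> the variable \<open>Var (length ts)\<close> is the first one past the list
    and so denotes \<open>t\<close>.\<close>
  let ?e = "\<lambda>ts t n. if n < length ts then ts ! n else t"
  have e_range: "range (?e ts t) \<subseteq> T" if "set ts \<subseteq> T" "t \<in> T" for ts t
    using that nth_mem by (auto simp: subset_iff)
  have e_map: "map (\<lambda>n. \<gamma> (?e ts t n)) [0..<length ts] = map \<gamma> ts" for \<gamma> :: "'t \<Rightarrow> 'x" and ts t
    by (rule nth_equalityI) simp_all
  have eq: "\<alpha> s = \<alpha> t \<longleftrightarrow> \<beta> s = \<beta> t" if "s \<in> T" "t \<in> T" for s t
    using Eq[of "Var 0" "Var 1" "?e [s] t"] e_range[of "[s]" t] that by simp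
  have f_eq: "fun_int A f (map \<alpha> ts) = \<alpha> t \<longleftrightarrow> fun_int B f (map \<beta> ts) = \<beta> t"
    if "f \<in> funs L" "length ts = funar L f" "set ts \<subseteq> T" "t \<in> T" for f ts t
  proof -
    let ?l = "App f (map Var [0..<length ts])" and ?r = "Var (length ts)"
    have "is_fm L (Eq ?l ?r)" using that by auto
    from Eq[OF this e_range[OF that(3,4)]] show ?thesis
      by (simp add: o_def e_map)
  qed
  have r_iff: "rel_int A r (map \<alpha> ts) \<longleftrightarrow> rel_int B r (map \<beta> ts)"
    if "r \<in> rels L" "length ts = relar L r" "set ts \<subseteq> T" for r ts
  proof -
    have "\<alpha> ` T \<noteq> {}" using A unfolding \<alpha> is_structure_def by blast
    then obtain t where t: "t \<in> T" by blast
    have "is_fm L (Rel r (map Var [0..<length ts]))" using that by auto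
    from Rel[OF this e_range[OF that(3) t]] show ?thesis by (simp add: o_def e_map)
  qed
  define g where "g x = (SOME t. t \<in> T \<and> \<alpha> t = x)" for x
  have g: "g x \<in> T" "\<alpha> (g x) = x" if "x \<in> Dom A" for x
    using someI_ex[of "\<lambda>t. t \<in> T \<and> \<alpha> t = x"] that unfolding \<alpha>[symmetric] g_def by blast+
  define h where "h x = \<beta> (g x)" for x
  have h: "h (\<alpha> t) = \<beta> t" if "t \<in> T" for t
  proof -
    have "\<alpha> t \<in> Dom A" using \<alpha> that by blast
    then show ?thesis using eq[OF g(1) that] g(2) unfolding h_def by blast
  qed
  have lift: "map \<alpha> (map g as) = as" "map \<beta> (map g as) = map h as" "set (map g as) \<subseteq> T" if "set as \<subseteq> Dom A" for as
    using that g by (auto simp: h_def map_idI subset_iff)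
  have "bij_betw h (Dom A) (Dom B)"
  proof (rule bij_betw_imageI)
    show "inj_on h (Dom A)"
      by (rule inj_onI) (metis eq g h_def)
    have "h ` \<alpha> ` T = \<beta> ` T" using h by (auto simp: image_iff)
    then show "h ` Dom A = Dom B" by (simp add: \<alpha> \<beta>)
  qed
  moreover have "h (fun_int A f as) = fun_int B f (map h as)"
    if f: "f \<in> funs L" and as: "set as \<subseteq> Dom A" "length as = funar L f" for f as
  proof -
    have "fun_int A f as \<in> Dom A" using A f as unfolding is_structure_def by blast
    then obtain t where t: "t \<in> T" "fun_int A f as = \<alpha> t" using \<alpha> by blast
    have "fun_int B f (map \<beta> (map g as)) = \<beta> t"
      using f_eq[OF f _ lift(3)[OF as(1)] t(1)] lift(1)[OF as(1)] as(2) t(2) by simp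
    then show ?thesis unfolding lift(2)[OF as(1)] t(2) h[OF t(1)] by simp
  qed
  moreover have "rel_int A r as \<longleftrightarrow> rel_int B r (map h as)"
    if r: "r \<in> rels L" and as: "set as \<subseteq> Dom A" "length as = relar L r" for r as
    using r_iff[OF r _ lift(3)[OF as(1)]] as(2) unfolding lift(1,2)[OF as(1)] by simp
  ultimately show ?thesis unfolding isomorphic_def by blast
qed

lemma red_power_is_structure: "is_structure L M \<Longrightarrow> is_structure L (red_power I F M)"
  unfolding red_power_def by (rule red_prod_is_structure)

lemma red_power_Dom: "Dom (red_power I F M) = red_class I F (\<lambda>_. M) ` prod_Dom I (\<lambda>_. M)"
  unfolding red_power_def by (rule red_prod_Dom)

lemma palyutin_red_power:
  assumes "is_structure L M" "proper_filter_on I F" "\<phi> \<in> palyutin L" "range e \<subseteq> prod_Dom I (\<lambda>_. M)"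
  shows "sat (red_power I F M) (\<lambda>n. red_class I F (\<lambda>_. M) (e n)) \<phi>
           \<longleftrightarrow> eventually (\<lambda>i. sat M (\<lambda>n. e n i) \<phi>) F"
  unfolding red_power_def by (rule palyutin_red_prod) (use assms in auto)

text \<open>The matched functions exhaust both powers, so their classes name all elements on either
  side. The ultrafilter contains the agreement set of every single condition, and the Los theorem
  turns this into preservation of atomic formulas.\<close>

theorem keisler_shelah:
  fixes M :: "('f, 'p, 'a) fo_structure" and N :: "('f, 'p, 'b) fo_structure"
  assumes inf: "infinite (UNIV :: 'k set)"
    and M: "is_structure L M" "|Dom M| \<le>o |UNIV :: 'k set|"
    and N: "is_structure L N" "|Dom N| \<le>o |UNIV :: 'k set|"
    and fm: "|UNIV :: ('f, 'p) fm set| \<le>o |UNIV :: 'k set|"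
    and MN: "elem_equiv L M N"
  obtains U :: "'k set filter"
  where "ultrafilter_on UNIV U" "isomorphic L (red_power UNIV U M) (red_power UNIV U N)"
proof -
  obtain a :: "'k set set \<Rightarrow> 'k set \<Rightarrow> 'a" and b :: "'k set set \<Rightarrow> 'k set \<Rightarrow> 'b"
    where a: "range a = {x. range x \<subseteq> Dom M}" and b: "range b = {y. range y \<subseteq> Dom N}"
      and fip: "\<And>C. finite C \<Longrightarrow> C \<subseteq> conditions L UNIV \<Longrightarrow> \<exists>j. agree M N C (\<lambda>s. a s j) (\<lambda>s. b s j)"
    by (rule generic_matching_family[OF inf M N fm MN]) (rule that)
  let ?E = "\<lambda>c. {j. agree M N {c} (\<lambda>s. a s j) (\<lambda>s. b s j)}"
  have fip': "(\<Inter>c\<in>C. ?E c) \<noteq> {}" if C: "finite C" "C \<subseteq> conditions L UNIV" for C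
  proof -
    obtain j where "agree M N C (\<lambda>s. a s j) (\<lambda>s. b s j)" using fip[OF C] by blast
    then have "j \<in> (\<Inter>c\<in>C. ?E c)" by (auto simp: agree_def)
    then show ?thesis by blast
  qed
  obtain U where U: "ultrafilter_on UNIV U" "\<And>c. c \<in> conditions L UNIV \<Longrightarrow> eventually (\<lambda>j. j \<in> ?E c) U"
    by (rule ultrafilter_of_fip[of "conditions L UNIV" ?E, OF fip']) (assumption, assumption, rule that)
  have ev: "\<forall>\<^sub>F j in U. sat M (\<lambda>n. a (e n) j) \<phi> \<longleftrightarrow> sat N (\<lambda>n. b (e n) j) \<phi>" if \<phi>: "is_fm L \<phi>" for \<phi> e
  proof -
    obtain k where k: "free_vars \<phi> \<subseteq> {..<k}"
      using finite_free_vars[of \<phi>] by (auto simp: finite_nat_set_iff_bounded)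
    let ?l = "map e [0..<k]"
    have "(\<phi>, ?l) \<in> conditions L UNIV" using \<phi> k by (simp add: conditions_def)
    from U(2)[OF this] have "\<forall>\<^sub>F j in U. sat M (\<lambda>n. a (?l ! n) j) \<phi> \<longleftrightarrow> sat N (\<lambda>n. b (?l ! n) j) \<phi>"
      by (simp only: agree_def mem_Collect_eq ball_simps prod.case simp_thms)
    moreover have "sat M (\<lambda>n. a (?l ! n) j) \<phi> \<longleftrightarrow> sat M (\<lambda>n. a (e n) j) \<phi>" for j
      by (rule sat_cong) (use k in auto)
    moreover have "sat N (\<lambda>n. b (?l ! n) j) \<phi> \<longleftrightarrow> sat N (\<lambda>n. b (e n) j) \<phi>" for j
      by (rule sat_cong) (use k in auto)
    ultimately show ?thesis by (simp only:)
  qed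
  have U': "proper_filter_on UNIV U" using U(1) by (simp add: ultrafilter_on_def)
  have prod: "prod_Dom UNIV (\<lambda>_. R) = {x. range x \<subseteq> Dom R}" for R :: "('f, 'p, 'c) fo_structure"
    by (auto simp: prod_Dom_def)
  let ?\<alpha> = "\<lambda>t. red_class UNIV U (\<lambda>_. M) (a t)" and ?\<beta> = "\<lambda>t. red_class UNIV U (\<lambda>_. N) (b t)"
  have atomic: "sat (red_power UNIV U M) (\<lambda>n. ?\<alpha> (e n)) \<phi> \<longleftrightarrow> sat (red_power UNIV U N) (\<lambda>n. ?\<beta> (e n)) \<phi>"
    if \<phi>: "\<phi> \<in> palyutin L" for \<phi> e
  proof -
    have ea: "range (\<lambda>n. a (e n)) \<subseteq> prod_Dom UNIV (\<lambda>_. M)" unfolding prod using a by blast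
    have eb: "range (\<lambda>n. b (e n)) \<subseteq> prod_Dom UNIV (\<lambda>_. N)" unfolding prod using b by blast
    have "sat (red_power UNIV U M) (\<lambda>n. ?\<alpha> (e n)) \<phi> \<longleftrightarrow> (\<forall>\<^sub>F j in U. sat M (\<lambda>n. a (e n) j) \<phi>)"
      by (rule palyutin_red_power[OF M(1) U' \<phi> ea])
    also have "\<dots> \<longleftrightarrow> (\<forall>\<^sub>F j in U. sat N (\<lambda>n. b (e n) j) \<phi>)"
      by (rule eventually_subst[OF ev[OF palyutin_is_fm[OF \<phi>]]])
    also have "\<dots> \<longleftrightarrow> sat (red_power UNIV U N) (\<lambda>n. ?\<beta> (e n)) \<phi>"
      by (rule palyutin_red_power[OF N(1) U' \<phi> eb, symmetric])
    finally show ?thesis .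
  qed
  have "isomorphic L (red_power UNIV U M) (red_power UNIV U N)"
  proof (rule isomorphic_by_atomic[where T = UNIV and \<alpha> = ?\<alpha> and \<beta> = ?\<beta>])
    show "range ?\<alpha> = Dom (red_power UNIV U M)"
      unfolding red_power_Dom prod a[symmetric] by (simp add: image_image)
    show "range ?\<beta> = Dom (red_power UNIV U N)"
      unfolding red_power_Dom prod b[symmetric] by (simp add: image_image)
    show "is_structure L (red_power UNIV U M)" by (rule red_power_is_structure[OF M(1)])
    show "is_structure L (red_power UNIV U N)" by (rule red_power_is_structure[OF N(1)])
  qed (rule atomic, erule palyutin.Eq palyutin.Rel)+
  then show ?thesis using that U(1) by blast
qed

section \<open>Isomorphic reduced powers\<close>

text \<open>Functions on the product of \<omega> and \<open>J\<close> name the elements of both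
  sides, on the right through their slices. Unfolding \<open>Fin_otimes\<close> gives two nested
  quantifiers: the inner one is truth in the Frechet power, the outer one truth in its power modulo
  \<open>U\<close>, each by the Los theorem.\<close>

lemma red_power_Fin_otimes_isomorphic:
  assumes M: "is_structure L M" and U: "proper_filter_on J U"
  shows "isomorphic L (red_power (UNIV \<times> J) (Fin_otimes U) M)
           (red_power J U (red_power (UNIV :: nat set) cofinite M))"
proof -
  let ?P = "red_power (UNIV :: nat set) cofinite M"
  let ?T = "prod_Dom (UNIV \<times> J) (\<lambda>_. M)"
  let ?slice = "\<lambda>x j n. x (n, j)"
  let ?c = "red_class (UNIV :: nat set) cofinite (\<lambda>_. M)"
  let ?\<alpha> = "red_class (UNIV \<times> J) (Fin_otimes U) (\<lambda>_. M)"
  let ?\<beta>' = "\<lambda>x. \<lambda>j\<in>J. ?c (?slice x j)"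
  let ?\<beta> = "\<lambda>x. red_class J U (\<lambda>_. ?P) (?\<beta>' x)"
  have P: "is_structure L ?P" by (rule red_power_is_structure[OF M])
  have J: "eventually (\<lambda>j. j \<in> J) U" using U by (simp add: proper_filter_on_def le_principal)
  have slice: "?slice x j \<in> prod_Dom UNIV (\<lambda>_. M)" if "x \<in> ?T" "j \<in> J" for x j
    using that by (auto simp: prod_Dom_def PiE_iff)
  have \<beta>': "?\<beta>' x \<in> prod_Dom J (\<lambda>_. ?P)" if "x \<in> ?T" for x
    using slice[OF that] by (auto simp: prod_Dom_def red_power_Dom)
  have surj: "\<exists>x\<in>?T. ?\<beta>' x = y" if y: "y \<in> prod_Dom J (\<lambda>_. ?P)" for y
  proof -
    have "\<forall>j\<in>J. \<exists>z. z \<in> prod_Dom UNIV (\<lambda>_. M) \<and> y j = ?c z"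
      using y by (auto simp: prod_Dom_def[of J] red_power_Dom dest!: PiE_mem)
    then obtain z where z: "\<And>j. j \<in> J \<Longrightarrow> z j \<in> prod_Dom UNIV (\<lambda>_. M)" "\<And>j. j \<in> J \<Longrightarrow> y j = ?c (z j)"
      by metis
    let ?x = "\<lambda>(n, j)\<in>UNIV \<times> J. z j n"
    have "?x \<in> ?T" using z(1) by (auto simp: prod_Dom_def)
    moreover have "?\<beta>' ?x = y"
    proof
      fix j show "?\<beta>' ?x j = y j"
        using z(2)[of j] y by (cases "j \<in> J") (auto simp: prod_Dom_def)
    qed
    ultimately show ?thesis by blast
  qed
  have atomic: "sat (red_power (UNIV \<times> J) (Fin_otimes U) M) (\<lambda>n. ?\<alpha> (e n)) \<phi> \<longleftrightarrow>
      sat (red_power J U ?P) (\<lambda>n. ?\<beta> (e n)) \<phi>"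
    if \<phi>: "\<phi> \<in> palyutin L" and e: "range e \<subseteq> ?T" for \<phi> e
  proof -
    have "sat (red_power (UNIV \<times> J) (Fin_otimes U) M) (\<lambda>n. ?\<alpha> (e n)) \<phi> \<longleftrightarrow>
        (\<forall>\<^sub>F j in U. \<forall>\<^sub>F k in cofinite. sat M (\<lambda>n. ?slice (e n) j k) \<phi>)"
      using palyutin_red_power[OF M proper_filter_on_Fin_otimes[OF U] \<phi> e]
      by (simp add: eventually_Fin_otimes)
    also have "\<dots> \<longleftrightarrow> (\<forall>\<^sub>F j in U. sat ?P (\<lambda>n. ?\<beta>' (e n) j) \<phi>)"
    proof (rule eventually_subst)
      show "\<forall>\<^sub>F j in U. (\<forall>\<^sub>F k in cofinite. sat M (\<lambda>n. ?slice (e n) j k) \<phi>) \<longleftrightarrow>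
          sat ?P (\<lambda>n. ?\<beta>' (e n) j) \<phi>"
        using J
      proof eventually_elim
        case (elim j)
        have "range (\<lambda>n. ?slice (e n) j) \<subseteq> prod_Dom UNIV (\<lambda>_. M)" using slice elim e by blast
        from palyutin_red_power[OF M proper_filter_on_cofinite \<phi> this] show ?case
          using elim by simp
      qed
    qed
    also have "\<dots> \<longleftrightarrow> sat (red_power J U ?P) (\<lambda>n. ?\<beta> (e n)) \<phi>"
    proof -
      have "range (\<lambda>n. ?\<beta>' (e n)) \<subseteq> prod_Dom J (\<lambda>_. ?P)" using \<beta>' e by blast
      from palyutin_red_power[OF P U \<phi> this] show ?thesis by (rule sym)
    qed
    finally show ?thesis .
  qed
  show ?thesis
  proof (rule isomorphic_by_atomic[where T = ?T and \<alpha> = ?\<alpha> and \<beta> = ?\<beta>])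
    show "?\<alpha> ` ?T = Dom (red_power (UNIV \<times> J) (Fin_otimes U) M)" by (simp only: red_power_Dom)
    have im: "?\<beta>' ` ?T = prod_Dom J (\<lambda>_. ?P)" using \<beta>' surj by blast
    show "?\<beta> ` ?T = Dom (red_power J U ?P)"
      unfolding red_power_Dom[of J] im[symmetric] image_image ..
    show "is_structure L (red_power (UNIV \<times> J) (Fin_otimes U) M)" by (rule red_power_is_structure[OF M])
    show "is_structure L (red_power J U ?P)" by (rule red_power_is_structure[OF P])
  qed (rule atomic, erule palyutin.Eq palyutin.Rel, assumption)+
qed

text \<open>Needed because \<open>Fin_otimes U\<close> lives on pairs, whereas the filters
  quantified over in (iv) and (v) live on the index type itself.\<close>

lemma red_power_reindex_isomorphic:
  assumes M: "is_structure L M" and F: "proper_filter_on I F" and g: "inj_on g I"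
  shows "isomorphic L (red_power I F M) (red_power (g ` I) (filtermap g F) M)"
    and "proper_filter_on (g ` I) (filtermap g F)"
proof -
  have I: "eventually (\<lambda>i. i \<in> I) F" using F by (simp add: proper_filter_on_def le_principal)
  have "eventually (\<lambda>i. g i \<in> g ` I) F" using I by (rule eventually_mono) blast
  then show F': "proper_filter_on (g ` I) (filtermap g F)"
    using F by (simp add: proper_filter_on_def le_principal eventually_filtermap filtermap_bot_iff)
  let ?T = "prod_Dom I (\<lambda>_. M)"
  let ?\<alpha> = "red_class I F (\<lambda>_. M)"
  let ?\<beta>' = "\<lambda>x. \<lambda>j\<in>g ` I. x (inv_into I g j)"
  let ?\<beta> = "\<lambda>x. red_class (g ` I) (filtermap g F) (\<lambda>_. M) (?\<beta>' x)"
  have \<beta>': "?\<beta>' x \<in> prod_Dom (g ` I) (\<lambda>_. M)" if "x \<in> ?T" for x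
    unfolding prod_Dom_def restrict_PiE_iff
  proof
    fix j assume "j \<in> g ` I"
    then have "inv_into I g j \<in> I" by (rule inv_into_into)
    with that show "x (inv_into I g j) \<in> Dom M" unfolding prod_Dom_def by (rule PiE_mem)
  qed
  have surj: "\<exists>x\<in>?T. ?\<beta>' x = y" if y: "y \<in> prod_Dom (g ` I) (\<lambda>_. M)" for y
  proof -
    let ?x = "\<lambda>i\<in>I. y (g i)"
    have "?x \<in> ?T" using y by (simp add: prod_Dom_def PiE_iff)
    moreover have "?\<beta>' ?x = y"
    proof
      fix j show "?\<beta>' ?x j = y j"
      proof (cases "j \<in> g ` I")
        case True
        then show ?thesis by (simp add: inv_into_into f_inv_into_f)
      next
        case False
        then show ?thesis using PiE_arb[OF y[unfolded prod_Dom_def]] by simp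
      qed
    qed
    ultimately show ?thesis by blast
  qed
  have atomic: "sat (red_power I F M) (\<lambda>n. ?\<alpha> (e n)) \<phi> \<longleftrightarrow>
      sat (red_power (g ` I) (filtermap g F) M) (\<lambda>n. ?\<beta> (e n)) \<phi>"
    if \<phi>: "\<phi> \<in> palyutin L" and e: "range e \<subseteq> ?T" for \<phi> e
  proof -
    have e': "range (\<lambda>n. ?\<beta>' (e n)) \<subseteq> prod_Dom (g ` I) (\<lambda>_. M)" using \<beta>' e by blast
    have "sat (red_power I F M) (\<lambda>n. ?\<alpha> (e n)) \<phi> \<longleftrightarrow> (\<forall>\<^sub>F i in F. sat M (\<lambda>n. e n i) \<phi>)"
      by (rule palyutin_red_power[OF M F \<phi> e])
    also have "\<dots> \<longleftrightarrow> (\<forall>\<^sub>F i in F. sat M (\<lambda>n. ?\<beta>' (e n) (g i)) \<phi>)"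
      by (rule eventually_subst, use I in eventually_elim) (simp add: inv_into_f_f[OF g])
    also have "\<dots> \<longleftrightarrow> sat (red_power (g ` I) (filtermap g F) M) (\<lambda>n. ?\<beta> (e n)) \<phi>"
      using palyutin_red_power[OF M F' \<phi> e'] by (simp only: eventually_filtermap)
    finally show ?thesis .
  qed
  show "isomorphic L (red_power I F M) (red_power (g ` I) (filtermap g F) M)"
  proof (rule isomorphic_by_atomic[where T = ?T and \<alpha> = ?\<alpha> and \<beta> = ?\<beta>])
    show "?\<alpha> ` ?T = Dom (red_power I F M)" by (simp only: red_power_Dom)
    have im: "?\<beta>' ` ?T = prod_Dom (g ` I) (\<lambda>_. M)" using \<beta>' surj by blast
    show "?\<beta> ` ?T = Dom (red_power (g ` I) (filtermap g F) M)"
      unfolding red_power_Dom[of "g ` I"] im[symmetric] image_image ..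
    show "is_structure L (red_power I F M)" "is_structure L (red_power (g ` I) (filtermap g F) M)"
      by (rule red_power_is_structure[OF M])+
  qed (rule atomic, erule palyutin.Eq palyutin.Rel, assumption)+
qed

text \<open>A sequence is coded by its graph, a subset of the product of \<omega> and
  \<open>'a\<close>, and this product embeds into \<open>'x\<close>.\<close>

lemma card_of_sequences:
  assumes inf: "infinite (UNIV :: 'x set)" and le: "|UNIV :: 'a set| \<le>o |UNIV :: 'x set|"
  shows "|UNIV :: (nat \<Rightarrow> 'a) set| \<le>o |UNIV :: 'x set set|"
proof -
  have "|UNIV :: nat set| \<le>o |UNIV :: 'x set|" using inf infinite_iff_card_of_nat by blast
  then have "|(UNIV :: nat set) \<times> (UNIV :: 'a set)| \<le>o |UNIV :: 'x set|"
    using inf le by (intro card_of_Sigma_ordLeq_infinite) auto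
  then obtain h :: "nat \<times> 'a \<Rightarrow> 'x" where h: "inj h"
    unfolding card_of_ordLeq[symmetric] by auto
  have "inj (\<lambda>x :: nat \<Rightarrow> 'a. range (\<lambda>n. h (n, x n)))"
  proof (rule injI, rule ext)
    fix x y :: "nat \<Rightarrow> 'a" and n
    assume "range (\<lambda>n. h (n, x n)) = range (\<lambda>n. h (n, y n))"
    then have "h (n, x n) \<in> range (\<lambda>n. h (n, y n))" by blast
    then show "x n = y n" by (auto dest: injD[OF h])
  qed
  then show ?thesis by (rule card_of_ordLeqI) simp
qed

lemma card_of_frechet_power:
  assumes "infinite (UNIV :: 'x set)" "|UNIV :: 'a set| \<le>o |UNIV :: 'x set|"
  shows "|Dom (red_power UNIV cofinite M :: ('f, 'p, (nat \<Rightarrow> 'a) set) fo_structure)| \<le>o |UNIV :: 'x set set|"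
proof -
  have "|Dom (red_power UNIV cofinite M :: ('f, 'p, (nat \<Rightarrow> 'a) set) fo_structure)| \<le>o |UNIV :: (nat \<Rightarrow> 'a) set|"
    by (rule surj_imp_ordLeq[of _ "red_class UNIV cofinite (\<lambda>_. M)"]) (auto simp: red_power_Dom)
  then show ?thesis using card_of_sequences[OF assms] ordLeq_transitive by blast
qed

lemma palyutin_equiv_sym: "palyutin_equiv L M N \<Longrightarrow> palyutin_equiv L N M"
  by (simp add: palyutin_equiv_def)

lemma palyutin_equiv_trans:
  "palyutin_equiv L M N \<Longrightarrow> palyutin_equiv L N K \<Longrightarrow> palyutin_equiv L M K"
  by (simp add: palyutin_equiv_def)

lemma palyutin_equiv_red_power_iff:
  assumes "is_structure L M" "is_structure L N" "proper_filter_on I F" "proper_filter_on J G"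
  shows "palyutin_equiv L (red_power I F M) (red_power J G N) \<longleftrightarrow> palyutin_equiv L M N"
  using palyutin_equiv_red_power[OF assms(1,3)] palyutin_equiv_red_power[OF assms(2,4)]
  by (meson palyutin_equiv_sym palyutin_equiv_trans)

text \<open>The sum type \<open>?X\<close> bounds the symbols and both domains, so the Frechet
  powers have at most 2^|?X| elements. With this cardinal as \<kappa>, the index set 2^\<kappa> of
  \<open>keisler_shelah\<close> is exactly the type \<open>idx\<close>: this is the origin of its
  two power sets.\<close>

lemma palyutin_equiv_imp_isomorphic_Fin_otimes:
  fixes M :: "('f, 'p, 'a) fo_structure" and N :: "('f, 'p, 'b) fo_structure"
  assumes M: "is_structure L M" and N: "is_structure L N" and MN: "palyutin_equiv L M N"
  obtains U :: "('j, 'f, 'p, 'a, 'b) idx filter"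
  where "ultrafilter_on UNIV U"
    "isomorphic L (red_power (UNIV \<times> UNIV) (Fin_otimes U) M) (red_power (UNIV \<times> UNIV) (Fin_otimes U) N)"
proof -
  let ?X = "UNIV :: ('j + 'f + 'p + 'a + 'b + nat) set"
  let ?K = "UNIV :: ('j + 'f + 'p + 'a + 'b + nat) set set"
  have X: "infinite ?X" by simp
  have XK: "|?X| \<le>o |?K|" using card_of_Pow[of ?X] by (simp add: ordLess_imp_ordLeq)
  then have K: "infinite ?K" using X card_of_ordLeq_infinite by blast
  have f: "|UNIV :: 'f set| \<le>o |?X|" by (rule card_of_ordLeqI[of "\<lambda>x. Inr (Inl x)"]) (auto simp: inj_def)
  have p: "|UNIV :: 'p set| \<le>o |?X|" by (rule card_of_ordLeqI[of "\<lambda>x. Inr (Inr (Inl x))"]) (auto simp: inj_def)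
  have a: "|UNIV :: 'a set| \<le>o |?X|" by (rule card_of_ordLeqI[of "\<lambda>x. Inr (Inr (Inr (Inl x)))"]) (auto simp: inj_def)
  have b: "|UNIV :: 'b set| \<le>o |?X|" by (rule card_of_ordLeqI[of "\<lambda>x. Inr (Inr (Inr (Inr (Inl x))))"]) (auto simp: inj_def)
  have fm: "|UNIV :: ('f, 'p) fm set| \<le>o |?K|" by (rule ordLeq_transitive[OF card_of_fm[OF X f p] XK])
  let ?P = "red_power (UNIV :: nat set) cofinite M" and ?Q = "red_power (UNIV :: nat set) cofinite N"
  obtain U :: "('j, 'f, 'p, 'a, 'b) idx filter" where U: "ultrafilter_on UNIV U"
    and iso: "isomorphic L (red_power UNIV U ?P) (red_power UNIV U ?Q)"
    by (rule keisler_shelah[OF K red_power_is_structure[OF M] card_of_frechet_power[OF X a]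
        red_power_is_structure[OF N] card_of_frechet_power[OF X b] fm
        palyutin_equiv_imp_frechet_power_elem_equiv[OF M N MN]]) (rule that)
  have U': "proper_filter_on UNIV U" using U by (simp add: ultrafilter_on_def)
  have 1: "isomorphic L (red_power (UNIV \<times> UNIV) (Fin_otimes U) M) (red_power UNIV U ?P)"
    by (rule red_power_Fin_otimes_isomorphic[OF M U'])
  have 2: "isomorphic L (red_power UNIV U ?Q) (red_power (UNIV \<times> UNIV) (Fin_otimes U) N)"
    by (rule isomorphic_sym[OF red_power_is_structure[OF N] red_power_Fin_otimes_isomorphic[OF N U']])
  from that[OF U isomorphic_trans[OF 1 isomorphic_trans[OF iso 2]]] show ?thesis .
qed

lemma inj_nat_prod:
  assumes "infinite (UNIV :: 'x set)"
  obtains g :: "nat \<times> 'x \<Rightarrow> 'x" where "inj g"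
proof -
  have "|UNIV :: nat set| \<le>o |UNIV :: 'x set|" using assms infinite_iff_card_of_nat by blast
  then have "|(UNIV :: nat set) \<times> (UNIV :: 'x set)| \<le>o |UNIV :: 'x set|"
    using assms by (intro card_of_Sigma_ordLeq_infinite) (auto simp: card_of_refl ordIso_imp_ordLeq)
  then show ?thesis using that unfolding card_of_ordLeq[symmetric] by auto
qed

theorem theorem1p13:
  fixes L :: "('f, 'p) fo_signature"
    and M :: "('f, 'p, 'a) fo_structure"
    and N :: "('f, 'p, 'b) fo_structure"
  assumes "is_structure L M" and "is_structure L N"
  shows
    "(palyutin_equiv L M N \<longleftrightarrow>
        elem_equiv L (red_power UNIV cofinite M :: ('f, 'p, (nat \<Rightarrow> 'a) set) fo_structure)
                     (red_power UNIV cofinite N :: ('f, 'p, (nat \<Rightarrow> 'b) set) fo_structure)) \<and>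
     (palyutin_equiv L M N \<longleftrightarrow>
        (\<exists>(J :: ('j, 'f, 'p, 'a, 'b) idx set) U. ultrafilter_on J U \<and>
           isomorphic L (red_power (UNIV \<times> J) (Fin_otimes U) M)
                        (red_power (UNIV \<times> J) (Fin_otimes U) N))) \<and>
     (palyutin_equiv L M N \<longleftrightarrow>
        (\<exists>(I :: ('j, 'f, 'p, 'a, 'b) idx set) F. proper_filter_on I F \<and>
           isomorphic L (red_power I F M) (red_power I F N))) \<and>
     (palyutin_equiv L M N \<longleftrightarrow>
        (\<exists>(I :: ('j, 'f, 'p, 'a, 'b) idx set) F. proper_filter_on I F \<and>
           palyutin_equiv L (red_power I F M) (red_power I F N)))"
proof -
  note M = assms(1) and N = assms(2)
  note pal_iff = palyutin_equiv_red_power_iff[OF M N]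
  \<comment> \<open>The index type \<open>'i\<close> is left open, since (iii) needs pairs and (iv)
    the type \<open>idx\<close>.\<close>
  have iso_imp: "palyutin_equiv L M N"
    if "proper_filter_on I F" "isomorphic L (red_power I F M) (red_power I F N)" for I :: "'i set" and F
    using isomorphic_imp_elem_equiv[OF red_power_is_structure[OF M] that(2)] pal_iff[OF that(1,1)]
    by (blast dest: elem_equiv_imp_palyutin_equiv)
  have i_ii: "palyutin_equiv L M N \<longleftrightarrow>
      elem_equiv L (red_power (UNIV :: nat set) cofinite M) (red_power (UNIV :: nat set) cofinite N)"
    using palyutin_equiv_imp_frechet_power_elem_equiv[OF M N]
      pal_iff[OF proper_filter_on_cofinite proper_filter_on_cofinite]
      elem_equiv_imp_palyutin_equiv by blast
  have i_iii: "\<exists>(J :: ('j, 'f, 'p, 'a, 'b) idx set) U. ultrafilter_on J U \<and>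
      isomorphic L (red_power (UNIV \<times> J) (Fin_otimes U) M) (red_power (UNIV \<times> J) (Fin_otimes U) N)"
    if MN: "palyutin_equiv L M N"
    by (rule palyutin_equiv_imp_isomorphic_Fin_otimes[OF M N MN]) blast
  have iii_i: "palyutin_equiv L M N"
    if "ultrafilter_on J U" "isomorphic L (red_power (UNIV \<times> J) (Fin_otimes U) M)
      (red_power (UNIV \<times> J) (Fin_otimes U) N)" for J :: "('j, 'f, 'p, 'a, 'b) idx set" and U
    by (rule iso_imp[OF proper_filter_on_Fin_otimes that(2)]) (use that(1) in \<open>simp add: ultrafilter_on_def\<close>)
  have i_iv: "\<exists>(I :: ('j, 'f, 'p, 'a, 'b) idx set) F. proper_filter_on I F \<and>
      isomorphic L (red_power I F M) (red_power I F N)" if MN: "palyutin_equiv L M N"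
  proof -
    obtain J :: "('j, 'f, 'p, 'a, 'b) idx set" and U where "ultrafilter_on J U"
      and iso: "isomorphic L (red_power (UNIV \<times> J) (Fin_otimes U) M) (red_power (UNIV \<times> J) (Fin_otimes U) N)"
      using i_iii[OF MN] by blast
    then have F: "proper_filter_on (UNIV \<times> J) (Fin_otimes U)"
      by (intro proper_filter_on_Fin_otimes) (simp add: ultrafilter_on_def)
    \<comment> \<open>The filter from (iii) lives on pairs; an infinite type absorbs the factor
      \<omega>, so the filter can be transported back into \<open>idx\<close> along an
      injection.\<close>
    have "infinite (UNIV :: ('j, 'f, 'p, 'a, 'b) idx set)" by (simp add: Finite_Set.finite_set)
    then obtain g :: "nat \<times> ('j, 'f, 'p, 'a, 'b) idx \<Rightarrow> ('j, 'f, 'p, 'a, 'b) idx" where "inj g"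
      by (rule inj_nat_prod)
    then have g: "inj_on g (UNIV \<times> J)" by (rule inj_on_subset) simp
    let ?I = "g ` (UNIV \<times> J)" and ?F = "filtermap g (Fin_otimes U)"
    note reM = red_power_reindex_isomorphic[OF M F g] and reN = red_power_reindex_isomorphic[OF N F g]
    have "isomorphic L (red_power ?I ?F M) (red_power ?I ?F N)"
      by (rule isomorphic_trans[OF isomorphic_sym[OF red_power_is_structure[OF M] reM(1)]
            isomorphic_trans[OF iso reN(1)]])
    then show ?thesis using reM(2) by blast
  qed
  have i_v: "\<exists>(I :: ('j, 'f, 'p, 'a, 'b) idx set) F. proper_filter_on I F \<and>
      palyutin_equiv L (red_power I F M) (red_power I F N)" if "palyutin_equiv L M N"
    using i_iv[OF that] pal_iff that by blast
  show ?thesis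
    using i_ii i_iii iii_i i_iv iso_imp i_v pal_iff by blast
qed

end
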